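(* Let $n\ge5$ and let $(S^n,g_0)$ be the round unit sphere $S^n\subset\mathbb{R}^{n+1}$. Let \[ \mathcal{V}_{1,4} := \Bigl\{ u\in C^\infty(S^n) : u>0,\ \int_{S^n} u^{\frac{4n}{n-4}}\,d\mathrm{vol}_{g_0}=\omega_n,\ \text{the scalar curvature of } u^{\frac{8}{n-4}}g_0 \text{ is positive}\Bigr\}, \] an open subset of the constraint set $\{u: \int u^{4n/(n-4)}=\omega_n\}$, and let $\mathcal{E}_{\sigma_2}(u):=\int_{S^n} u\,L_{\sigma_2}(u,u,u)\,d\mathrm{vol}_{g_0}$. If $u\in\mathcal{V}_{1,4}$ is a local minimizer of $\mathcal{E}_{\sigma_2}\colon\mathcal{V}_{1,4}\to\mathbb{R}$, then there is a point $\xi\in B^{n+1}$ (the open unit ball of $\mathbb{R}^{n+1}$) such that \[ u(\zeta) = \left(\frac{1+\xi\cdot\zeta}{(1-|\xi|^2)^{1/2}}\right)^{-\frac{n-4}{4}} \quad\text{for all }\zeta\in S^n, \] i.e. $u^{8/(n-4)}g_0$ has constant sectional curvature one.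
   Context: $\omega_n$ is the volume of the round unit $S^n$. All geometric quantities are taken with respect to $g_0$: $\nabla$ is the gradient, $\delta$ the divergence, $d$ the exterior derivative, $\Delta=\delta d$ the (nonpositive) Laplacian. $L_{\sigma_2}$ is the symmetric trilinear differential operator (the polarization) whose diagonal is \[ L_{\sigma_2}(u,u,u) = \tfrac12\delta\bigl(|\nabla u|^2du\bigr) - \tfrac{n-4}{16}\bigl(u\Delta|\nabla u|^2 - \delta((\Delta u^2)du)\bigr) - \tfrac{n-1}{4}\bigl(\tfrac{n-4}{4}\bigr)^2 u\Delta u^2 + \tfrac{n(n-1)}{8}\bigl(\tfrac{n-4}{4}\bigr)^3u^3. \] "Local minimizer" means $\mathcal{E}_{\sigma_2}(v)\ge\mathcal{E}_{\sigma_2}(u)$ for all $v\in\mathcal{V}_{1,4}$ near $u$ in the $C^\infty$ topology. *)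

theory Defs
  imports "HOL-Analysis.Analysis"
begin

text \<open>The round sphere S^n is sphere 0 1 in a Euclidean space 'a with DIM('a) = n+1.
  Functions on S^n are represented by functions u :: 'a => real (values off the sphere
  are irrelevant); they are studied through the 0-homogeneous extension.\<close>

definition hext :: "('a::euclidean_space \<Rightarrow> 'b) \<Rightarrow> 'a \<Rightarrow> 'b" where
  "hext u x = u (x /\<^sub>R norm x)"

definition pd1 :: "'a::euclidean_space \<Rightarrow> ('a \<Rightarrow> real) \<Rightarrow> 'a \<Rightarrow> real" where
  "pd1 b f x = deriv (\<lambda>t. f (x + t *\<^sub>R b)) 0"

fun pdl :: "'a::euclidean_space list \<Rightarrow> ('a \<Rightarrow> real) \<Rightarrow> 'a \<Rightarrow> real" where
  "pdl [] f = f"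
| "pdl (b # bs) f = pd1 b (pdl bs f)"

definition smooth_on :: "'a::euclidean_space set \<Rightarrow> ('a \<Rightarrow> real) \<Rightarrow> bool" where
  "smooth_on U f \<longleftrightarrow> (\<forall>bs. set bs \<subseteq> Basis \<longrightarrow>
      continuous_on U (pdl bs f) \<and>
      (\<forall>b\<in>Basis. \<forall>x\<in>U. (\<lambda>t. pdl bs f (x + t *\<^sub>R b)) differentiable (at 0)))"

definition smooth_sphere :: "('a::euclidean_space \<Rightarrow> real) \<Rightarrow> bool" where
  "smooth_sphere u \<longleftrightarrow> smooth_on (- {0}) (hext u)"

text \<open>Gradient on the round sphere (tangential, since hext u is 0-homogeneous).\<close>
definition sgrad :: "('a::euclidean_space \<Rightarrow> real) \<Rightarrow> 'a \<Rightarrow> 'a" where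
  "sgrad u z = (\<Sum>b\<in>Basis. pd1 b (hext u) z *\<^sub>R b)"

text \<open>Divergence on the round sphere of a tangent vector field X (= Euclidean divergence
  of its 0-homogeneous extension, evaluated on the sphere).\<close>
definition sdiv :: "('a::euclidean_space \<Rightarrow> 'a) \<Rightarrow> 'a \<Rightarrow> real" where
  "sdiv X z = (\<Sum>b\<in>Basis. pd1 b (\<lambda>x. hext X x \<bullet> b) z)"

definition slap :: "('a::euclidean_space \<Rightarrow> real) \<Rightarrow> 'a \<Rightarrow> real" where
  "slap u = sdiv (sgrad u)"

text \<open>Integral over S^n w.r.t. dvol_{g0}, via the cone formula
  int_{S^n} f = (n+1) int_{B^{n+1}} f(x/|x|) dx.\<close>
definition sint :: "('a::euclidean_space \<Rightarrow> real) \<Rightarrow> real" where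
  "sint f = real DIM('a) * integral (ball 0 1) (hext f)"

definition omega :: "'a::euclidean_space itself \<Rightarrow> real" where
  "omega TYPE('a) = sint (\<lambda>_::'a. 1)"

definition dimn :: "'a::euclidean_space itself \<Rightarrow> real" where
  "dimn TYPE('a) = real DIM('a) - 1"

text \<open>Scalar curvature of u^{8/(n-4)} g0 = v^{4/(n-2)} g0, v = u^{2(n-2)/(n-4)}, by the
  standard conformal formula R = v^{-(n+2)/(n-2)} (n(n-1) v - 4(n-1)/(n-2) Delta v).\<close>
definition scal_conf :: "('a::euclidean_space \<Rightarrow> real) \<Rightarrow> 'a \<Rightarrow> real" where
  "scal_conf u z = (let n = dimn TYPE('a); v = (\<lambda>x. u x powr (2*(n-2)/(n-4))) in
     v z powr (-(n+2)/(n-2)) * (n*(n-1) * v z - 4*(n-1)/(n-2) * slap v z))"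

definition V14 :: "('a::euclidean_space \<Rightarrow> real) set" where
  "V14 = {u. smooth_sphere u \<and> (\<forall>z\<in>sphere 0 1. u z > 0)
      \<and> sint (\<lambda>z. u z powr (4 * dimn TYPE('a) / (dimn TYPE('a) - 4))) = omega TYPE('a)
      \<and> (\<forall>z\<in>sphere 0 1. scal_conf u z > 0)}"

text \<open>Diagonal L_{sigma_2}(u,u,u); 1-forms f du are identified with f grad u via g0.\<close>
definition Lsig2 :: "('a::euclidean_space \<Rightarrow> real) \<Rightarrow> 'a \<Rightarrow> real" where
  "Lsig2 u z = (let n = dimn TYPE('a);
       g2 = (\<lambda>x. (norm (sgrad u x))\<^sup>2);
       lu2 = slap (\<lambda>x. (u x)\<^sup>2) in
     1/2 * sdiv (\<lambda>x. g2 x *\<^sub>R sgrad u x) z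
     - (n-4)/16 * (u z * slap g2 z - sdiv (\<lambda>x. lu2 x *\<^sub>R sgrad u x) z)
     - (n-1)/4 * ((n-4)/4)^2 * u z * lu2 z
     + n*(n-1)/8 * ((n-4)/4)^3 * (u z)^3)"

definition Esig2 :: "('a::euclidean_space \<Rightarrow> real) \<Rightarrow> real" where
  "Esig2 u = sint (\<lambda>z. u z * Lsig2 u z)"

text \<open>Local minimizer on V14 w.r.t. the C^infinity topology: some C^k-neighbourhood
  (k-th order derivatives of the homogeneous extensions, on the sphere) works.\<close>
definition local_min_V14 :: "('a::euclidean_space \<Rightarrow> real) \<Rightarrow> bool" where
  "local_min_V14 u \<longleftrightarrow> u \<in> V14 \<and> (\<exists>k::nat. \<exists>\<epsilon>>0. \<forall>v\<in>V14.
      (\<forall>bs. set bs \<subseteq> Basis \<and> length bs \<le> k \<longrightarrow>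
         (\<forall>z\<in>sphere 0 1. \<bar>pdl bs (hext v) z - pdl bs (hext u) z\<bar> < \<epsilon>))
      \<longrightarrow> Esig2 v \<ge> Esig2 u)"

end

theory Submission
  imports Defs
begin

text \<open>The Frank-Lieb argument. Conformal covariance of the energy and of the scalar curvature lets one
  replace the round metric by its image under a Moebius transformation, chosen so that the
  coordinate functions y of the new round metric are orthogonal to the weight of the constraint.
  Then y u is an admissible second variation for every coordinate y. Since the squares of the
  coordinates sum to one and the coordinates are eigenfunctions, the sum of these second variations
  reduces to an integral of the squared gradient of u against a quantity that positivity of the scalar
  curvature makes negative. Hence u is constant with respect to the new round metric, and the constant is
  fixed by conformal invariance of the volume. No diffeomorphism is needed: everything is
  expressed through the conformal factor (1 + \<xi> z) / sqrt (1 - |\<xi>|^2).\<close>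

section \<open>Smooth functions and their partial derivatives\<close>

text \<open>Write m = (n-4)/4; the constraint exponent is then p = (4m+4)/m. The energy is
  homogeneous of degree four, so minimality under the constraint bounds the second-order coefficient
  in direction y u below by 2(p-1) = 6 + 8/m times the energy, weighted by the share of y^2 in the
  constraint mass. Over all coordinates these shares add up to one. The quartic form yields 6 times
  the energy by itself; the remaining 8/m is exactly what cancels the terms of order zero, so that
  every surviving term carries the squared gradient.

  Keeping all functions on the original sphere has a price. The new metric enters through the
  weights \<open>P4\<close> and \<open>j\<close> and the operator \<open>Aop\<close>, and the energy
  is covariant only up to divergences, which have to be exhibited. The geometric input is limited to
  inner products, Laplacians and Hessians of linear functions. Without a change of variables, the
  volume of the new metric comes from a first-variation argument, and the balancing point is a
  critical point of the integral of \<rho> \<tau> over the ball, where tangent inequalities for ln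
  replace a degree argument.\<close>

fun Ck_on :: "nat \<Rightarrow> 'a::euclidean_space set \<Rightarrow> ('a \<Rightarrow> real) \<Rightarrow> bool" where
  "Ck_on 0 U f \<longleftrightarrow> continuous_on U f"
| "Ck_on (Suc k) U f \<longleftrightarrow> continuous_on U f \<and>
     (\<forall>b\<in>Basis. (\<forall>x\<in>U. (\<lambda>t. f (x + t *\<^sub>R b)) differentiable (at 0)) \<and> Ck_on k U (pd1 b f))"

lemma pdl_append: "pdl (bs @ cs) f = pdl bs (pdl cs f)"
  by (induction bs) auto

lemma smooth_on_pd1: "smooth_on U f \<Longrightarrow> b \<in> Basis \<Longrightarrow> smooth_on U (pd1 b f)"
proof -
  assume f: "smooth_on U f" and b: "b \<in> Basis"
  have "pdl bs (pd1 b f) = pdl (bs @ [b]) f" for bs by (simp add: pdl_append)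
  then show ?thesis using f b unfolding smooth_on_def by simp
qed

lemma smooth_on_imp_Ck_on: "smooth_on U f \<Longrightarrow> Ck_on k U f"
proof (induction k arbitrary: f)
  case 0 then show ?case unfolding smooth_on_def by (auto dest: spec[of _ "[]"])
next
  case (Suc k)
  have "continuous_on U f" "\<forall>b\<in>Basis. \<forall>x\<in>U. (\<lambda>t. f (x + t *\<^sub>R b)) differentiable (at 0)"
    using Suc.prems unfolding smooth_on_def by (auto dest: spec[of _ "[]"])
  then show ?case using Suc.IH smooth_on_pd1[OF Suc.prems] by auto
qed

text \<open>\<open>Ck_on\<close> peels off the derivative that acts first, \<open>pdl\<close> the
  one that acts last. The former suits closure properties: a product or chain rule turns a first
  derivative into an expression of the same kind, and induction on k applies with the functions left
  arbitrary.\<close>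

lemma smooth_on_iff_Ck_on: "smooth_on U f \<longleftrightarrow> (\<forall>k. Ck_on k U f)"
proof
  assume f: "\<forall>k. Ck_on k U f"
  have "set bs \<subseteq> Basis \<Longrightarrow> Ck_on k U (pdl bs f)" for bs k
  proof (induction bs arbitrary: k)
    case (Cons b bs)
    then have "Ck_on (Suc k) U (pdl bs f)" by auto
    then show ?case using Cons.prems by auto
  qed (use f in auto)
  then have "set bs \<subseteq> Basis \<Longrightarrow> Ck_on (Suc 0) U (pdl bs f)" for bs by blast
  then show "smooth_on U f" unfolding smooth_on_def by simp
qed (simp add: smooth_on_imp_Ck_on)

lemma Ck_on_continuous: "Ck_on k U f \<Longrightarrow> continuous_on U f"
  by (cases k) auto

lemma Ck_on_SucD: "Ck_on (Suc k) U f \<Longrightarrow> Ck_on k U f"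
proof (induction k arbitrary: f)
  case (Suc k) then show ?case by (metis Ck_on.simps(2))
qed simp

lemma eventually_line_in_open:
  fixes x :: "'a::euclidean_space"
  assumes "open U" "x \<in> U"
  shows "\<forall>\<^sub>F t in nhds (0::real). x + t *\<^sub>R b \<in> U"
proof -
  have "((\<lambda>t. x + t *\<^sub>R b) \<longlongrightarrow> x + 0 *\<^sub>R b) (nhds (0::real))"
    by (intro tendsto_intros filterlim_ident)
  then show ?thesis using assms by (intro topological_tendstoD) auto
qed

lemma pd1_cong:
  assumes "open U" "x \<in> U" "\<And>y. y \<in> U \<Longrightarrow> f y = g y"
  shows "pd1 b f x = pd1 b g x"
  unfolding pd1_def
  by (rule deriv_cong_ev[OF eventually_mono[OF eventually_line_in_open[OF assms(1,2)]]]) (use assms(3) in auto)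

lemma line_diff_cong:
  fixes f g :: "'a::euclidean_space \<Rightarrow> real"
  assumes "open U" "x \<in> U" "\<And>y. y \<in> U \<Longrightarrow> f y = g y"
    and "(\<lambda>t. f (x + t *\<^sub>R b)) differentiable (at (0::real))"
  shows "(\<lambda>t. g (x + t *\<^sub>R b)) differentiable (at (0::real))"
proof -
  obtain D where D: "((\<lambda>t. f (x + t *\<^sub>R b)) has_real_derivative D) (at 0)"
    using assms(4) by (auto simp: real_differentiable_def)
  have "((\<lambda>t. g (x + t *\<^sub>R b)) has_real_derivative D) (at 0)"
    by (rule DERIV_cong_ev[THEN iffD1, OF refl eventually_mono[OF eventually_line_in_open[OF assms(1,2)]] refl D])
       (use assms(3) in auto)
  then show ?thesis by (auto simp: real_differentiable_def)
qed

lemma Ck_on_cong: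
  assumes "open U"
  shows "(\<And>y. y \<in> U \<Longrightarrow> f y = g y) \<Longrightarrow> Ck_on k U f \<Longrightarrow> Ck_on k U g"
proof (induction k arbitrary: f g)
  case 0 then show ?case using continuous_on_cong by (metis Ck_on.simps(1))
next
  case (Suc k)
  have "continuous_on U g" using Suc.prems continuous_on_cong by (metis Ck_on.simps(2))
  moreover have "Ck_on k U (pd1 b g)" if "b \<in> Basis" for b
  proof (rule Suc.IH)
    show "Ck_on k U (pd1 b f)" using Suc.prems(2) that by simp
    show "pd1 b f y = pd1 b g y" if "y \<in> U" for y
      using assms that Suc.prems(1) by (rule pd1_cong)
  qed
  moreover have "(\<lambda>t. g (x + t *\<^sub>R b)) differentiable (at 0)" if "b \<in> Basis" "x \<in> U" for b x
    using assms that(2) Suc.prems(1) by (rule line_diff_cong) (use that Suc.prems(2) in simp_all)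
  ultimately show ?case by simp
qed

lemma smooth_on_cong:
  assumes "open U" "\<And>y. y \<in> U \<Longrightarrow> f y = g y"
  shows "smooth_on U f \<longleftrightarrow> smooth_on U g"
  using Ck_on_cong[OF assms(1), of f g] Ck_on_cong[OF assms(1), of g f] assms(2)
  unfolding smooth_on_iff_Ck_on by metis

lemma Ck_on_line:
  assumes "Ck_on (Suc k) U f" "b \<in> Basis" "x \<in> U"
  shows "((\<lambda>t. f (x + t *\<^sub>R b)) has_real_derivative pd1 b f x) (at 0)"
  unfolding pd1_def using assms
  by (simp add: DERIV_deriv_iff_real_differentiable)

text \<open>With the partial derivatives supplied as explicit functions D, each closure proof only
  has to state its differentiation rule; \<open>pd1\<close> agrees with D by uniqueness of
  derivatives.\<close>

lemma Ck_on_SucI: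
  assumes "continuous_on U f"
    and "\<And>b x. b \<in> Basis \<Longrightarrow> x \<in> U \<Longrightarrow> ((\<lambda>t. f (x + t *\<^sub>R b)) has_real_derivative D b x) (at 0)"
    and "\<And>b. b \<in> Basis \<Longrightarrow> Ck_on k U (D b)" and "open U"
  shows "Ck_on (Suc k) U f"
proof -
  have "pd1 b f x = D b x" if "b \<in> Basis" "x \<in> U" for b x
    unfolding pd1_def using assms(2)[OF that] by (rule DERIV_imp_deriv)
  then have "Ck_on k U (pd1 b f)" if "b \<in> Basis" for b
    using that Ck_on_cong[OF assms(4), of "D b" "pd1 b f" k] assms(3) by auto
  then show ?thesis using assms(1,2) by (auto simp: real_differentiable_def)
qed

lemma Ck_on_Suc_pd1: "Ck_on (Suc k) U f \<Longrightarrow> b \<in> Basis \<Longrightarrow> Ck_on k U (pd1 b f)"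
  by simp

declare Ck_on.simps(2)[simp del]

section \<open>Closure of C^k functions under algebra, exp, inverse and ln\<close>

lemma Ck_on_const: "open U \<Longrightarrow> Ck_on k U (\<lambda>x. c)"
proof (induction k arbitrary: c)
  case (Suc k)
  show ?case by (rule Ck_on_SucI[where D = "\<lambda>b x. 0"]) (use Suc in auto)
qed simp

lemma Ck_on_inner: "open U \<Longrightarrow> Ck_on k U (\<lambda>x. x \<bullet> v)"
proof (cases k)
  case (Suc j)
  assume U: "open U"
  show ?thesis unfolding Suc
    by (rule Ck_on_SucI[where D = "\<lambda>b x. b \<bullet> v"])
       (use U in \<open>auto intro!: continuous_intros Ck_on_const derivative_eq_intros simp: inner_add_left\<close>)
qed (auto intro!: continuous_intros)

lemma Ck_on_add: "open U \<Longrightarrow> Ck_on k U f \<Longrightarrow> Ck_on k U g \<Longrightarrow> Ck_on k U (\<lambda>x. f x + g x)"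
proof (induction k arbitrary: f g)
  case (Suc k)
  show ?case
  proof (rule Ck_on_SucI[where D = "\<lambda>b x. pd1 b f x + pd1 b g x"])
    show "Ck_on k U (\<lambda>x. pd1 b f x + pd1 b g x)" if "b \<in> Basis" for b
      by (intro Suc.IH Ck_on_Suc_pd1 Suc.prems that)
    show "continuous_on U (\<lambda>x. f x + g x)"
      by (intro continuous_intros Ck_on_continuous[OF Suc.prems(2)] Ck_on_continuous[OF Suc.prems(3)])
  qed (auto intro!: DERIV_add Ck_on_line Suc.prems)
qed (auto intro!: continuous_intros)

lemma Ck_on_mult: "open U \<Longrightarrow> Ck_on k U f \<Longrightarrow> Ck_on k U g \<Longrightarrow> Ck_on k U (\<lambda>x. f x * g x)"
proof (induction k arbitrary: f g)
  case (Suc k)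
  show ?case
  proof (rule Ck_on_SucI[where D = "\<lambda>b x. pd1 b f x * g x + f x * pd1 b g x"])
    show "((\<lambda>t. f (x + t *\<^sub>R b) * g (x + t *\<^sub>R b)) has_real_derivative
        pd1 b f x * g x + f x * pd1 b g x) (at 0)" if "b \<in> Basis" "x \<in> U" for b x
      using DERIV_mult[OF Ck_on_line[OF Suc.prems(2) that] Ck_on_line[OF Suc.prems(3) that]]
      by (simp add: algebra_simps)
    show "Ck_on k U (\<lambda>x. pd1 b f x * g x + f x * pd1 b g x)" if "b \<in> Basis" for b
      by (intro Ck_on_add Suc.IH Ck_on_Suc_pd1 Ck_on_SucD[OF Suc.prems(2)] Ck_on_SucD[OF Suc.prems(3)] Suc.prems that)
  qed (intro Suc.prems continuous_intros Ck_on_continuous[OF Suc.prems(2)] Ck_on_continuous[OF Suc.prems(3)])+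
qed (auto intro!: continuous_intros)

lemma Ck_on_sum: "open U \<Longrightarrow> (\<And>i. i \<in> A \<Longrightarrow> Ck_on k U (f i)) \<Longrightarrow> Ck_on k U (\<lambda>x. \<Sum>i\<in>A. f i x)"
  by (induction A rule: infinite_finite_induct) (auto intro: Ck_on_const Ck_on_add)

lemma Ck_on_exp: "open U \<Longrightarrow> Ck_on k U f \<Longrightarrow> Ck_on k U (\<lambda>x. exp (f x))"
proof (induction k arbitrary: f)
  case (Suc k)
  show ?case
  proof (rule Ck_on_SucI[where D = "\<lambda>b x. exp (f x) * pd1 b f x"])
    show "((\<lambda>t. exp (f (x + t *\<^sub>R b))) has_real_derivative exp (f x) * pd1 b f x) (at 0)"
      if "b \<in> Basis" "x \<in> U" for b x
      by (rule derivative_eq_intros Ck_on_line[OF Suc.prems(2) that] | simp)+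
    show "Ck_on k U (\<lambda>x. exp (f x) * pd1 b f x)" if "b \<in> Basis" for b
      by (intro Ck_on_mult Suc.IH Ck_on_Suc_pd1 Ck_on_SucD[OF Suc.prems(2)] Suc.prems that)
  qed (intro Suc.prems continuous_intros Ck_on_continuous[OF Suc.prems(2)])+
qed (auto intro!: continuous_intros)

lemma Ck_on_inverse: "open U \<Longrightarrow> Ck_on k U f \<Longrightarrow> (\<And>x. x \<in> U \<Longrightarrow> f x \<noteq> 0) \<Longrightarrow> Ck_on k U (\<lambda>x. inverse (f x))"
proof (induction k arbitrary: f)
  case (Suc k)
  show ?case
  \<comment> \<open>Expressed through inverse (f x) itself, so that the induction hypothesis applies
    to every factor.\<close>
  proof (rule Ck_on_SucI[where D = "\<lambda>b x. - 1 * (inverse (f x) * inverse (f x) * pd1 b f x)"])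
    show "((\<lambda>t. inverse (f (x + t *\<^sub>R b))) has_real_derivative
        - 1 * (inverse (f x) * inverse (f x) * pd1 b f x)) (at 0)"
      if "b \<in> Basis" "x \<in> U" for b x
      by (rule derivative_eq_intros Ck_on_line[OF Suc.prems(2) that] | use Suc.prems that in simp)+
    show "Ck_on k U (\<lambda>x. - 1 * (inverse (f x) * inverse (f x) * pd1 b f x))" if "b \<in> Basis" for b
      by (intro Ck_on_mult Ck_on_const Suc.IH Ck_on_Suc_pd1 Ck_on_SucD[OF Suc.prems(2)] Suc.prems that)
  qed (use Suc.prems Ck_on_continuous[OF Suc.prems(2)] in \<open>auto intro!: continuous_on_inverse\<close>)
qed (auto intro!: continuous_intros)

text \<open>One derivative turns ln f into inverse f times a partial derivative of f, so the rule
  for the inverse settles all orders.\<close>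

lemma Ck_on_ln: "open U \<Longrightarrow> Ck_on k U f \<Longrightarrow> (\<And>x. x \<in> U \<Longrightarrow> f x > 0) \<Longrightarrow> Ck_on k U (\<lambda>x. ln (f x))"
proof (cases k)
  case 0 assume "Ck_on k U f" "\<And>x. x \<in> U \<Longrightarrow> f x > 0"
  with 0 show ?thesis by (auto intro!: continuous_on_ln simp: less_imp_neq[symmetric])
next
  case (Suc j)
  assume a: "open U" "Ck_on k U f" and p: "\<And>x. x \<in> U \<Longrightarrow> f x > 0"
  have n: "\<And>x. x \<in> U \<Longrightarrow> f x \<noteq> 0" using p by force
  show ?thesis unfolding Suc
  proof (rule Ck_on_SucI[where D = "\<lambda>b x. inverse (f x) * pd1 b f x"])
    show "((\<lambda>t. ln (f (x + t *\<^sub>R b))) has_real_derivative inverse (f x) * pd1 b f x) (at 0)"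
      if "b \<in> Basis" "x \<in> U" for b x
      by (rule derivative_eq_intros Ck_on_line[OF a(2)[unfolded Suc] that] | use p that in \<open>simp add: field_simps\<close>)+
    show "Ck_on j U (\<lambda>x. inverse (f x) * pd1 b f x)" if "b \<in> Basis" for b
      by (intro Ck_on_mult Ck_on_inverse Ck_on_Suc_pd1 Ck_on_SucD[OF a(2)[unfolded Suc]] a(1) a(2)[unfolded Suc] that n)
    show "continuous_on U (\<lambda>x. ln (f x))"
      using n Ck_on_continuous[OF a(2)] by (intro continuous_on_ln) auto
  qed (rule a)
qed

lemma smooth_on_add: "open U \<Longrightarrow> smooth_on U f \<Longrightarrow> smooth_on U g \<Longrightarrow> smooth_on U (\<lambda>x. f x + g x)"
  unfolding smooth_on_iff_Ck_on using Ck_on_add by blast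

lemma smooth_on_mult: "open U \<Longrightarrow> smooth_on U f \<Longrightarrow> smooth_on U g \<Longrightarrow> smooth_on U (\<lambda>x. f x * g x)"
  unfolding smooth_on_iff_Ck_on using Ck_on_mult by blast

lemma smooth_on_const: "open U \<Longrightarrow> smooth_on U (\<lambda>x. c)"
  unfolding smooth_on_iff_Ck_on using Ck_on_const by blast

lemma smooth_on_inner: "open U \<Longrightarrow> smooth_on U (\<lambda>x. x \<bullet> v)"
  unfolding smooth_on_iff_Ck_on using Ck_on_inner by blast

lemma smooth_on_sum: "open U \<Longrightarrow> (\<And>i. i \<in> A \<Longrightarrow> smooth_on U (h i)) \<Longrightarrow> smooth_on U (\<lambda>x. \<Sum>i\<in>A. h i x)"
  unfolding smooth_on_iff_Ck_on by (intro allI Ck_on_sum) auto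

lemma smooth_on_exp: "open U \<Longrightarrow> smooth_on U f \<Longrightarrow> smooth_on U (\<lambda>x. exp (f x))"
  unfolding smooth_on_iff_Ck_on using Ck_on_exp by blast

lemma smooth_on_ln: "open U \<Longrightarrow> smooth_on U f \<Longrightarrow> (\<And>x. x \<in> U \<Longrightarrow> f x > 0) \<Longrightarrow> smooth_on U (\<lambda>x. ln (f x))"
  unfolding smooth_on_iff_Ck_on by (intro allI Ck_on_ln) auto

lemma smooth_on_continuous: "smooth_on U f \<Longrightarrow> continuous_on U f"
  using smooth_on_imp_Ck_on[of U f 0] by simp

section \<open>Differentiation along lines, total differentiability, symmetry of second
  derivatives\<close>

lemma smooth_on_line:
  "smooth_on U f \<Longrightarrow> b \<in> Basis \<Longrightarrow> x \<in> U \<Longrightarrow>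
    ((\<lambda>t. f (x + t *\<^sub>R b)) has_real_derivative pd1 b f x) (at 0)"
  using Ck_on_line smooth_on_imp_Ck_on by blast

lemma smooth_on_line_at:
  assumes "smooth_on U f" "b \<in> Basis" "x + s *\<^sub>R b \<in> U"
  shows "((\<lambda>t. f (x + t *\<^sub>R b)) has_real_derivative pd1 b f (x + s *\<^sub>R b)) (at s)"
proof -
  have "((\<lambda>t. f (x + s *\<^sub>R b + t *\<^sub>R b)) has_real_derivative pd1 b f (x + s *\<^sub>R b)) (at 0)"
    by (rule smooth_on_line[OF assms])
  then have "((\<lambda>t. f (x + (t + s) *\<^sub>R b)) has_real_derivative pd1 b f (x + s *\<^sub>R b)) (at 0)"
    by (simp add: algebra_simps)
  then show ?thesis using DERIV_shift[of "\<lambda>t. f (x + t *\<^sub>R b)" _ 0 s] by simp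
qed

text \<open>Continuous partial derivatives suffice: the increment h is added one coordinate at a
  time, and each addition is controlled by the mean value inequality.\<close>

lemma smooth_on_has_derivative:
  fixes f :: "'a::euclidean_space \<Rightarrow> real"
  assumes U: "open U" "x \<in> U" and f: "smooth_on U f"
  shows "(f has_derivative (\<lambda>h. \<Sum>b\<in>Basis. (h \<bullet> b) * pd1 b f x)) (at x)"
proof -
  define N where "N S h = (\<Sum>b\<in>S. (h \<bullet> b) *\<^sub>R b)" for S and h :: 'a
  \<comment> \<open>All intermediate points lie within K norm h of x: DIM for \<open>N S h\<close>
    and one more for the coordinate being added.\<close>
  define K where "K = real DIM('a) + 1"
  have K: "K > 0" by (simp add: K_def)
  have normN: "norm (N S h) \<le> real DIM('a) * norm h" if "S \<subseteq> Basis" for S h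
  proof -
    have "norm (N S h) \<le> (\<Sum>b\<in>S. norm ((h \<bullet> b) *\<^sub>R b))" unfolding N_def by (rule norm_sum)
    also have "\<dots> \<le> (\<Sum>b\<in>S. norm h)"
    proof (rule sum_mono)
      fix b assume "b \<in> S"
      then have b: "b \<in> Basis" using that by blast
      show "norm ((h \<bullet> b) *\<^sub>R b) \<le> norm h" using Basis_le_norm[OF b, of h] b by simp
    qed
    also have "\<dots> \<le> real DIM('a) * norm h"
      using card_mono[OF finite_Basis that] by (simp add: mult_right_mono)
    finally show ?thesis .
  qed
  \<comment> \<open>\<open>N S h\<close> is the part of h in the coordinates S; the induction
    enlarges S up to the whole basis.\<close>
  have claim: "\<exists>d>0. \<forall>h. norm h < d \<longrightarrow>
      \<bar>f (x + N S h) - f x - (\<Sum>b\<in>S. (h \<bullet> b) * pd1 b f x)\<bar> \<le> e * norm h"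
    if "finite S" "S \<subseteq> Basis" "e > 0" for S and e :: real
    using that
  proof (induction S arbitrary: e rule: finite_induct)
    case empty then show ?case by (intro exI[of _ 1]) (auto simp: N_def)
  next
    case (insert c S)
    then have c: "c \<in> Basis" "S \<subseteq> Basis" by auto
    obtain d1 where d1: "d1 > 0" "\<And>h. norm h < d1 \<Longrightarrow>
        \<bar>f (x + N S h) - f x - (\<Sum>b\<in>S. (h \<bullet> b) * pd1 b f x)\<bar> \<le> e/2 * norm h"
      using insert.IH[of "e/2"] insert.prems c by auto
    have "isCont (pd1 c f) x"
      using smooth_on_continuous[OF smooth_on_pd1[OF f c(1)]] U continuous_on_eq_continuous_at by blast
    then obtain d2 where d2: "d2 > 0" "\<And>y. dist y x < d2 \<Longrightarrow> dist (pd1 c f y) (pd1 c f x) < e/2"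
      using insert.prems unfolding continuous_at_eps_delta by (meson half_gt_zero)
    obtain d3 where d3: "d3 > 0" "ball x d3 \<subseteq> U" using U openE by blast
    have "\<bar>f (x + N (insert c S) h) - f x - (\<Sum>b\<in>insert c S. (h \<bullet> b) * pd1 b f x)\<bar> \<le> e * norm h"
      if h: "norm h < min d1 (min d2 d3 / K)" for h
    proof -
      define s where "s = h \<bullet> c"
      \<comment> \<open>Subtracting the linear part leaves a function whose derivative is small near
        x, by continuity of \<open>pd1 c f\<close>.\<close>
      define \<psi> where "\<psi> t = f (x + N S h + t *\<^sub>R c) - t * pd1 c f x" for t
      have s: "\<bar>s\<bar> \<le> norm h" unfolding s_def using Basis_le_norm c by blast
      have near: "dist (x + N S h + t *\<^sub>R c) x < min d2 d3" if "t \<in> closed_segment 0 s" for t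
      proof -
        have "\<bar>t\<bar> \<le> \<bar>s\<bar>" using that by (auto simp: closed_segment_eq_real_ivl split: if_splits)
        then have "norm (N S h + t *\<^sub>R c) \<le> K * norm h"
          using normN[OF c(2), of h] s c norm_triangle_ineq[of "N S h" "t *\<^sub>R c"]
          by (auto simp: K_def algebra_simps)
        also have "\<dots> < min d2 d3" using h K by (simp add: field_simps)
        finally show ?thesis by (simp add: dist_norm add.assoc)
      qed
      have 1: "norm (\<psi> s - \<psi> 0) \<le> e/2 * norm (s - 0)"
      proof (rule field_differentiable_bound[where S="closed_segment 0 s"])
        show "(\<psi> has_field_derivative pd1 c f (x + N S h + t *\<^sub>R c) - pd1 c f x) (at t within closed_segment 0 s)"
          if "t \<in> closed_segment 0 s" for t
        proof -
          have "x + N S h + t *\<^sub>R c \<in> U" using near[OF that] d3 by (auto simp: dist_commute)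
          then show ?thesis unfolding \<psi>_def
            by (auto intro!: derivative_eq_intros
                DERIV_subset[OF smooth_on_line_at[OF f c(1)]])
        qed
        show "norm (pd1 c f (x + N S h + t *\<^sub>R c) - pd1 c f x) \<le> e/2" if "t \<in> closed_segment 0 s" for t
          using d2(2)[of "x + N S h + t *\<^sub>R c"] near[OF that] by (simp add: dist_norm)
      qed auto
      have 2: "N (insert c S) h = N S h + s *\<^sub>R c"
        using insert by (simp add: N_def s_def add.commute)
      have "e/2 * norm (s - 0) \<le> e/2 * norm h" using s insert.prems by (simp add: mult_left_mono)
      then have 3: "\<bar>\<psi> s - \<psi> 0\<bar> \<le> e/2 * norm h" using 1 by simp
      have 4: "\<bar>f (x + N S h) - f x - (\<Sum>b\<in>S. (h \<bullet> b) * pd1 b f x)\<bar> \<le> e/2 * norm h"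
        using d1 h by simp
      have "f (x + N (insert c S) h) - f x - (\<Sum>b\<in>insert c S. (h \<bullet> b) * pd1 b f x)
          = (\<psi> s - \<psi> 0) + (f (x + N S h) - f x - (\<Sum>b\<in>S. (h \<bullet> b) * pd1 b f x))"
        using insert.hyps by (simp add: 2 \<psi>_def s_def[symmetric] add.assoc)
      then have "\<bar>f (x + N (insert c S) h) - f x - (\<Sum>b\<in>insert c S. (h \<bullet> b) * pd1 b f x)\<bar>
          \<le> e/2 * norm h + e/2 * norm h"
        using order_trans[OF abs_triangle_ineq add_mono[OF 3 4]] by (simp only:)
      then show ?thesis by simp
    qed
    moreover have "min d1 (min d2 d3 / K) > 0" using d1 d2 d3 K by simp
    ultimately show ?case by blast
  qed
  have N: "N Basis h = h" for h by (simp add: N_def euclidean_representation)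
  show ?thesis
    unfolding has_derivative_at_alt
  proof (intro conjI allI impI)
    show "bounded_linear (\<lambda>h. \<Sum>b\<in>Basis. (h \<bullet> b) * pd1 b f x)"
      by (intro bounded_linear_sum bounded_linear_mult_left[THEN bounded_linear_compose] bounded_linear_inner_left)
    fix e :: real assume "e > 0"
    then obtain d where "d > 0" "\<And>h. norm h < d \<Longrightarrow>
        \<bar>f (x + h) - f x - (\<Sum>b\<in>Basis. (h \<bullet> b) * pd1 b f x)\<bar> \<le> e * norm h"
      using claim[of Basis e] N by auto
    from this(1) this(2)[of "_ - x"]
    show "\<exists>d>0. \<forall>y. norm (y - x) < d \<longrightarrow>
        norm (f y - f x - (\<Sum>b\<in>Basis. ((y - x) \<bullet> b) * pd1 b f x)) \<le> e * norm (y - x)"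
      by (intro exI[of _ d]) auto
  qed
qed

text \<open>The mean value inequality is used twice, in direction b for the derivative along a, then
  in direction a for f itself. The linear terms with A remove the main part before each use.\<close>

lemma mixed_difference_bound:
  fixes f :: "'a::euclidean_space \<Rightarrow> real"
  assumes f: "smooth_on U f" and ab: "a \<in> Basis" "b \<in> Basis" and h: "h > 0"
    and near: "\<And>s t. 0 \<le> s \<Longrightarrow> s \<le> h \<Longrightarrow> 0 \<le> t \<Longrightarrow> t \<le> h \<Longrightarrow> x + s *\<^sub>R a + t *\<^sub>R b \<in> U \<and>
        \<bar>pd1 b (pd1 a f) (x + s *\<^sub>R a + t *\<^sub>R b) - A\<bar> \<le> e"
  shows "\<bar>f (x + h *\<^sub>R a + h *\<^sub>R b) - f (x + h *\<^sub>R a) - f (x + h *\<^sub>R b) + f x - h * h * A\<bar> \<le> h * h * e"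
proof -
  have inner: "\<bar>pd1 a f (x + s *\<^sub>R a + h *\<^sub>R b) - pd1 a f (x + s *\<^sub>R a) - h * A\<bar> \<le> e * h"
    if s: "s \<in> {0..h}" for s
  proof -
    have "norm ((pd1 a f (x + s *\<^sub>R a + h *\<^sub>R b) - h * A) - (pd1 a f (x + s *\<^sub>R a + 0 *\<^sub>R b) - 0 * A)) \<le> e * norm (h - 0)"
    proof (rule field_differentiable_bound[where S="{0..h}"])
      show "((\<lambda>t. pd1 a f (x + s *\<^sub>R a + t *\<^sub>R b) - t * A) has_field_derivative
          pd1 b (pd1 a f) (x + s *\<^sub>R a + t *\<^sub>R b) - A) (at t within {0..h})" if "t \<in> {0..h}" for t
        using near[of s t] s that
        by (auto intro!: derivative_eq_intros DERIV_subset[OF smooth_on_line_at[OF smooth_on_pd1[OF f ab(1)] ab(2)]])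
    qed (use near[of s] s h in auto)
    then show ?thesis using h by simp
  qed
  have "norm ((f (x + h *\<^sub>R a + h *\<^sub>R b) - f (x + h *\<^sub>R a) - h * (h * A))
      - (f (x + 0 *\<^sub>R a + h *\<^sub>R b) - f (x + 0 *\<^sub>R a) - 0 * (h * A))) \<le> (e * h) * norm (h - 0)"
  proof (rule field_differentiable_bound[where S="{0..h}"])
    show "((\<lambda>s. f (x + s *\<^sub>R a + h *\<^sub>R b) - f (x + s *\<^sub>R a) - s * (h * A)) has_field_derivative
        pd1 a f (x + s *\<^sub>R a + h *\<^sub>R b) - pd1 a f (x + s *\<^sub>R a) - h * A) (at s within {0..h})"
      if "s \<in> {0..h}" for s
    proof -
      have 1: "x + h *\<^sub>R b + s *\<^sub>R a \<in> U" "x + s *\<^sub>R a \<in> U"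
        using near[of s h] near[of s 0] that h by (auto simp: algebra_simps)
      have "((\<lambda>s. f (x + h *\<^sub>R b + s *\<^sub>R a) - f (x + s *\<^sub>R a) - s * (h * A)) has_field_derivative
        pd1 a f (x + h *\<^sub>R b + s *\<^sub>R a) - pd1 a f (x + s *\<^sub>R a) - h * A) (at s within {0..h})"
        by (auto intro!: derivative_eq_intros DERIV_subset[OF smooth_on_line_at[OF f ab(1)]] 1)
      then show ?thesis by (simp add: add.commute add.left_commute)
    qed
  qed (use inner h in auto)
  then show ?thesis using h by (simp add: algebra_simps)
qed

text \<open>The second difference of f over a small square is symmetric in a and b, and h^2 times
  either mixed derivative approximates it with an error that is arbitrarily small relative to
  h^2.\<close>

lemma pd1_commute:
  fixes f :: "'a::euclidean_space \<Rightarrow> real"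
  assumes U: "open U" "x \<in> U" and f: "smooth_on U f" and ab: "a \<in> Basis" "b \<in> Basis"
  shows "pd1 a (pd1 b f) x = pd1 b (pd1 a f) x"
proof -
  have "\<bar>pd1 a (pd1 b f) x - pd1 b (pd1 a f) x\<bar> \<le> 0 + e" if e: "e > 0" for e :: real
  proof -
    define \<epsilon> where "\<epsilon> = e / 2"
    have c: "isCont (pd1 a (pd1 b f)) x" "isCont (pd1 b (pd1 a f)) x"
      using smooth_on_continuous smooth_on_pd1 f ab U continuous_on_eq_continuous_at by metis+
    obtain d1 where d1: "d1 > 0" "\<And>y. dist y x < d1 \<Longrightarrow> dist (pd1 a (pd1 b f) y) (pd1 a (pd1 b f) x) < \<epsilon>"
      using c(1) e unfolding continuous_at_eps_delta \<epsilon>_def by (meson half_gt_zero)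
    obtain d2 where d2: "d2 > 0" "\<And>y. dist y x < d2 \<Longrightarrow> dist (pd1 b (pd1 a f) y) (pd1 b (pd1 a f) x) < \<epsilon>"
      using c(2) e unfolding continuous_at_eps_delta \<epsilon>_def by (meson half_gt_zero)
    obtain d3 where d3: "d3 > 0" "ball x d3 \<subseteq> U" using U openE by blast
    define d where "d = min d1 (min d2 d3)"
    define h where "h = d / 3"
    have h: "h > 0" using d1 d2 d3 by (simp add: h_def d_def)
    have near: "dist (x + s *\<^sub>R v + t *\<^sub>R w) x < d"
      if "0 \<le> s" "s \<le> h" "0 \<le> t" "t \<le> h" "v \<in> Basis" "w \<in> Basis" for s t v w
    proof -
      have "norm (s *\<^sub>R v + t *\<^sub>R w) \<le> s + t" using that norm_triangle_ineq[of "s *\<^sub>R v" "t *\<^sub>R w"] by simp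
      also have "\<dots> < d" using that h by (simp add: h_def)
      finally show ?thesis by (simp add: dist_norm add.assoc)
    qed
    have inU: "y \<in> U" if "dist y x < d" for y using that d3 by (auto simp: d_def dist_commute)
    have 1: "\<bar>f (x + h *\<^sub>R a + h *\<^sub>R b) - f (x + h *\<^sub>R a) - f (x + h *\<^sub>R b) + f x - h * h * pd1 b (pd1 a f) x\<bar> \<le> h * h * \<epsilon>"
    proof (rule mixed_difference_bound[OF f ab h])
      show "x + s *\<^sub>R a + t *\<^sub>R b \<in> U \<and> \<bar>pd1 b (pd1 a f) (x + s *\<^sub>R a + t *\<^sub>R b) - pd1 b (pd1 a f) x\<bar> \<le> \<epsilon>"
        if "0 \<le> s" "s \<le> h" "0 \<le> t" "t \<le> h" for s t
        using near[OF that ab] inU[OF near[OF that ab]] d2(2)[of "x + s *\<^sub>R a + t *\<^sub>R b"]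
        by (simp add: dist_real_def d_def)
    qed
    have 2: "\<bar>f (x + h *\<^sub>R b + h *\<^sub>R a) - f (x + h *\<^sub>R b) - f (x + h *\<^sub>R a) + f x - h * h * pd1 a (pd1 b f) x\<bar> \<le> h * h * \<epsilon>"
    proof (rule mixed_difference_bound[OF f ab(2,1) h])
      show "x + s *\<^sub>R b + t *\<^sub>R a \<in> U \<and> \<bar>pd1 a (pd1 b f) (x + s *\<^sub>R b + t *\<^sub>R a) - pd1 a (pd1 b f) x\<bar> \<le> \<epsilon>"
        if "0 \<le> s" "s \<le> h" "0 \<le> t" "t \<le> h" for s t
        using near[OF that ab(2,1)] inU[OF near[OF that ab(2,1)]] d1(2)[of "x + s *\<^sub>R b + t *\<^sub>R a"]
        by (simp add: dist_real_def d_def)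
    qed
    have 3: "x + h *\<^sub>R b + h *\<^sub>R a = x + h *\<^sub>R a + h *\<^sub>R b" by (simp add: algebra_simps)
    define X where "X = f (x + h *\<^sub>R a + h *\<^sub>R b) - f (x + h *\<^sub>R a) - f (x + h *\<^sub>R b) + f x"
    have 5: "\<bar>X - h * h * pd1 b (pd1 a f) x\<bar> \<le> h * h * \<epsilon>" using 1 by (simp only: X_def)
    have "\<bar>X - h * h * pd1 a (pd1 b f) x\<bar> \<le> h * h * \<epsilon>"
    proof -
      have "X = f (x + h *\<^sub>R b + h *\<^sub>R a) - f (x + h *\<^sub>R b) - f (x + h *\<^sub>R a) + f x"
        unfolding X_def 3 by simp
      then show ?thesis using 2 by (simp only:)
    qed
    with 5 have "\<bar>h * h * pd1 a (pd1 b f) x - h * h * pd1 b (pd1 a f) x\<bar> \<le> 2 * (h * h * \<epsilon>)"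
      by linarith
    also have "2 * (h * h * \<epsilon>) = (h * h) * e" by (simp add: \<epsilon>_def)
    finally have "(h * h) * \<bar>pd1 a (pd1 b f) x - pd1 b (pd1 a f) x\<bar> \<le> (h * h) * e"
      using h by (simp only: right_diff_distrib[symmetric] abs_mult)
    then have "\<bar>pd1 a (pd1 b f) x - pd1 b (pd1 a f) x\<bar> \<le> e"
      by (rule mult_left_le_imp_le) (rule mult_pos_pos[OF h h])
    then show ?thesis by simp
  qed
  then have "\<bar>pd1 a (pd1 b f) x - pd1 b (pd1 a f) x\<bar> \<le> 0" by (rule field_le_epsilon)
  then show ?thesis by simp
qed

text \<open>By translation invariance the integrals of the difference quotients vanish.\<close>

lemma integral_line_derivative_eq_0:
  fixes H :: "'a::euclidean_space \<Rightarrow> real"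
  assumes cont: "continuous_on UNIV H" and supp: "\<And>x. norm x \<ge> 1 \<Longrightarrow> H x = 0"
    and b: "b \<in> Basis"
    and D: "\<And>x. ((\<lambda>t. H (x + t *\<^sub>R b)) has_real_derivative D x) (at 0)"
    and bd: "\<And>x. \<bar>D x\<bar> \<le> C"
  shows "(\<integral>x. D x \<partial>lborel) = 0" and "integrable lborel D"
proof -
  have [measurable]: "H \<in> borel_measurable borel"
    using cont by (rule borel_measurable_continuous_onI)
  have Dat: "((\<lambda>t. H (x + t *\<^sub>R b)) has_real_derivative D (x + s *\<^sub>R b)) (at s)" for x s
  proof -
    have "((\<lambda>t. H (x + (t + s) *\<^sub>R b)) has_real_derivative D (x + s *\<^sub>R b)) (at 0)"
      using D[of "x + s *\<^sub>R b"] by (simp add: algebra_simps)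
    then show ?thesis using DERIV_shift[of "\<lambda>t. H (x + t *\<^sub>R b)" _ 0 s] by simp
  qed
  define r where "r k = inverse (real (Suc k))" for k
  define s where "s k x = (H (x + r k *\<^sub>R b) - H x) / r k" for k x
  have r: "r k > 0" "r k \<le> 1" for k by (simp_all add: r_def field_simps)
  have rlim: "filterlim r (at 0) sequentially"
  proof -
    have "r \<longlonglongrightarrow> 0" using LIMSEQ_inverse_real_of_nat by (simp add: r_def[abs_def])
    then show ?thesis using r(1) by (auto simp: filterlim_at less_imp_neq[symmetric])
  qed
  have lim: "(\<lambda>k. s k x) \<longlonglongrightarrow> D x" for x
    using filterlim_compose[OF D[of x, unfolded DERIV_def] rlim] by (simp add: s_def)
  have C: "C \<ge> 0" using bd[of 0] by simp
  have lip: "\<bar>H (x + t *\<^sub>R b) - H x\<bar> \<le> C * \<bar>t\<bar>" for x t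
    using field_differentiable_bound[of UNIV "\<lambda>t. H (x + t *\<^sub>R b)" "\<lambda>s. D (x + s *\<^sub>R b)" C t 0] Dat bd
    by (auto simp: norm_real)
  \<comment> \<open>For norm x > 2 both terms of the quotient vanish, since the step is at most 1;
    elsewhere the Lipschitz bound applies.\<close>
  have sbd: "norm (s k x) \<le> C * indicator (cball 0 2) x" for k x
  proof (cases "norm x \<le> 2")
    case True
    have "\<bar>H (x + r k *\<^sub>R b) - H x\<bar> / r k \<le> C"
      using lip[of x "r k"] r(1)[of k] by (subst pos_divide_le_eq) auto
    then show ?thesis using True r(1)[of k] by (simp add: s_def abs_divide)
  next
    case False
    have "norm (x + r k *\<^sub>R b) \<ge> norm x - norm (r k *\<^sub>R b)" by (rule norm_diff_ineq)
    then have "norm (x + r k *\<^sub>R b) \<ge> 1" using False r[of k] b by simp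
    then show ?thesis using False supp by (simp add: s_def)
  qed
  have cb: "integrable lborel (\<lambda>x::'a. c * indicator (cball 0 R) x)" for c R :: real
  proof (intro integrable_mult_right integrable_real_indicator)
    show "emeasure lborel (cball (0::'a) R) < \<infinity>" by (rule emeasure_lborel_cball_finite)
  qed simp
  note w = cb[of C 2]
  have meas: "s k \<in> borel_measurable lborel" for k unfolding s_def by measurable
  have Dm: "D \<in> borel_measurable lborel"
    by (rule borel_measurable_LIMSEQ_metric[OF meas lim])
  note dc = integral_dominated_convergence[OF Dm meas w AE_I2[OF lim] AE_I2[OF sbd]]
  show "integrable lborel D"
    by (rule integrable_dominated_convergence[OF Dm meas w AE_I2[OF lim] AE_I2[OF sbd]])
  have Hi: "integrable lborel H"
  proof -
    have "bounded (H ` cball 0 1)"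
      by (intro compact_imp_bounded compact_continuous_image continuous_on_subset[OF cont] compact_cball) simp
    then obtain M where M: "\<And>x. x \<in> cball 0 1 \<Longrightarrow> norm (H x) \<le> M"
      unfolding bounded_iff by blast
    have "norm (H x) \<le> norm (M * indicator (cball 0 1) x)" for x
    proof (cases "norm x \<le> 1")
      case True then show ?thesis using M[of x] by simp
    next
      case False then show ?thesis using supp[of x] by simp
    qed
    then show ?thesis by (intro Bochner_Integration.integrable_bound[OF cb[of M 1]]) auto
  qed
  have "(\<integral>x. H x \<partial>distr lborel borel ((+) v)) = (\<integral>x. H (v + x) \<partial>lborel)" for v
    by (rule integral_distr) simp_all
  then have shift1: "(\<integral>x. H (x + v) \<partial>lborel) = (\<integral>x. H x \<partial>lborel)" for v
    unfolding lborel_distr_plus by (metis (no_types, lifting) Bochner_Integration.integral_cong add.commute)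
  have "integrable (distr lborel borel ((+) v)) H \<longleftrightarrow> integrable lborel (\<lambda>x. H (v + x))" for v
    by (rule integrable_distr_eq) simp_all
  then have shift2: "integrable lborel (\<lambda>x. H (x + v))" for v
    unfolding lborel_distr_plus using Hi by (simp add: add.commute[of _ v])
  have "(\<integral>x. s k x \<partial>lborel) = 0" for k
    unfolding s_def by (simp add: shift1 shift2 Hi)
  then show "(\<integral>x. D x \<partial>lborel) = 0" using LIMSEQ_unique[OF dc] by simp
qed

section \<open>Differential operators on the sphere\<close>

lemma open_punct: "open (- {0::'a::euclidean_space})" by auto

lemma hext_scale: "c > 0 \<Longrightarrow> hext f (c *\<^sub>R x) = hext f x"
  by (simp add: hext_def field_simps)

lemma hext_sphere: "z \<in> sphere 0 1 \<Longrightarrow> hext f z = f z"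
  by (simp add: hext_def)

lemma sgn_in_sphere: "x \<noteq> 0 \<Longrightarrow> x /\<^sub>R norm x \<in> sphere 0 1"
  by simp

lemma sphere_nonzero: "z \<in> sphere 0 1 \<Longrightarrow> z \<noteq> (0::'a::euclidean_space)"
  by auto

lemma hext_cong: "(\<And>z. z \<in> sphere 0 1 \<Longrightarrow> f z = g z) \<Longrightarrow> x \<noteq> 0 \<Longrightarrow> hext f x = hext g x"
  unfolding hext_def using sgn_in_sphere by blast

lemma smooth_sphere_cong:
  "(\<And>z. z \<in> sphere 0 1 \<Longrightarrow> f z = g z) \<Longrightarrow> smooth_sphere f \<longleftrightarrow> smooth_sphere g"
  unfolding smooth_sphere_def by (intro smooth_on_cong hext_cong) auto

lemma smooth_sphereI:
  assumes "smooth_on (-{0}) F" "\<And>x. x \<noteq> 0 \<Longrightarrow> hext f x = F x"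
  shows "smooth_sphere f"
  unfolding smooth_sphere_def using assms smooth_on_cong[OF open_punct, of "hext f" F] by auto

lemma smooth_sphereD: "smooth_sphere f \<Longrightarrow> smooth_on (-{0}) (hext f)"
  by (simp add: smooth_sphere_def)

lemma smooth_sphere_add: "smooth_sphere f \<Longrightarrow> smooth_sphere g \<Longrightarrow> smooth_sphere (\<lambda>x. f x + g x)"
  by (rule smooth_sphereI[OF smooth_on_add[OF open_punct smooth_sphereD smooth_sphereD]]) (auto simp: hext_def)

lemma smooth_sphere_mult: "smooth_sphere f \<Longrightarrow> smooth_sphere g \<Longrightarrow> smooth_sphere (\<lambda>x. f x * g x)"
  by (rule smooth_sphereI[OF smooth_on_mult[OF open_punct smooth_sphereD smooth_sphereD]]) (auto simp: hext_def)

lemma smooth_sphere_const: "smooth_sphere (\<lambda>x. c)"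
  by (rule smooth_sphereI[OF smooth_on_const[OF open_punct]]) (auto simp: hext_def)

lemma smooth_sphere_exp: "smooth_sphere f \<Longrightarrow> smooth_sphere (\<lambda>x. exp (f x))"
  by (rule smooth_sphereI[OF smooth_on_exp[OF open_punct smooth_sphereD]]) (auto simp: hext_def)

lemma smooth_sphere_ln:
  assumes "smooth_sphere f" "\<And>z. z \<in> sphere 0 1 \<Longrightarrow> f z > 0"
  shows "smooth_sphere (\<lambda>x. ln (f x))"
proof (rule smooth_sphereI[OF smooth_on_ln[OF open_punct smooth_sphereD[OF assms(1)]]])
  show "hext f x > 0" if "x \<in> - {0}" for x using assms(2)[OF sgn_in_sphere] that by (simp add: hext_def)
qed (simp add: hext_def)

text \<open>Writing 1 / norm x as exp (-1/2 ln (x x)) reduces smoothness to the closure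
  rules.\<close>

lemma smooth_on_norm_inv: "smooth_on (- {0}) (\<lambda>x::'a::euclidean_space. inverse (norm x))"
proof -
  have "smooth_on (- {0}) (\<lambda>x::'a. \<Sum>b\<in>Basis. (x \<bullet> b) * (x \<bullet> b))"
    by (intro smooth_on_sum smooth_on_mult smooth_on_inner open_punct)
  then have "smooth_on (- {0}) (\<lambda>x::'a. x \<bullet> x)"
    by (simp add: euclidean_inner[symmetric])
  then have "smooth_on (- {0}) (\<lambda>x::'a. exp ((-1/2) * ln (x \<bullet> x)))"
    by (intro smooth_on_exp smooth_on_mult smooth_on_const smooth_on_ln open_punct) auto
  moreover have "exp ((-1/2) * ln (x \<bullet> x)) = inverse (norm x)" if "x \<noteq> 0" for x :: 'a
  proof -
    have "ln (x \<bullet> x) = 2 * ln (norm x)" using that by (simp add: dot_square_norm ln_realpow)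
    then show ?thesis using that by (simp add: exp_minus)
  qed
  ultimately show ?thesis
    using smooth_on_cong[OF open_punct, of "\<lambda>x::'a. exp ((-1/2) * ln (x \<bullet> x))" "\<lambda>x. inverse (norm x)"] by auto
qed

lemma smooth_on_inner_self: "smooth_on (- {0}) (\<lambda>x::'a::euclidean_space. x \<bullet> x)"
proof -
  have "smooth_on (- {0}) (\<lambda>x::'a. \<Sum>b\<in>Basis. (x \<bullet> b) * (x \<bullet> b))"
    by (intro smooth_on_sum smooth_on_mult smooth_on_inner open_punct)
  then show ?thesis by (simp add: euclidean_inner[symmetric])
qed

lemma smooth_sphere_coord: "smooth_sphere (\<lambda>z. z \<bullet> v)"
  by (rule smooth_sphereI[OF smooth_on_mult[OF open_punct smooth_on_inner smooth_on_norm_inv]])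
     (auto simp: hext_def)

section \<open>Homogeneity of extensions and Euler's identity\<close>

lemma pd1_scale:
  fixes f :: "'a::euclidean_space \<Rightarrow> real"
  assumes f: "smooth_on (- {0}) f" and c: "c > 0" and x: "x \<noteq> 0" and b: "b \<in> Basis"
    and sc: "\<And>y. f (c *\<^sub>R y) = a * f y"
  shows "pd1 b f (c *\<^sub>R x) = a / c * pd1 b f x"
proof -
  have "((\<lambda>t. f (x + (inverse c * t) *\<^sub>R b)) has_real_derivative pd1 b f x * inverse c) (at 0)"
    by (rule DERIV_chain2[where f="\<lambda>t. f (x + t *\<^sub>R b)" and g="\<lambda>t. inverse c * t"])
       (use smooth_on_line[OF f b] x in \<open>auto intro!: derivative_eq_intros\<close>)
  from DERIV_cmult[OF this, of a]
  have "((\<lambda>t. a * f (x + (inverse c * t) *\<^sub>R b)) has_real_derivative a * (pd1 b f x * inverse c)) (at 0)" .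
  moreover have "a * f (x + (inverse c * t) *\<^sub>R b) = f (c *\<^sub>R x + t *\<^sub>R b)" for t
    using sc[of "x + (inverse c * t) *\<^sub>R b"] c by (simp add: scaleR_add_right mult.assoc[symmetric])
  ultimately have "((\<lambda>t. f (c *\<^sub>R x + t *\<^sub>R b)) has_real_derivative a * (pd1 b f x * inverse c)) (at 0)"
    by simp
  then show ?thesis unfolding pd1_def[of b f "c *\<^sub>R x"]
    by (simp add: DERIV_imp_deriv divide_inverse mult_ac)
qed

lemma pd1_hext_scale:
  assumes "smooth_sphere f" "c > 0" "x \<noteq> 0" "b \<in> Basis"
  shows "pd1 b (hext f) (c *\<^sub>R x) = pd1 b (hext f) x / c"
  using pd1_scale[OF smooth_sphereD[OF assms(1)] assms(2-4), of 1] assms(2) by (simp add: hext_scale)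

lemma pd1_hext_sgn:
  assumes "smooth_sphere f" "x \<noteq> 0" "b \<in> Basis"
  shows "pd1 b (hext f) (x /\<^sub>R norm x) = norm x * pd1 b (hext f) x"
  using pd1_hext_scale[OF assms(1) _ assms(2,3), of "inverse (norm x)"] assms(2) by (simp add: field_simps)

lemma pd1_pd1_scale:
  assumes f: "smooth_sphere f" and c: "c > 0" and x: "x \<noteq> 0" and ab: "a \<in> Basis" "b \<in> Basis"
  shows "pd1 a (pd1 b (hext f)) (c *\<^sub>R x) = pd1 a (pd1 b (hext f)) x / c\<^sup>2"
proof -
  \<comment> \<open>The scaling rule asks for homogeneity at every point, the origin included, where
    \<open>pd1 b (hext f)\<close> has no controlled value.\<close>
  define g where "g y = (if y = 0 then 0 else pd1 b (hext f) y)" for y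
  have eq: "pd1 a (pd1 b (hext f)) y = pd1 a g y" if "y \<noteq> 0" for y
    by (rule pd1_cong[OF open_punct]) (use that in \<open>auto simp: g_def\<close>)
  have "smooth_on (- {0}) g"
    using smooth_on_cong[OF open_punct, of g "pd1 b (hext f)"] smooth_on_pd1[OF smooth_sphereD[OF f] ab(2)]
    by (auto simp: g_def)
  from pd1_scale[OF this c x ab(1), of "1/c"]
  have "pd1 a g (c *\<^sub>R x) = (1/c) / c * pd1 a g x"
    using c pd1_hext_scale[OF f c _ ab(2)] by (auto simp: g_def)
  then show ?thesis using c x by (simp add: eq power2_eq_square)
qed

text \<open>The extension is constant along rays, so its radial derivative vanishes. Hence Euclidean
  gradients of extensions are already tangential.\<close>

lemma euler_hext:
  assumes f: "smooth_sphere f" and x: "x \<noteq> 0"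
  shows "(\<Sum>b\<in>Basis. (x \<bullet> b) * pd1 b (hext f) x) = 0"
proof -
  define A where "A h = (\<Sum>b\<in>Basis. (h \<bullet> b) * pd1 b (hext f) x)" for h
  have A: "(hext f has_derivative A) (at x)"
    using smooth_on_has_derivative[OF open_punct _ smooth_sphereD[OF f], of x] x by (simp add: A_def[abs_def])
  have 1: "((\<lambda>t::real. t *\<^sub>R x) has_derivative (\<lambda>t. t *\<^sub>R x)) (at 1)"
    by (auto intro!: derivative_eq_intros)
  have "((\<lambda>t::real. hext f (t *\<^sub>R x)) has_derivative (\<lambda>t. A (t *\<^sub>R x))) (at 1)"
    by (rule has_derivative_compose[OF 1]) (use A in simp)
  moreover have "((\<lambda>t::real. hext f (t *\<^sub>R x)) has_derivative (\<lambda>t. 0)) (at 1)"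
  proof (rule has_derivative_transform_within_open[where f="\<lambda>t. hext f x", OF _ open_greaterThan[of 0]])
    show "hext f x = hext f (t *\<^sub>R x)" if "t \<in> {0<..}" for t using that by (simp add: hext_scale)
  qed auto
  ultimately have "(\<lambda>t. A (t *\<^sub>R x)) = (\<lambda>t. 0)" by (rule has_derivative_unique)
  then have "A (1 *\<^sub>R x) = 0" by metis
  then show ?thesis by (simp add: A_def)
qed

lemma sgrad_inner: "b \<in> Basis \<Longrightarrow> sgrad f z \<bullet> b = pd1 b (hext f) z"
  by (simp add: sgrad_def inner_sum_left inner_Basis if_distrib cong: if_cong)

lemma sgrad_dot: "sgrad f z \<bullet> sgrad g z = (\<Sum>b\<in>Basis. pd1 b (hext f) z * pd1 b (hext g) z)"
  by (subst euclidean_inner) (simp add: sgrad_inner)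

lemma sgrad_tangent: "smooth_sphere f \<Longrightarrow> z \<in> sphere 0 1 \<Longrightarrow> z \<bullet> sgrad f z = 0"
  using euler_hext[OF _ sphere_nonzero, of f z] by (subst euclidean_inner) (auto simp: sgrad_inner)

lemma pd1_add:
  assumes "smooth_on U f" "smooth_on U g" "x \<in> U" "b \<in> Basis"
  shows "pd1 b (\<lambda>x. f x + g x) x = pd1 b f x + pd1 b g x"
  unfolding pd1_def[of b "\<lambda>x. f x + g x"]
  by (intro DERIV_imp_deriv DERIV_add smooth_on_line[OF assms(1)] smooth_on_line[OF assms(2)] assms)

lemma pd1_mult:
  assumes "smooth_on U f" "smooth_on U g" "x \<in> U" "b \<in> Basis"
  shows "pd1 b (\<lambda>x. f x * g x) x = pd1 b f x * g x + f x * pd1 b g x"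
  unfolding pd1_def[of b "\<lambda>x. f x * g x"]
  using DERIV_mult[OF smooth_on_line[OF assms(1,4,3)] smooth_on_line[OF assms(2,4,3)]]
  by (intro DERIV_imp_deriv) (simp add: algebra_simps)

lemma pd1_sum:
  assumes "\<And>i. i \<in> A \<Longrightarrow> smooth_on U (f i)" "x \<in> U" "b \<in> Basis"
  shows "pd1 b (\<lambda>x. \<Sum>i\<in>A. f i x) x = (\<Sum>i\<in>A. pd1 b (f i) x)"
  unfolding pd1_def[of b "\<lambda>x. \<Sum>i\<in>A. f i x"]
  by (intro DERIV_imp_deriv DERIV_sum smooth_on_line[OF assms(1)] assms)

lemma pd1_const [simp]: "pd1 b (\<lambda>x. c) = (\<lambda>x. 0)"
  by (simp add: pd1_def fun_eq_iff)

lemma pd1_inner: "pd1 b (\<lambda>x. x \<bullet> v) x = b \<bullet> v"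
  unfolding pd1_def
  by (rule DERIV_imp_deriv) (auto intro!: derivative_eq_intros simp: inner_add_left)

lemma pd1_inner_self: "pd1 b (\<lambda>x. x \<bullet> x) x = 2 * (x \<bullet> b)"
proof -
  have "(\<lambda>t. (x + t *\<^sub>R b) \<bullet> (x + t *\<^sub>R b)) = (\<lambda>t. x \<bullet> x + 2 * t * (x \<bullet> b) + t * t * (b \<bullet> b))"
    by (simp add: fun_eq_iff algebra_simps inner_commute)
  then show ?thesis unfolding pd1_def
    by (intro DERIV_imp_deriv) (auto intro!: derivative_eq_intros)
qed

lemma pd1_exp:
  assumes "smooth_on U f" "x \<in> U" "b \<in> Basis"
  shows "pd1 b (\<lambda>x. exp (f x)) x = exp (f x) * pd1 b f x"
  unfolding pd1_def[of b "\<lambda>x. exp (f x)"]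
  by (rule DERIV_imp_deriv) (rule derivative_eq_intros smooth_on_line[OF assms(1,3,2)] | simp)+

lemma hext_sgrad:
  assumes "smooth_sphere f" "x \<noteq> 0" "b \<in> Basis"
  shows "hext (sgrad f) x \<bullet> b = norm x * pd1 b (hext f) x"
  using assms by (simp add: hext_def[of "sgrad f"] sgrad_inner pd1_hext_sgn)

lemma norm_inverse_inner: "norm x = inverse (norm x) * (x \<bullet> x)"
  by (cases "x = 0") (auto simp: dot_square_norm power2_eq_square)

lemma smooth_on_norm: "smooth_on (- {0}) (\<lambda>x::'a::euclidean_space. norm x)"
  by (subst norm_inverse_inner) (intro smooth_on_mult open_punct smooth_on_norm_inv smooth_on_inner_self)

lemma pd1_norm:
  fixes z :: "'a::euclidean_space"
  assumes "z \<in> sphere 0 1" "b \<in> Basis"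
  shows "pd1 b norm z = z \<bullet> b"
proof -
  have z: "z \<in> - {0}" using assms by auto
  have "pd1 b (\<lambda>x. norm x * norm x) z = pd1 b norm z * norm z + norm z * pd1 b norm z"
    by (rule pd1_mult[OF smooth_on_norm smooth_on_norm z assms(2)])
  moreover have "(\<lambda>x::'a. norm x * norm x) = (\<lambda>x. x \<bullet> x)"
    by (simp add: fun_eq_iff dot_square_norm power2_eq_square)
  ultimately show ?thesis using assms pd1_inner_self[of b z] by simp
qed

definition lapl :: "('a::euclidean_space \<Rightarrow> real) \<Rightarrow> 'a \<Rightarrow> real" where
  "lapl F x = (\<Sum>b\<in>Basis. pd1 b (pd1 b F) x)"

text \<open>The extended gradient field is norm x times the Euclidean gradient of the extension.
  Differentiating the factor norm x produces the radial derivative of f, which vanishes by Euler's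
  identity, so no curvature correction appears.\<close>

lemma sdiv_scaled_sgrad:
  fixes a f :: "'a::euclidean_space \<Rightarrow> real"
  assumes a: "smooth_sphere a" and f: "smooth_sphere f" and z: "z \<in> sphere 0 1"
  shows "sdiv (\<lambda>x. a x *\<^sub>R sgrad f x) z = sgrad a z \<bullet> sgrad f z + a z * lapl (hext f) z"
proof -
  have z0: "z \<in> - {0}" using z by auto
  have "pd1 b (\<lambda>x. hext (\<lambda>x. a x *\<^sub>R sgrad f x) x \<bullet> b) z =
      pd1 b (hext a) z * pd1 b (hext f) z + a z * ((z \<bullet> b) * pd1 b (hext f) z + pd1 b (pd1 b (hext f)) z)"
    if b: "b \<in> Basis" for b
  proof -
    note sm = smooth_sphereD[OF a] smooth_sphereD[OF f] smooth_on_norm smooth_on_pd1[OF smooth_sphereD[OF f] b]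
    have "pd1 b (\<lambda>x. hext (\<lambda>x. a x *\<^sub>R sgrad f x) x \<bullet> b) z
        = pd1 b (\<lambda>x. hext a x * (norm x * pd1 b (hext f) x)) z"
    proof (rule pd1_cong[OF open_punct z0])
      fix y :: 'a assume "y \<in> - {0}"
      then show "hext (\<lambda>x. a x *\<^sub>R sgrad f x) y \<bullet> b = hext a y * (norm y * pd1 b (hext f) y)"
        using hext_sgrad[OF f _ b, of y] by (simp add: hext_def)
    qed
    also have "\<dots> = pd1 b (hext a) z * (norm z * pd1 b (hext f) z)
        + hext a z * (pd1 b norm z * pd1 b (hext f) z + norm z * pd1 b (pd1 b (hext f)) z)"
      unfolding pd1_mult[OF sm(1) smooth_on_mult[OF open_punct sm(3,4)] z0 b] pd1_mult[OF sm(3,4) z0 b] by simp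
    finally show ?thesis using z b pd1_norm[OF z b] by (simp add: hext_sphere)
  qed
  then have "sdiv (\<lambda>x. a x *\<^sub>R sgrad f x) z = (\<Sum>b\<in>Basis. pd1 b (hext a) z * pd1 b (hext f) z)
     + a z * ((\<Sum>b\<in>Basis. (z \<bullet> b) * pd1 b (hext f) z) + lapl (hext f) z)"
    unfolding sdiv_def lapl_def by (simp add: sum.distrib sum_distrib_left distrib_left)
  then show ?thesis using euler_hext[OF f, of z] z0 by (simp add: sgrad_dot)
qed

lemma slap_eq_lapl:
  assumes f: "smooth_sphere f" and z: "z \<in> sphere 0 1"
  shows "slap f z = lapl (hext f) z"
proof -
  have "slap f z = sdiv (\<lambda>x. 1 *\<^sub>R sgrad f x) z" by (simp add: slap_def)
  moreover have "sgrad (\<lambda>x. 1) z = 0" by (simp add: sgrad_def hext_def[abs_def])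
  ultimately show ?thesis using sdiv_scaled_sgrad[OF smooth_sphere_const f z, of 1] by simp
qed

text \<open>Two derivatives lower the degree of homogeneity by two; the factor x x restores degree
  zero. This formula and the next one give smoothness of the resulting functions.\<close>

lemma hext_sgrad_dot:
  assumes "smooth_sphere f" "smooth_sphere g" "x \<noteq> 0"
  shows "hext (\<lambda>z. sgrad f z \<bullet> sgrad g z) x = (x \<bullet> x) * (\<Sum>b\<in>Basis. pd1 b (hext f) x * pd1 b (hext g) x)"
  unfolding hext_def[of "\<lambda>z. sgrad f z \<bullet> sgrad g z"]
  unfolding sgrad_dot sum_distrib_left
  by (rule sum.cong) (use assms in \<open>auto simp: pd1_hext_sgn dot_square_norm power2_eq_square\<close>)

lemma hext_slap:
  assumes "smooth_sphere f" "x \<noteq> 0"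
  shows "hext (slap f) x = (x \<bullet> x) * lapl (hext f) x"
proof -
  have "lapl (hext f) (inverse (norm x) *\<^sub>R x) = (x \<bullet> x) * lapl (hext f) x"
    unfolding lapl_def sum_distrib_left
    by (rule sum.cong) (use assms in \<open>auto simp: pd1_pd1_scale dot_square_norm power_inverse divide_inverse mult.commute\<close>)
  then show ?thesis using slap_eq_lapl[OF assms(1) sgn_in_sphere[OF assms(2)]]
    by (simp add: hext_def[of "slap f"])
qed

lemma smooth_sphere_sgrad_dot:
  assumes "smooth_sphere f" "smooth_sphere g"
  shows "smooth_sphere (\<lambda>z. sgrad f z \<bullet> sgrad g z)"
  by (rule smooth_sphereI[OF _ hext_sgrad_dot[OF assms]])
     (intro smooth_on_mult smooth_on_sum smooth_on_inner_self smooth_on_pd1 smooth_sphereD assms open_punct)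

lemma smooth_sphere_slap:
  assumes "smooth_sphere f"
  shows "smooth_sphere (slap f)"
  by (rule smooth_sphereI[OF _ hext_slap[OF assms]])
     (unfold lapl_def, intro smooth_on_mult smooth_on_sum smooth_on_inner_self smooth_on_pd1 smooth_sphereD assms open_punct)

section \<open>The divergence theorem on the sphere\<close>

lemma smooth_sphere_continuous: "smooth_sphere f \<Longrightarrow> continuous_on (sphere 0 1) f"
proof -
  assume f: "smooth_sphere f"
  have "continuous_on (sphere 0 1) (hext f)"
    using continuous_on_subset[OF smooth_on_continuous[OF smooth_sphereD[OF f]], of "sphere 0 1"] by auto
  then show ?thesis using continuous_on_cong[of "sphere 0 1" "sphere 0 1" "hext f" f] hext_sphere by metis
qed

lemma smooth_sphere_bounded:
  assumes "smooth_sphere f"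
  obtains M where "M > 0" "\<And>z. z \<in> sphere 0 1 \<Longrightarrow> \<bar>f z\<bar> \<le> M"
proof -
  have "bounded (f ` sphere 0 1)"
    by (intro compact_imp_bounded compact_continuous_image smooth_sphere_continuous assms compact_sphere)
  then obtain M where "M > 0" "\<And>y. y \<in> f ` sphere 0 1 \<Longrightarrow> norm y \<le> M"
    unfolding bounded_pos by blast
  then show thesis by (intro that[of M]) auto
qed

lemma integrable_hext:
  fixes f :: "'a::euclidean_space \<Rightarrow> real"
  assumes f: "smooth_sphere f"
  shows "integrable lborel (\<lambda>x. indicator (ball 0 1) x * hext f x)"
proof -
  obtain M where M: "M > 0" "\<And>z. z \<in> sphere 0 1 \<Longrightarrow> \<bar>f z\<bar> \<le> M"
    using smooth_sphere_bounded[OF f] by blast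
  \<comment> \<open>\<open>hext f 0\<close> is \<open>f 0\<close>, because division by zero gives
    zero; this value is not controlled by the bound on the sphere.\<close>
  define M' where "M' = max M \<bar>f 0\<bar>"
  have bd: "\<bar>hext f x\<bar> \<le> M'" for x
    using M(2)[OF sgn_in_sphere, of x] by (cases "x = 0") (auto simp: hext_def M'_def)
  have [measurable]: "hext f \<in> borel_measurable borel"
  proof -
    have 1: "(\<lambda>x. if x \<in> -{0} then hext f x else f 0) \<in> borel_measurable borel"
      by (rule borel_measurable_continuous_on_if[OF _ smooth_on_continuous[OF smooth_sphereD[OF f]]]) auto
    have 2: "(\<lambda>x. if x \<in> -{0} then hext f x else f 0) = hext f" by (auto simp: hext_def)
    show ?thesis using 1 unfolding 2 .
  qed
  have "integrable lborel (\<lambda>x::'a. M' * indicator (ball 0 1) x)"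
    by (intro integrable_mult_right integrable_real_indicator emeasure_lborel_ball_finite) auto
  then show ?thesis
    by (rule Bochner_Integration.integrable_bound) (use bd M(1) in \<open>auto simp: indicator_def M'_def\<close>)
qed

lemma sint_eq_lborel:
  fixes f :: "'a::euclidean_space \<Rightarrow> real"
  assumes "smooth_sphere f"
  shows "sint f = real DIM('a) * (\<integral>x. indicator (ball 0 1) x * hext f x \<partial>lborel)"
proof -
  have "set_integrable lborel (ball 0 1) (hext f)"
    using integrable_hext[OF assms] by (simp add: set_integrable_def)
  from set_borel_integral_eq_integral(2)[OF this] show ?thesis
    by (simp add: sint_def set_lebesgue_integral_def)
qed

text \<open>A cutoff of class C^1 is enough, as a vector field is differentiated only once. This
  rational form vanishes for s \<le> 0, tends to 1, and has an explicit continuous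
  derivative.\<close>

definition cutoff :: "real \<Rightarrow> real" where "cutoff s = (max 0 s)\<^sup>2 / (1 + s\<^sup>2)"

definition cutoff' :: "real \<Rightarrow> real" where
  "cutoff' s = (2 * max 0 s * (1 + s\<^sup>2) - (max 0 s)\<^sup>2 * (2 * s)) / (1 + s\<^sup>2)\<^sup>2"

lemma one_plus_square_neq_0 [simp]: "1 + s\<^sup>2 \<noteq> (0::real)"
  using zero_le_power2[of s] by linarith

lemma has_derivative_max0_square: "((\<lambda>s::real. (max 0 s)\<^sup>2) has_real_derivative 2 * max 0 s) (at s)"
proof -
  consider "s > 0" | "s < 0" | "s = 0" by linarith
  then show ?thesis
  proof cases
    case 1
    have "((\<lambda>s::real. s\<^sup>2) has_real_derivative 2 * max 0 s) (at s)"
      using 1 by (auto intro!: derivative_eq_intros)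
    then show ?thesis
      by (rule has_field_derivative_transform_within_open[OF _ open_greaterThan[of 0]]) (use 1 in auto)
  next
    case 2
    have "((\<lambda>s::real. 0) has_real_derivative 2 * max 0 s) (at s)"
      using 2 by (auto intro!: derivative_eq_intros)
    then show ?thesis
      by (rule has_field_derivative_transform_within_open[OF _ open_lessThan[of 0]]) (use 2 in auto)
  next
    case 3
    have "((\<lambda>h::real. (max 0 h)\<^sup>2 / h) \<longlongrightarrow> 0) (at 0)"
    proof (rule Lim_null_comparison)
      show "\<forall>\<^sub>F h in at 0. norm ((max 0 h)\<^sup>2 / h) \<le> \<bar>h::real\<bar>"
        by (rule always_eventually) (auto simp: max_def power2_eq_square)
    qed (auto intro!: tendsto_eq_intros)
    then show ?thesis using 3 by (simp add: DERIV_def)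
  qed
qed

lemma DERIV_cutoff: "(cutoff has_real_derivative cutoff' s) (at s)"
proof -
  have "((\<lambda>s::real. 1 + s\<^sup>2) has_real_derivative 2 * s) (at s)"
    by (auto intro!: derivative_eq_intros)
  from DERIV_divide[OF has_derivative_max0_square this one_plus_square_neq_0]
  show ?thesis unfolding cutoff_def[abs_def] cutoff'_def by (simp only: power2_eq_square[of "1 + s\<^sup>2"])
qed

lemma continuous_cutoff': "continuous_on UNIV cutoff'"
  unfolding cutoff'_def[abs_def] by (intro continuous_intros) auto

lemma continuous_cutoff: "continuous_on UNIV cutoff"
  unfolding cutoff_def[abs_def] by (intro continuous_intros) auto

lemma cutoff_nonpos: "s \<le> 0 \<Longrightarrow> cutoff s = 0" "s \<le> 0 \<Longrightarrow> cutoff' s = 0"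
  by (simp_all add: cutoff_def cutoff'_def max_def)

lemma cutoff_bounds: "0 \<le> cutoff s" "cutoff s \<le> 1"
proof -
  have "1 + s\<^sup>2 > 0" by (simp add: add_pos_nonneg)
  then show "0 \<le> cutoff s" "cutoff s \<le> 1"
    by (auto simp: cutoff_def max_def divide_simps)
qed

lemma cutoff_tendsto: "(cutoff \<longlongrightarrow> 1) at_top"
proof -
  have "((\<lambda>s::real. 1 - inverse (1 + s\<^sup>2)) \<longlongrightarrow> 1 - 0) at_top"
    by (intro tendsto_intros tendsto_inverse_0_at_top filterlim_tendsto_add_at_top[OF tendsto_const]
        filterlim_pow_at_top filterlim_ident) auto
  moreover have "\<forall>\<^sub>F s in at_top. 1 - inverse (1 + s\<^sup>2) = cutoff s"
    using eventually_ge_at_top[of 0] by eventually_elim (simp add: cutoff_def field_simps)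
  ultimately show ?thesis using Lim_transform_eventually by fastforce
qed

text \<open>By the cone formula the integral is one over the ball, where the extension of the
  integrand is a Euclidean divergence. Multiplying the field by radial functions supported away from
  the origin and the boundary gives compact support, and the integral of each partial derivative
  vanishes.\<close>

lemma sint_divergence:
  fixes a f :: "'a::euclidean_space \<Rightarrow> real"
  assumes a: "smooth_sphere a" and f: "smooth_sphere f"
  shows "sint (\<lambda>z. sgrad a z \<bullet> sgrad f z + a z * slap f z) = 0"
proof -
  define h where "h = (\<lambda>z. sgrad a z \<bullet> sgrad f z + a z * slap f z)"
  define A F where "A = hext a" and "F = hext f"
  have A: "smooth_on (- {0}) A" and F: "smooth_on (- {0}) F"
    using a f by (auto simp: A_def F_def smooth_sphere_def)
  have h: "smooth_sphere h" unfolding h_def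
    by (intro smooth_sphere_add smooth_sphere_mult smooth_sphere_sgrad_dot smooth_sphere_slap a f)
  have hext_h: "hext h x = (x \<bullet> x) * ((\<Sum>b\<in>Basis. pd1 b A x * pd1 b F x) + A x * lapl F x)" if "x \<noteq> 0" for x
  proof -
    have "hext h x = hext (\<lambda>z. sgrad a z \<bullet> sgrad f z) x + A x * hext (slap f) x"
      by (simp add: h_def hext_def A_def)
    then show ?thesis using that
      by (simp add: hext_sgrad_dot[OF a f] hext_slap[OF f] A_def F_def algebra_simps)
  qed
  \<comment> \<open>The field |x|^2 A grad F has degree one and is orthogonal to x by Euler's
    identity; its divergence is exactly the extension of h.\<close>
  define V where "V b x = (x \<bullet> x) * (A x * pd1 b F x)" for b x
  have V: "smooth_on (- {0}) (V b)" if "b \<in> Basis" for b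
    unfolding V_def[abs_def]
    by (intro smooth_on_mult smooth_on_inner_self smooth_on_pd1 A F open_punct that)
  have pdV: "pd1 b (V b) x = 2 * (x \<bullet> b) * (A x * pd1 b F x)
      + (x \<bullet> x) * (pd1 b A x * pd1 b F x + A x * pd1 b (pd1 b F) x)" if "b \<in> Basis" "x \<noteq> 0" for b x
  proof -
    have x: "x \<in> - {0}" using that by simp
    note sm = smooth_on_inner_self A smooth_on_pd1[OF F that(1)]
    show ?thesis unfolding V_def[abs_def]
      unfolding pd1_mult[OF sm(1) smooth_on_mult[OF open_punct sm(2,3)] x that(1)]
        pd1_mult[OF sm(2,3) x that(1)] pd1_inner_self by simp
  qed
  have eul: "(\<Sum>b\<in>Basis. (x \<bullet> b) * pd1 b F x) = 0" if "x \<noteq> 0" for x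
    unfolding F_def by (rule euler_hext[OF f that])
  \<comment> \<open>Radial cutoffs avoid both the origin, where the extensions are singular, and the boundary.\<close>
  define c c' where "c k \<tau> = cutoff (k * \<tau> - 1) * cutoff (k * (1 - \<tau>) - 1)"
    and "c' k \<tau> = k * cutoff' (k * \<tau> - 1) * cutoff (k * (1 - \<tau>) - 1)
        - k * cutoff (k * \<tau> - 1) * cutoff' (k * (1 - \<tau>) - 1)" for k \<tau> :: real
  have Dc: "(c k has_real_derivative c' k \<tau>) (at \<tau>)" for k \<tau>
    unfolding c_def[abs_def] c'_def
    by (auto intro!: derivative_eq_intros DERIV_chain2[OF DERIV_cutoff])
  have c_cont: "continuous_on UNIV (c k)" "continuous_on UNIV (c' k)" for k
    unfolding c_def[abs_def] c'_def[abs_def]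
    by (intro continuous_intros continuous_on_compose2[OF continuous_cutoff] continuous_on_compose2[OF continuous_cutoff'] subset_UNIV)+
  have c_zero: "c k \<tau> = 0 \<and> c' k \<tau> = 0" if "k > 0" "k * \<tau> \<le> 1 \<or> \<tau> \<ge> 1" for k \<tau>
  proof -
    have "k * \<tau> - 1 \<le> 0 \<or> k * (1 - \<tau>) - 1 \<le> 0"
      using that mult_nonneg_nonpos[of k "1 - \<tau>"] by auto
    then show ?thesis by (auto simp: c_def c'_def cutoff_nonpos)
  qed
  have key: "(\<integral>x. c k (x \<bullet> x) * hext h x \<partial>lborel) = 0" if k: "k > 0" for k
  proof -
    define Hb where "Hb b x = (if x = 0 then 0 else c k (x \<bullet> x) * V b x)" for b x
    define D where "D b x = (if x = 0 then 0 else 2 * (x \<bullet> b) * c' k (x \<bullet> x) * V b x + c k (x \<bullet> x) * pd1 b (V b) x)" for b x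
    \<comment> \<open>The shift by 1 inside the cutoffs makes \<open>Hb\<close> vanish on this whole
      neighbourhood of the origin, so the value 0 assigned there is harmless.\<close>
    define U where "U = {x::'a. k * (x \<bullet> x) < 1}"
    have U: "open U" "0 \<in> U" unfolding U_def by (auto intro!: open_Collect_less continuous_intros)
    have HU: "Hb b x = 0" if "x \<in> U" for b x
      using c_zero[OF k, of "x \<bullet> x"] that by (simp add: Hb_def U_def)
    have cx: "continuous_on (- {0}) (\<lambda>x::'a. c k (x \<bullet> x))" "continuous_on (- {0}) (\<lambda>x::'a. c' k (x \<bullet> x))"
      by (intro continuous_on_compose2[OF c_cont(1)] continuous_on_compose2[OF c_cont(2)] continuous_intros subset_UNIV)+
    have int0: "integrable lborel (D b)" "(\<integral>x. D b x \<partial>lborel) = 0" if b: "b \<in> Basis" for b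
    proof -
      have Vc: "continuous_on (- {0}) (V b)" "continuous_on (- {0}) (pd1 b (V b))"
        using V[OF b] smooth_on_pd1[OF V[OF b] b] smooth_on_continuous by auto
      have cont: "continuous_on UNIV (Hb b)"
      proof -
        have "continuous_on (- {0}) (Hb b)"
          using continuous_on_mult[OF cx(1) Vc(1)] by (rule continuous_on_eq) (simp add: Hb_def)
        moreover have "continuous_on U (Hb b)"
          using continuous_on_const[of U 0] by (rule continuous_on_eq) (simp add: HU)
        moreover have "- {0} \<union> U = UNIV" using U by auto
        ultimately show ?thesis using continuous_on_open_Un[of "- {0}" U "Hb b"] U by auto
      qed
      have der: "((\<lambda>t. Hb b (x + t *\<^sub>R b)) has_real_derivative D b x) (at 0)" for x
      proof (cases "x = 0")
        case True
        have "\<forall>\<^sub>F t in nhds 0. 0 = Hb b (x + t *\<^sub>R b)"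
          using eventually_line_in_open[OF U(1), of x b] U(2) True by (auto elim!: eventually_mono simp: HU)
        from DERIV_cong_ev[OF refl this refl, of 0] show ?thesis using True by (simp add: D_def)
      next
        case False
        then have x: "x \<in> - {0}" by simp
        have sq: "((\<lambda>t. (x + t *\<^sub>R b) \<bullet> (x + t *\<^sub>R b)) has_real_derivative 2 * (x \<bullet> b)) (at 0)"
          using smooth_on_line[OF smooth_on_inner_self b x] by (simp add: pd1_inner_self)
        have "((\<lambda>t. c k ((x + t *\<^sub>R b) \<bullet> (x + t *\<^sub>R b))) has_real_derivative c' k (x \<bullet> x) * (2 * (x \<bullet> b))) (at 0)"
          by (rule DERIV_chain2[OF _ sq]) (use Dc in simp)
        from DERIV_mult[OF this smooth_on_line[OF V[OF b] b x]]
        have 1: "((\<lambda>t. c k ((x + t *\<^sub>R b) \<bullet> (x + t *\<^sub>R b)) * V b (x + t *\<^sub>R b)) has_real_derivative D b x) (at 0)"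
          using False by (simp add: D_def algebra_simps)
        have "\<forall>\<^sub>F t in nhds 0. c k ((x + t *\<^sub>R b) \<bullet> (x + t *\<^sub>R b)) * V b (x + t *\<^sub>R b) = Hb b (x + t *\<^sub>R b)"
          using eventually_line_in_open[OF open_punct x, of b] by (rule eventually_mono) (simp add: Hb_def)
        from DERIV_cong_ev[OF refl this refl] 1 show ?thesis by blast
      qed
      define K where "K = {x::'a. 1 \<le> k * (x \<bullet> x)} \<inter> cball 0 1"
      have K: "compact K" "K \<subseteq> - {0}" unfolding K_def
        by (intro closed_Int_compact closed_Collect_le continuous_intros) auto
      have Dc: "continuous_on (- {0}) (D b)"
      proof (rule continuous_on_eq)
        show "continuous_on (- {0}) (\<lambda>x. 2 * (x \<bullet> b) * c' k (x \<bullet> x) * V b x + c k (x \<bullet> x) * pd1 b (V b) x)"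
          by (intro continuous_intros cx Vc)
      qed (simp add: D_def)
      have "bounded (D b ` K)"
        by (intro compact_imp_bounded compact_continuous_image continuous_on_subset[OF Dc] K)
      then obtain C where C: "C > 0" "\<And>x. x \<in> K \<Longrightarrow> \<bar>D b x\<bar> \<le> C"
        unfolding bounded_pos by auto
      have bd: "\<bar>D b x\<bar> \<le> C" for x
      proof (cases "x \<in> K")
        case False
        then have "k * (x \<bullet> x) \<le> 1 \<or> x \<bullet> x \<ge> 1"
          using one_le_power[of "norm x" 2] by (auto simp: K_def dot_square_norm)
        then show ?thesis using C c_zero[OF k, of "x \<bullet> x"] by (auto simp: D_def)
      qed (use C in auto)
      have supp: "Hb b x = 0" if "norm x \<ge> 1" for x
        using c_zero[OF k, of "x \<bullet> x"] one_le_power[OF that, of 2] by (simp add: Hb_def dot_square_norm)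
      show "integrable lborel (D b)" "(\<integral>x. D b x \<partial>lborel) = 0"
        using integral_line_derivative_eq_0[OF cont supp b der bd] by auto
    qed
    have "(\<Sum>b\<in>Basis. D b x) = c k (x \<bullet> x) * hext h x" for x
    proof (cases "x = 0")
      case True then show ?thesis using c_zero[OF k, of 0] by (simp add: D_def)
    next
      case False
      \<comment> \<open>The derivative of the cutoff is of size k, but it multiplies the radial
        derivative of F, which is zero; no estimate of it is required.\<close>
      have "(\<Sum>b\<in>Basis. D b x) = (\<Sum>b\<in>Basis. (2 * c' k (x \<bullet> x) * (x \<bullet> x) * A x + 2 * c k (x \<bullet> x) * A x) * ((x \<bullet> b) * pd1 b F x)
          + c k (x \<bullet> x) * (x \<bullet> x) * (pd1 b A x * pd1 b F x + A x * pd1 b (pd1 b F) x))"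
        by (rule sum.cong) (use False in \<open>simp_all add: D_def pdV V_def algebra_simps\<close>)
      also have "\<dots> = (2 * c' k (x \<bullet> x) * (x \<bullet> x) * A x + 2 * c k (x \<bullet> x) * A x) * (\<Sum>b\<in>Basis. (x \<bullet> b) * pd1 b F x)
          + c k (x \<bullet> x) * (x \<bullet> x) * ((\<Sum>b\<in>Basis. pd1 b A x * pd1 b F x) + A x * lapl F x)"
        unfolding lapl_def sum_distrib_left sum.distrib[symmetric] by (simp only: distrib_left)
      finally show ?thesis using eul[OF False] by (simp add: hext_h[OF False])
    qed
    then have "(\<integral>x. c k (x \<bullet> x) * hext h x \<partial>lborel) = (\<integral>x. (\<Sum>b\<in>Basis. D b x) \<partial>lborel)" by simp
    also have "\<dots> = (\<Sum>b\<in>Basis. \<integral>x. D b x \<partial>lborel)"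
      by (rule Bochner_Integration.integral_sum) (rule int0(1))
    finally show ?thesis using int0(2) by simp
  qed
  have "(\<lambda>j. \<integral>x. c (real (Suc j)) (x \<bullet> x) * hext h x \<partial>lborel) \<longlonglongrightarrow> (\<integral>x. indicator (ball 0 1) x * hext h x \<partial>lborel)"
  proof (rule integral_dominated_convergence[where w="\<lambda>x. norm (indicator (ball 0 1) x * hext h x)"])
    show hm: "(\<lambda>x. indicator (ball 0 1) x * hext h x) \<in> borel_measurable lborel"
      using integrable_hext[OF h] by auto
    show "integrable lborel (\<lambda>x. norm (indicator (ball 0 1) x * hext h x))"
      using integrable_hext[OF h] by (rule integrable_norm)
    have czero: "c (real (Suc j)) (x \<bullet> x) * hext h x = c (real (Suc j)) (x \<bullet> x) * (indicator (ball 0 1) x * hext h x)" for j and x :: 'a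
      using c_zero[of "real (Suc j)" "x \<bullet> x"] one_le_power[of "norm x" 2]
      by (cases "norm x < 1") (auto simp: dot_square_norm)
    have "(\<lambda>x::'a. c k (x \<bullet> x)) \<in> borel_measurable borel" for k
      by (intro borel_measurable_continuous_onI continuous_on_compose2[OF c_cont(1)] continuous_intros subset_UNIV)
    then show "(\<lambda>x. c (real (Suc j)) (x \<bullet> x) * hext h x) \<in> borel_measurable lborel" for j
      unfolding czero using hm by simp
    have "\<bar>c k \<tau>\<bar> \<le> 1" for k \<tau>
      unfolding c_def using mult_le_one[OF cutoff_bounds(2,1,2)] cutoff_bounds(1) by (simp add: abs_mult abs_of_nonneg)
    then have "\<bar>c k \<tau>\<bar> * y \<le> y" if "y \<ge> 0" for k \<tau> y :: real
      using that mult_right_mono[of "\<bar>c k \<tau>\<bar>" 1 y] by simp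
    then show "AE x in lborel. norm (c (real (Suc j)) (x \<bullet> x) * hext h x) \<le> norm (indicator (ball 0 1) x * hext h x)" for j
      unfolding czero by (intro AE_I2) (simp add: abs_mult)
    show "AE x in lborel. (\<lambda>j. c (real (Suc j)) (x \<bullet> x) * hext h x) \<longlonglongrightarrow> indicator (ball 0 1) x * hext h x"
    proof (rule AE_mp[OF AE_lborel_singleton[of 0]], rule AE_I2, rule impI)
      fix x :: 'a assume x: "x \<noteq> 0"
      show "(\<lambda>j. c (real (Suc j)) (x \<bullet> x) * hext h x) \<longlonglongrightarrow> indicator (ball 0 1) x * hext h x"
      proof (cases "norm x < 1")
        case True
        have t: "0 < x \<bullet> x" "x \<bullet> x < 1" using x True by (auto simp: dot_square_norm power_less_one_iff abs_square_less_1)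
        have lim: "(\<lambda>j. cutoff (real (Suc j) * s - 1)) \<longlonglongrightarrow> 1" if "s > 0" for s
        proof (rule filterlim_compose[OF cutoff_tendsto])
          have "LIM j sequentially. -1 + s * real (Suc j) :> at_top"
            by (intro filterlim_tendsto_add_at_top[OF tendsto_const] filterlim_tendsto_pos_mult_at_top[OF tendsto_const that]
                filterlim_compose[OF filterlim_real_sequentially filterlim_Suc])
          then show "LIM j sequentially. real (Suc j) * s - 1 :> at_top" by (simp add: mult.commute)
        qed
        have "(\<lambda>j. c (real (Suc j)) (x \<bullet> x) * hext h x) \<longlonglongrightarrow> 1 * 1 * hext h x"
          unfolding c_def by (intro tendsto_intros lim) (use t in auto)
        then show ?thesis using True by simp
      next
        case False
        then show ?thesis unfolding czero by simp
      qed
    qed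
  qed
  then have "(\<lambda>j::nat. 0) \<longlonglongrightarrow> (\<integral>x. indicator (ball 0 1) x * hext h x \<partial>lborel)"
    using key[of "real (Suc _)"] by simp
  then have "(\<integral>x. indicator (ball 0 1) x * hext h x \<partial>lborel) = 0"
    by (simp add: LIMSEQ_const_iff)
  then show ?thesis using sint_eq_lborel[OF h] by (simp add: h_def)
qed

section \<open>Sum, product and chain rules for gradient and Laplacian on the sphere\<close>

lemma sgrad_cong:
  assumes "\<And>z. z \<in> sphere 0 1 \<Longrightarrow> f z = g z" and z: "z \<in> sphere 0 1"
  shows "sgrad f z = sgrad g z"
proof -
  have "pd1 b (hext f) z = pd1 b (hext g) z" for b
    by (rule pd1_cong[OF open_punct]) (use z hext_cong[of f g, OF assms(1)] in auto)
  then show ?thesis by (simp add: sgrad_def)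
qed

lemma sdiv_cong:
  assumes "\<And>z. z \<in> sphere 0 1 \<Longrightarrow> f z = g z" and z: "z \<in> sphere 0 1"
  shows "sdiv f z = sdiv g z"
proof -
  have "pd1 b (\<lambda>x. hext f x \<bullet> b) z = pd1 b (\<lambda>x. hext g x \<bullet> b) z" for b
    by (rule pd1_cong[OF open_punct]) (use z hext_cong[of f g, OF assms(1)] in auto)
  then show ?thesis by (simp add: sdiv_def)
qed

lemma slap_cong:
  assumes "\<And>z. z \<in> sphere 0 1 \<Longrightarrow> f z = g z" "z \<in> sphere 0 1"
  shows "slap f z = slap g z"
  unfolding slap_def
proof (rule sdiv_cong)
  show "sgrad f x = sgrad g x" if "x \<in> sphere 0 1" for x
    using assms(1) that by (rule sgrad_cong)
qed (rule assms(2))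

lemma sint_cong:
  fixes f g :: "'a::euclidean_space \<Rightarrow> real"
  assumes "\<And>z. z \<in> sphere 0 1 \<Longrightarrow> f z = g z"
  shows "sint f = sint g"
proof -
  have "integral (ball 0 1) (hext f) = integral (ball 0 1) (hext g)"
    by (rule integral_spike[of "{0}"]) (use hext_cong[of f g, OF assms] in auto)
  then show ?thesis by (simp add: sint_def)
qed

context
  fixes f g :: "'a::euclidean_space \<Rightarrow> real" and z :: 'a
  assumes f: "smooth_sphere f" and g: "smooth_sphere g" and z: "z \<in> sphere 0 1"
begin

private lemma z0: "z \<in> - {0}" using z by auto

lemma sgrad_add: "sgrad (\<lambda>x. f x + g x) z = sgrad f z + sgrad g z"
proof -
  have "hext (\<lambda>x. f x + g x) = (\<lambda>x. hext f x + hext g x)" by (simp add: hext_def fun_eq_iff)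
  then show ?thesis
    by (simp add: sgrad_def pd1_add[OF smooth_sphereD[OF f] smooth_sphereD[OF g] z0] sum.distrib scaleR_add_left)
qed

lemma sgrad_mult: "sgrad (\<lambda>x. f x * g x) z = g z *\<^sub>R sgrad f z + f z *\<^sub>R sgrad g z"
proof -
  have "hext (\<lambda>x. f x * g x) = (\<lambda>x. hext f x * hext g x)" by (simp add: hext_def fun_eq_iff)
  then show ?thesis
    by (simp add: sgrad_def pd1_mult[OF smooth_sphereD[OF f] smooth_sphereD[OF g] z0] sum.distrib
        scaleR_add_left scaleR_sum_right hext_sphere[OF z] mult.commute)
qed

lemma slap_add: "slap (\<lambda>x. f x + g x) z = slap f z + slap g z"
proof -
  note sm = smooth_sphereD[OF f] smooth_sphereD[OF g]
  have h: "hext (\<lambda>x. f x + g x) = (\<lambda>x. hext f x + hext g x)" by (simp add: hext_def fun_eq_iff)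
  have "pd1 b (pd1 b (\<lambda>x. hext f x + hext g x)) z = pd1 b (pd1 b (hext f)) z + pd1 b (pd1 b (hext g)) z"
    if b: "b \<in> Basis" for b
  proof -
    have "pd1 b (pd1 b (\<lambda>x. hext f x + hext g x)) z = pd1 b (\<lambda>x. pd1 b (hext f) x + pd1 b (hext g) x) z"
      by (rule pd1_cong[OF open_punct z0]) (rule pd1_add[OF sm _ b])
    then show ?thesis using pd1_add[OF smooth_on_pd1[OF sm(1) b] smooth_on_pd1[OF sm(2) b] z0 b] by simp
  qed
  then show ?thesis
    by (simp add: slap_eq_lapl[OF smooth_sphere_add[OF f g] z] slap_eq_lapl[OF f z] slap_eq_lapl[OF g z]
        lapl_def h sum.distrib)
qed

lemma slap_mult: "slap (\<lambda>x. f x * g x) z = g z * slap f z + f z * slap g z + 2 * (sgrad f z \<bullet> sgrad g z)"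
proof -
  note sm = smooth_sphereD[OF f] smooth_sphereD[OF g]
  have h: "hext (\<lambda>x. f x * g x) = (\<lambda>x. hext f x * hext g x)" by (simp add: hext_def fun_eq_iff)
  have "pd1 b (pd1 b (\<lambda>x. hext f x * hext g x)) z = g z * pd1 b (pd1 b (hext f)) z + f z * pd1 b (pd1 b (hext g)) z
      + 2 * (pd1 b (hext f) z * pd1 b (hext g) z)" if b: "b \<in> Basis" for b
  proof -
    note sm' = smooth_on_pd1[OF sm(1) b] smooth_on_pd1[OF sm(2) b]
    have "pd1 b (pd1 b (\<lambda>x. hext f x * hext g x)) z = pd1 b (\<lambda>x. pd1 b (hext f) x * hext g x + hext f x * pd1 b (hext g) x) z"
      by (rule pd1_cong[OF open_punct z0]) (rule pd1_mult[OF sm _ b])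
    then show ?thesis
      unfolding pd1_add[OF smooth_on_mult[OF open_punct sm'(1) sm(2)] smooth_on_mult[OF open_punct sm(1) sm'(2)] z0 b]
        pd1_mult[OF sm'(1) sm(2) z0 b] pd1_mult[OF sm(1) sm'(2) z0 b]
      by (simp add: hext_sphere[OF z])
  qed
  then show ?thesis
    by (simp add: slap_eq_lapl[OF smooth_sphere_mult[OF f g] z] slap_eq_lapl[OF f z] slap_eq_lapl[OF g z]
        lapl_def h sum.distrib sum_distrib_left sgrad_dot)
qed

end

lemma sgrad_exp:
  fixes f :: "'a::euclidean_space \<Rightarrow> real"
  assumes f: "smooth_sphere f" and z: "z \<in> sphere 0 1"
  shows "sgrad (\<lambda>x. exp (f x)) z = exp (f z) *\<^sub>R sgrad f z"
proof -
  have z0: "z \<in> - {0}" using z by auto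
  have "hext (\<lambda>x. exp (f x)) = (\<lambda>x. exp (hext f x))" by (simp add: hext_def fun_eq_iff)
  then show ?thesis
    by (simp add: sgrad_def pd1_exp[OF smooth_sphereD[OF f] z0] scaleR_sum_right hext_sphere[OF z])
qed

lemma slap_exp:
  fixes f :: "'a::euclidean_space \<Rightarrow> real"
  assumes f: "smooth_sphere f" and z: "z \<in> sphere 0 1"
  shows "slap (\<lambda>x. exp (f x)) z = exp (f z) * (slap f z + sgrad f z \<bullet> sgrad f z)"
proof -
  have z0: "z \<in> - {0}" using z by auto
  note sm = smooth_sphereD[OF f]
  have h: "hext (\<lambda>x. exp (f x)) = (\<lambda>x. exp (hext f x))" by (simp add: hext_def fun_eq_iff)
  have "pd1 b (pd1 b (\<lambda>x. exp (hext f x))) z = exp (f z) * (pd1 b (pd1 b (hext f)) z + pd1 b (hext f) z * pd1 b (hext f) z)"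
    if b: "b \<in> Basis" for b
  proof -
    note sm' = smooth_on_pd1[OF sm b]
    have "pd1 b (pd1 b (\<lambda>x. exp (hext f x))) z = pd1 b (\<lambda>x. exp (hext f x) * pd1 b (hext f) x) z"
      by (rule pd1_cong[OF open_punct z0]) (rule pd1_exp[OF sm _ b])
    then show ?thesis
      unfolding pd1_mult[OF smooth_on_exp[OF open_punct sm] sm' z0 b] pd1_exp[OF sm z0 b]
      by (simp add: hext_sphere[OF z] algebra_simps)
  qed
  then show ?thesis
    by (simp add: slap_eq_lapl[OF smooth_sphere_exp[OF f] z] slap_eq_lapl[OF f z]
        lapl_def h sum.distrib sum_distrib_left sgrad_dot distrib_left)
qed
lemma sgrad_const: "sgrad (\<lambda>x. c) (z::'a::euclidean_space) = 0"
proof -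
  have "hext (\<lambda>x::'a. c) = (\<lambda>x. c)" by (simp add: hext_def fun_eq_iff)
  then show ?thesis by (simp add: sgrad_def)
qed

lemma slap_const: "slap (\<lambda>x. c) (z::'a::euclidean_space) = 0"
proof -
  have "sgrad (\<lambda>x::'a. c) = (\<lambda>x. 0)" by (simp add: sgrad_const fun_eq_iff)
  moreover have "hext (\<lambda>x::'a. 0::'a) = (\<lambda>x. 0)" by (simp add: hext_def fun_eq_iff)
  ultimately show ?thesis by (simp add: slap_def sdiv_def)
qed

section \<open>Linear functions on the sphere: gradient, Laplacian and Hessian\<close>

lemma pd1_hext_coord:
  assumes x: "x \<noteq> 0" and b: "b \<in> Basis"
  shows "pd1 b (hext (\<lambda>z. z \<bullet> v)) x = inverse (norm x) * (b \<bullet> v) - inverse (norm x) ^ 3 * (x \<bullet> b) * (x \<bullet> v)"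
proof -
  have "pd1 b (hext (\<lambda>z. z \<bullet> v)) x = pd1 b (\<lambda>x. inverse (norm x) * (x \<bullet> v)) x"
    by (rule pd1_cong[OF open_punct]) (use x in \<open>auto simp: hext_def\<close>)
  also have "\<dots> = inverse (norm x) * (b \<bullet> v) - inverse (norm x) ^ 3 * (x \<bullet> b) * (x \<bullet> v)"
  proof -
    have 1: "((\<lambda>t. norm (x + t *\<^sub>R b)) has_real_derivative pd1 b norm x) (at 0)"
      using smooth_on_line[OF smooth_on_norm b, of x] x by simp
    have "pd1 b (\<lambda>y. norm y * norm y) x = pd1 b norm x * norm x + norm x * pd1 b norm x"
      by (rule pd1_mult[OF smooth_on_norm smooth_on_norm _ b]) (use x in auto)
    moreover have "(\<lambda>y::'a. norm y * norm y) = (\<lambda>y. y \<bullet> y)"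
      by (simp add: fun_eq_iff dot_square_norm power2_eq_square)
    ultimately have N: "pd1 b norm x = inverse (norm x) * (x \<bullet> b)"
      using pd1_inner_self[of b x] x by (simp add: field_simps)
    have "pd1 b (\<lambda>x. inverse (norm x)) x = - (inverse (norm x) ^ 3 * (x \<bullet> b))"
      unfolding pd1_def[of b "\<lambda>x. inverse (norm x)"]
      by (rule DERIV_imp_deriv) (use DERIV_inverse_fun[OF 1] x in \<open>auto simp: N power3_eq_cube mult_ac\<close>)
    then show ?thesis
      using pd1_mult[OF smooth_on_norm_inv smooth_on_inner[OF open_punct], of x b v] x b
      by (simp add: pd1_inner)
  qed
  finally show ?thesis .
qed

lemma sgrad_coord: "(z::'a::euclidean_space) \<in> sphere 0 1 \<Longrightarrow> sgrad (\<lambda>z. z \<bullet> v) z = v - (z \<bullet> v) *\<^sub>R z"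
proof (rule euclidean_eqI)
  fix b :: 'a assume z: "z \<in> sphere 0 1" and b: "b \<in> Basis"
  then show "sgrad (\<lambda>z. z \<bullet> v) z \<bullet> b = (v - (z \<bullet> v) *\<^sub>R z) \<bullet> b"
    unfolding sgrad_inner[OF b] pd1_hext_coord[OF sphere_nonzero[OF z] b]
    by (simp add: inner_diff_left inner_commute[of b v])
qed

lemma slap_coord:
  fixes z :: "'a::euclidean_space"
  assumes z: "z \<in> sphere 0 1"
  shows "slap (\<lambda>z. z \<bullet> v) z = - (real DIM('a) - 1) * (z \<bullet> v)"
proof -
  have z0: "z \<in> - {0}" using z by auto
  have "pd1 b (\<lambda>x. hext (sgrad (\<lambda>z. z \<bullet> v)) x \<bullet> b) z = - ((b \<bullet> v) * (z \<bullet> b)) - (z \<bullet> v) + 2 * (z \<bullet> v) * ((z \<bullet> b) * (z \<bullet> b))"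
    if b: "b \<in> Basis" for b
  proof -
    have "pd1 b (\<lambda>x. hext (sgrad (\<lambda>z. z \<bullet> v)) x \<bullet> b) z = pd1 b (\<lambda>x. v \<bullet> b - hext (\<lambda>z. (z \<bullet> v) * (z \<bullet> b)) x) z"
    proof (rule pd1_cong[OF open_punct z0])
      fix x :: 'a assume "x \<in> - {0}"
      then have "x /\<^sub>R norm x \<in> sphere 0 1" by simp
      from sgrad_coord[OF this, of v] show "hext (sgrad (\<lambda>z. z \<bullet> v)) x \<bullet> b = v \<bullet> b - hext (\<lambda>z. (z \<bullet> v) * (z \<bullet> b)) x"
        by (simp add: hext_def inner_diff_left)
    qed
    also have "\<dots> = pd1 b (\<lambda>x. v \<bullet> b + (-1) * hext (\<lambda>z. (z \<bullet> v) * (z \<bullet> b)) x) z" by simp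
    also have "\<dots> = - pd1 b (hext (\<lambda>z. (z \<bullet> v) * (z \<bullet> b))) z"
    proof -
      have s: "smooth_on (-{0}) (hext (\<lambda>z. (z \<bullet> v) * (z \<bullet> b)))"
        by (intro smooth_sphereD smooth_sphere_mult smooth_sphere_coord)
      show ?thesis
        unfolding pd1_add[OF smooth_on_const[OF open_punct] smooth_on_mult[OF open_punct smooth_on_const[OF open_punct] s] z0 b]
          pd1_mult[OF smooth_on_const[OF open_punct] s z0 b] by simp
    qed
    also have "pd1 b (hext (\<lambda>z. (z \<bullet> v) * (z \<bullet> b))) z = sgrad (\<lambda>z. (z \<bullet> v) * (z \<bullet> b)) z \<bullet> b"
      using b by (simp add: sgrad_inner)
    finally show ?thesis using z b
      by (simp add: sgrad_mult[OF smooth_sphere_coord smooth_sphere_coord z] sgrad_coord[OF z] inner_diff_left inner_add_left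
          algebra_simps inner_commute[of b v])
  qed
  then have "slap (\<lambda>z. z \<bullet> v) z = - (\<Sum>b\<in>Basis. (z \<bullet> b) * (v \<bullet> b)) - real DIM('a) * (z \<bullet> v)
      + 2 * (z \<bullet> v) * (\<Sum>b\<in>Basis. (z \<bullet> b) * (z \<bullet> b))"
    by (simp add: slap_def sdiv_def sum.distrib sum_subtractf sum_distrib_left sum_negf inner_commute mult.commute mult.left_commute)
  also have "\<dots> = - (real DIM('a) - 1) * (z \<bullet> v)"
    unfolding euclidean_inner[symmetric] using z by (simp add: dot_square_norm algebra_simps)
  finally show ?thesis .
qed

text \<open>The Hessian of a linear function restricted to the sphere is minus that function times the metric.\<close>

lemma hessian_coord:
  fixes f :: "'a::euclidean_space \<Rightarrow> real"
  assumes f: "smooth_sphere f" and z: "z \<in> sphere 0 1"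
  shows "2 * (sgrad f z \<bullet> sgrad (\<lambda>z. v \<bullet> sgrad f z) z) - v \<bullet> sgrad (\<lambda>z. sgrad f z \<bullet> sgrad f z) z
      = - 2 * (z \<bullet> v) * (sgrad f z \<bullet> sgrad f z)"
    and "smooth_sphere (\<lambda>z. v \<bullet> sgrad f z)"
proof -
  have z0: "z \<in> - {0}" using z by auto
  define F where "F = hext f"
  have F: "smooth_on (- {0}) F" using f by (simp add: F_def smooth_sphereD)
  have h1: "hext (\<lambda>z. v \<bullet> sgrad f z) x = norm x * (\<Sum>c\<in>Basis. (v \<bullet> c) * pd1 c F x)" if "x \<noteq> 0" for x
  proof -
    have "hext (\<lambda>z. v \<bullet> sgrad f z) x = (\<Sum>c\<in>Basis. (v \<bullet> c) * (hext (sgrad f) x \<bullet> c))"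
      unfolding hext_def[of "\<lambda>z. v \<bullet> sgrad f z"] hext_def[of "sgrad f"] by (rule euclidean_inner)
    then show ?thesis using that by (simp add: hext_sgrad[OF f] F_def sum_distrib_left mult_ac)
  qed
  have sc: "smooth_on (- {0}) (\<lambda>x. \<Sum>c\<in>Basis. (v \<bullet> c) * pd1 c F x)"
    by (intro smooth_on_sum smooth_on_mult smooth_on_const smooth_on_pd1 F open_punct)
  show "smooth_sphere (\<lambda>z. v \<bullet> sgrad f z)"
    by (rule smooth_sphereI[OF smooth_on_mult[OF open_punct smooth_on_norm sc] h1])
  define S where "S = (\<Sum>c\<in>Basis. (v \<bullet> c) * pd1 c F z)"
  have d1: "pd1 b (hext (\<lambda>z. v \<bullet> sgrad f z)) z = (z \<bullet> b) * S + (\<Sum>c\<in>Basis. (v \<bullet> c) * pd1 b (pd1 c F) z)"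
    if b: "b \<in> Basis" for b
  proof -
    have "pd1 b (hext (\<lambda>z. v \<bullet> sgrad f z)) z = pd1 b (\<lambda>x. norm x * (\<Sum>c\<in>Basis. (v \<bullet> c) * pd1 c F x)) z"
      by (rule pd1_cong[OF open_punct z0]) (simp add: h1)
    also have "\<dots> = pd1 b norm z * S + norm z * pd1 b (\<lambda>x. \<Sum>c\<in>Basis. (v \<bullet> c) * pd1 c F x) z"
      unfolding S_def by (rule pd1_mult[OF smooth_on_norm sc z0 b])
    also have "pd1 b (\<lambda>x. \<Sum>c\<in>Basis. (v \<bullet> c) * pd1 c F x) z = (\<Sum>c\<in>Basis. pd1 b (\<lambda>x. (v \<bullet> c) * pd1 c F x) z)"
      by (rule pd1_sum[OF _ z0 b]) (intro smooth_on_mult smooth_on_const smooth_on_pd1 F open_punct)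
    also have "\<dots> = (\<Sum>c\<in>Basis. (v \<bullet> c) * pd1 b (pd1 c F) z)"
      by (rule sum.cong) (use pd1_mult[OF smooth_on_const[OF open_punct] smooth_on_pd1[OF F] z0 b] in auto)
    finally show ?thesis using z b by (simp add: pd1_norm)
  qed
  have d2: "pd1 c (hext (\<lambda>z. sgrad f z \<bullet> sgrad f z)) z
      = 2 * (z \<bullet> c) * (\<Sum>b\<in>Basis. pd1 b F z * pd1 b F z) + 2 * (\<Sum>b\<in>Basis. pd1 b F z * pd1 c (pd1 b F) z)"
    if c: "c \<in> Basis" for c
  proof -
    have sb: "smooth_on (- {0}) (\<lambda>x. \<Sum>b\<in>Basis. pd1 b F x * pd1 b F x)"
      by (intro smooth_on_sum smooth_on_mult smooth_on_pd1 F open_punct)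
    have "pd1 c (hext (\<lambda>z. sgrad f z \<bullet> sgrad f z)) z = pd1 c (\<lambda>x. (x \<bullet> x) * (\<Sum>b\<in>Basis. pd1 b F x * pd1 b F x)) z"
      by (rule pd1_cong[OF open_punct z0]) (simp add: hext_sgrad_dot[OF f f] F_def)
    also have "\<dots> = 2 * (z \<bullet> c) * (\<Sum>b\<in>Basis. pd1 b F z * pd1 b F z)
        + (z \<bullet> z) * pd1 c (\<lambda>x. \<Sum>b\<in>Basis. pd1 b F x * pd1 b F x) z"
      using pd1_mult[OF smooth_on_inner_self sb z0 c] by (simp add: pd1_inner_self)
    also have "pd1 c (\<lambda>x. \<Sum>b\<in>Basis. pd1 b F x * pd1 b F x) z = (\<Sum>b\<in>Basis. pd1 c (\<lambda>x. pd1 b F x * pd1 b F x) z)"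
      by (rule pd1_sum[OF _ z0 c]) (intro smooth_on_mult smooth_on_pd1 F open_punct)
    also have "\<dots> = (\<Sum>b\<in>Basis. 2 * (pd1 b F z * pd1 c (pd1 b F) z))"
      by (rule sum.cong) (use pd1_mult[OF smooth_on_pd1[OF F] smooth_on_pd1[OF F] z0 c] in auto)
    finally show ?thesis using z by (simp add: dot_square_norm sum_distrib_left)
  qed
  have eul: "(\<Sum>b\<in>Basis. (z \<bullet> b) * pd1 b F z) = 0"
    unfolding F_def using z0 by (intro euler_hext[OF f]) auto
  have "sgrad f z \<bullet> sgrad (\<lambda>z. v \<bullet> sgrad f z) z
      = S * (\<Sum>b\<in>Basis. (z \<bullet> b) * pd1 b F z) + (\<Sum>b\<in>Basis. \<Sum>c\<in>Basis. (v \<bullet> c) * (pd1 b F z * pd1 b (pd1 c F) z))"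
    unfolding sgrad_dot by (simp add: d1 F_def[symmetric] sum.distrib sum_distrib_left algebra_simps)
  moreover have "v \<bullet> sgrad (\<lambda>z. sgrad f z \<bullet> sgrad f z) z = 2 * (\<Sum>c\<in>Basis. (v \<bullet> c) * (z \<bullet> c)) * (\<Sum>b\<in>Basis. pd1 b F z * pd1 b F z)
     + 2 * (\<Sum>c\<in>Basis. \<Sum>b\<in>Basis. (v \<bullet> c) * (pd1 b F z * pd1 c (pd1 b F) z))"
  proof -
    have "v \<bullet> sgrad (\<lambda>z. sgrad f z \<bullet> sgrad f z) z = (\<Sum>c\<in>Basis. (v \<bullet> c) * pd1 c (hext (\<lambda>z. sgrad f z \<bullet> sgrad f z)) z)"
      by (subst euclidean_inner) (simp add: sgrad_inner)
    also have "\<dots> = (\<Sum>c\<in>Basis. 2 * ((v \<bullet> c) * (z \<bullet> c)) * (\<Sum>b\<in>Basis. pd1 b F z * pd1 b F z)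
        + 2 * (\<Sum>b\<in>Basis. (v \<bullet> c) * (pd1 b F z * pd1 c (pd1 b F) z)))"
      by (rule sum.cong) (simp_all add: d2 sum_distrib_left distrib_left mult_ac)
    finally show ?thesis by (simp add: sum.distrib flip: sum_distrib_left sum_distrib_right)
  qed
  \<comment> \<open>By symmetry of second derivatives the two double sums agree and cancel; what
    remains comes from differentiating the factor |x|^2.\<close>
  moreover have "(\<Sum>c\<in>Basis. \<Sum>b\<in>Basis. (v \<bullet> c) * (pd1 b F z * pd1 c (pd1 b F) z))
      = (\<Sum>b\<in>Basis. \<Sum>c\<in>Basis. (v \<bullet> c) * (pd1 b F z * pd1 b (pd1 c F) z))"
  proof (subst sum.swap, intro sum.cong refl)
    fix b c :: 'a assume "b \<in> Basis" "c \<in> Basis"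
    from pd1_commute[OF open_punct z0 F this]
    show "(v \<bullet> c) * (pd1 b F z * pd1 c (pd1 b F) z) = (v \<bullet> c) * (pd1 b F z * pd1 b (pd1 c F) z)"
      by simp
  qed
  moreover have "(\<Sum>c\<in>Basis. (v \<bullet> c) * (z \<bullet> c)) = z \<bullet> v"
    by (subst inner_commute[of z v]) (rule euclidean_inner[symmetric])
  ultimately show "2 * (sgrad f z \<bullet> sgrad (\<lambda>z. v \<bullet> sgrad f z) z) - v \<bullet> sgrad (\<lambda>z. sgrad f z \<bullet> sgrad f z) z
      = - 2 * (z \<bullet> v) * (sgrad f z \<bullet> sgrad f z)"
    unfolding sgrad_dot F_def[symmetric] eul by simp
qed

section \<open>The ring of smooth functions on the sphere\<close>

text \<open>Bundling smoothness into a type removes all smoothness side conditions, and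
  differential identities become ring identities that can be checked pointwise.\<close>

typedef (overloaded) 'a sfun =
  "{f :: 'a::euclidean_space \<Rightarrow> real. smooth_sphere f \<and> (\<forall>z. z \<notin> sphere 0 1 \<longrightarrow> f z = 0)}"
  morphisms ev Abs_sfun
  by (rule exI[of _ "\<lambda>_. 0"]) (simp add: smooth_sphere_const)

definition toS :: "('a::euclidean_space \<Rightarrow> real) \<Rightarrow> 'a sfun" where
  "toS f = Abs_sfun (\<lambda>z. if z \<in> sphere 0 1 then f z else 0)"

lemma smooth_ev: "smooth_sphere (ev f)"
  using ev[of f] by simp

lemma ev_toS: "smooth_sphere f \<Longrightarrow> z \<in> sphere 0 1 \<Longrightarrow> ev (toS f) z = f z"
proof -
  assume f: "smooth_sphere f" and z: "z \<in> sphere 0 1"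
  have "smooth_sphere (\<lambda>z. if z \<in> sphere 0 1 then f z else 0)"
    using f smooth_sphere_cong[of f "\<lambda>z. if z \<in> sphere 0 1 then f z else 0"] by simp
  then show ?thesis using z unfolding toS_def by (subst Abs_sfun_inverse) auto
qed

text \<open>Elements are normalised to vanish off the sphere, so agreement on the sphere is
  equality.\<close>

lemma sfun_eqI:
  assumes "\<And>z. z \<in> sphere 0 1 \<Longrightarrow> ev f z = ev g z"
  shows "f = g"
proof -
  have "ev f z = ev g z" for z
    using assms ev[of f] ev[of g] by (cases "z \<in> sphere 0 1") auto
  then show ?thesis by (simp add: ev_inject[symmetric] fun_eq_iff)
qed

instantiation sfun :: (euclidean_space) comm_ring_1
begin

definition "f + g = toS (\<lambda>z. ev f z + ev g z)"
definition "f * g = toS (\<lambda>z. ev f z * ev g z)"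
definition "- f = toS (\<lambda>z. - 1 * ev f z)"
definition minus_sfun where "minus_sfun f g = f + - (g :: 'a sfun)"
definition "0 = toS (\<lambda>_. 0)"
definition "1 = toS (\<lambda>_. 1)"

lemma ev_ring:
  assumes "z \<in> sphere 0 1"
  shows "ev (f + g) z = ev f z + ev g z" "ev (f * g) z = ev f z * ev g z" "ev (- f) z = - ev f z"
    "ev (f - g) z = ev f z - ev g z" "ev 0 z = 0" "ev 1 z = 1"
  using assms
  by (simp_all add: plus_sfun_def times_sfun_def uminus_sfun_def minus_sfun_def zero_sfun_def one_sfun_def
      ev_toS smooth_ev smooth_sphere_add smooth_sphere_mult[OF smooth_sphere_const smooth_ev, of "-1", simplified]
      smooth_sphere_mult smooth_sphere_const)

instance
proof
  obtain b :: 'a where "b \<in> Basis" using nonempty_Basis by blast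
  then have "b \<in> sphere 0 1" by simp
  then show "(0::'a sfun) \<noteq> 1" using ev_ring(5,6) by (metis zero_neq_one)
qed (rule sfun_eqI; simp add: ev_ring algebra_simps)+

end

lemma ev_sum: "z \<in> sphere 0 1 \<Longrightarrow> ev (sum f A) z = (\<Sum>i\<in>A. ev (f i) z)"
  by (induction A rule: infinite_finite_induct) (auto simp: ev_ring)

section \<open>Constants, coordinates, exp, ln and the differential operators on the ring\<close>

definition cst :: "real \<Rightarrow> 'a::euclidean_space sfun" where "cst c = toS (\<lambda>_. c)"

definition coord :: "'a::euclidean_space \<Rightarrow> 'a sfun" where "coord v = toS (\<lambda>z. z \<bullet> v)"

definition sexp :: "'a::euclidean_space sfun \<Rightarrow> 'a sfun" where "sexp f = toS (\<lambda>z. exp (ev f z))"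

text \<open>\<^term>\<open>sln f\<close> is only meaningful for everywhere positive functions.\<close>

definition sln :: "'a::euclidean_space sfun \<Rightarrow> 'a sfun" where "sln f = toS (\<lambda>z. ln (ev f z))"

text \<open>The carre du champ of the round metric. All later geometry is expressed by it, the
  Laplacian \<open>Lp\<close> and the integral \<open>SI\<close>; no tensors occur.\<close>

definition Gm :: "'a::euclidean_space sfun \<Rightarrow> 'a sfun \<Rightarrow> 'a sfun" where
  "Gm f g = toS (\<lambda>z. sgrad (ev f) z \<bullet> sgrad (ev g) z)"

definition Lp :: "'a::euclidean_space sfun \<Rightarrow> 'a sfun" where "Lp f = toS (slap (ev f))"

definition SI :: "'a::euclidean_space sfun \<Rightarrow> real" where "SI f = sint (ev f)"

definition pos_on :: "'a::euclidean_space sfun \<Rightarrow> bool" where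
  "pos_on f \<longleftrightarrow> (\<forall>z\<in>sphere 0 1. ev f z > 0)"

lemma ev_cst: "z \<in> sphere 0 1 \<Longrightarrow> ev (cst c) z = c"
  by (simp add: cst_def ev_toS smooth_sphere_const)

lemma ev_coord: "z \<in> sphere 0 1 \<Longrightarrow> ev (coord v) z = z \<bullet> v"
  by (simp add: coord_def ev_toS smooth_sphere_coord)

lemma ev_sexp: "z \<in> sphere 0 1 \<Longrightarrow> ev (sexp f) z = exp (ev f z)"
  by (simp add: sexp_def ev_toS smooth_sphere_exp smooth_ev)

lemma ev_sln: "pos_on f \<Longrightarrow> z \<in> sphere 0 1 \<Longrightarrow> ev (sln f) z = ln (ev f z)"
  unfolding sln_def pos_on_def by (intro ev_toS smooth_sphere_ln smooth_ev) auto

lemma ev_Gm: "z \<in> sphere 0 1 \<Longrightarrow> ev (Gm f g) z = sgrad (ev f) z \<bullet> sgrad (ev g) z"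
  by (simp add: Gm_def ev_toS smooth_sphere_sgrad_dot smooth_ev)

lemma ev_Lp: "z \<in> sphere 0 1 \<Longrightarrow> ev (Lp f) z = slap (ev f) z"
  by (simp add: Lp_def ev_toS smooth_sphere_slap smooth_ev)

lemma pos_sexp: "pos_on (sexp f)"
  by (simp add: pos_on_def ev_sexp)

lemma sexp_sln: "pos_on f \<Longrightarrow> sexp (sln f) = f"
  by (rule sfun_eqI) (auto simp: ev_sexp ev_sln pos_on_def)

lemma sexp_add: "sexp (f + g) = sexp f * sexp g"
  by (rule sfun_eqI) (simp add: ev_sexp ev_ring exp_add)

lemma sexp_0: "sexp 0 = 1"
  by (rule sfun_eqI) (simp add: ev_sexp ev_ring)

lemma cst_hom: "cst (a + b) = cst a + cst b" "cst (a * b) = cst a * cst b" "cst (- a) = - cst a"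
    "cst (a - b) = cst a - cst b" "cst 0 = 0" "cst 1 = 1"
  by (rule sfun_eqI, simp add: ev_ring ev_cst)+

lemma Gm_commute: "Gm f g = Gm g f"
  by (rule sfun_eqI) (simp add: ev_Gm inner_commute)

lemma Gm_left:
  shows "Gm (f + g) h = Gm f h + Gm g h" and "Gm (f * g) h = g * Gm f h + f * Gm g h"
    and "Gm (cst c) h = 0" and "Gm (sexp f) h = sexp f * Gm f h"
proof -
  have 1: "sgrad (ev (f + g)) z = sgrad (ev f) z + sgrad (ev g) z"
    and 2: "sgrad (ev (f * g)) z = ev g z *\<^sub>R sgrad (ev f) z + ev f z *\<^sub>R sgrad (ev g) z"
    and 3: "sgrad (ev (cst c)) z = 0"
    and 4: "sgrad (ev (sexp f)) z = exp (ev f z) *\<^sub>R sgrad (ev f) z" if z: "z \<in> sphere 0 1" for z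
    unfolding sgrad_add[OF smooth_ev smooth_ev z, symmetric] sgrad_mult[OF smooth_ev smooth_ev z, symmetric]
      sgrad_exp[OF smooth_ev z, symmetric] sgrad_const[of c z, symmetric]
    by (rule sgrad_cong[OF _ z], simp only: ev_ring ev_sexp ev_cst)+
  show "Gm (f + g) h = Gm f h + Gm g h" "Gm (f * g) h = g * Gm f h + f * Gm g h"
    by (rule sfun_eqI, simp add: ev_Gm ev_ring 1 2 inner_add_left)+
  show "Gm (cst c) h = 0" "Gm (sexp f) h = sexp f * Gm f h"
    by (rule sfun_eqI, simp add: ev_Gm ev_ring ev_sexp 3 4)+
qed

lemma Gm_right:
  shows "Gm h (f + g) = Gm h f + Gm h g" and "Gm h (f * g) = g * Gm h f + f * Gm h g"
    and "Gm h (cst c) = 0" and "Gm h (sexp f) = sexp f * Gm h f"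
  using Gm_left Gm_commute by metis+

lemma uminus_eq_cst: "- f = cst (-1) * (f :: 'a::euclidean_space sfun)"
  by (rule sfun_eqI) (simp add: ev_ring ev_cst)

lemma Gm_minus:
  fixes f g g' h :: "'a::euclidean_space sfun"
  shows "Gm (- f) g = - Gm f g" "Gm g (- f) = - Gm g f"
    "Gm (f - g') h = Gm f h - Gm g' h" "Gm h (f - g') = Gm h f - Gm h g'" "Gm 0 f = 0" "Gm f 0 = 0"
    "Gm 1 f = 0" "Gm f 1 = 0"
proof -
  show 1: "Gm (- f) g = - Gm f g" for f g :: "'a sfun"
    unfolding uminus_eq_cst[of f] uminus_eq_cst[of "Gm f g"] Gm_left(2,3) by simp
  show 2: "Gm (f - g') h = Gm f h - Gm g' h" for f g' h :: "'a sfun"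
    unfolding diff_conv_add_uminus Gm_left 1 ..
  show 3: "Gm 0 f = 0" "Gm 1 f = 0" for f :: "'a sfun"
    using Gm_left(3)[of 0 f] Gm_left(3)[of 1 f] by (simp_all add: cst_hom)
  show "Gm g (- f) = - Gm g f"
    using 1[of f g] unfolding Gm_commute[of "- f" g] Gm_commute[of f g] .
  show "Gm h (f - g') = Gm h f - Gm h g'"
    using 2[of f g' h] unfolding Gm_commute[of "f - g'" h] Gm_commute[of f h] Gm_commute[of g' h] .
  show "Gm f 0 = 0" "Gm f 1 = 0"
    using 3[of f] unfolding Gm_commute[of 0 f] Gm_commute[of 1 f] .
qed

lemma Lp_rules:
  fixes f g :: "'a::euclidean_space sfun"
  shows "Lp (f + g) = Lp f + Lp g" and "Lp (f * g) = g * Lp f + f * Lp g + cst 2 * Gm f g"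
    and "Lp (cst c :: 'a sfun) = 0" and "Lp (sexp f) = sexp f * (Lp f + Gm f f)"
proof -
  have 1: "slap (ev (f + g)) z = slap (ev f) z + slap (ev g) z"
    and 2: "slap (ev (f * g)) z = ev g z * slap (ev f) z + ev f z * slap (ev g) z + 2 * (sgrad (ev f) z \<bullet> sgrad (ev g) z)"
    and 3: "slap (ev (cst c)) z = 0"
    and 4: "slap (ev (sexp f)) z = exp (ev f z) * (slap (ev f) z + sgrad (ev f) z \<bullet> sgrad (ev f) z)" if z: "z \<in> sphere 0 1" for z
    unfolding slap_add[OF smooth_ev smooth_ev z, symmetric] slap_mult[OF smooth_ev smooth_ev z, symmetric]
      slap_exp[OF smooth_ev z, symmetric] slap_const[of c z, symmetric]
    by (rule slap_cong[OF _ z], simp only: ev_ring ev_sexp ev_cst)+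
  show "Lp (f + g) = Lp f + Lp g" "Lp (f * g) = g * Lp f + f * Lp g + cst 2 * Gm f g"
    by (rule sfun_eqI, simp add: ev_Lp ev_Gm ev_ring ev_cst 1 2)+
  show "Lp (cst c :: 'a sfun) = 0" "Lp (sexp f) = sexp f * (Lp f + Gm f f)"
    by (rule sfun_eqI, simp only: ev_Lp ev_Gm ev_ring ev_sexp 3 4)+
qed

lemma Lp_minus:
  fixes f g :: "'a::euclidean_space sfun"
  shows "Lp (- f) = - Lp f" "Lp (f - g) = Lp f - Lp g" "Lp (0 :: 'a sfun) = 0" "Lp (1 :: 'a sfun) = 0"
proof -
  show 1: "Lp (- f) = - Lp f" for f :: "'a sfun"
    unfolding uminus_eq_cst[of f] uminus_eq_cst[of "Lp f"] Lp_rules(2,3) Gm_left(3) by simp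
  show "Lp (f - g) = Lp f - Lp g"
    unfolding diff_conv_add_uminus Lp_rules 1 ..
  show "Lp (0 :: 'a sfun) = 0" "Lp (1 :: 'a sfun) = 0"
    using Lp_rules(3)[where 'a='a, of 0] Lp_rules(3)[where 'a='a, of 1] by (simp_all add: cst_hom)
qed

lemma sgrad_ev_coord:
  assumes "z \<in> sphere 0 1"
  shows "sgrad (ev (coord v)) z = v - (z \<bullet> v) *\<^sub>R z"
  using sgrad_cong[of "ev (coord v)" "\<lambda>z. z \<bullet> v", OF ev_coord assms] sgrad_coord[OF assms] by simp

lemma Gm_coord_eq: "z \<in> sphere 0 1 \<Longrightarrow> ev (Gm (coord v) f) z = v \<bullet> sgrad (ev f) z"
  using sgrad_tangent[OF smooth_ev[of f], of z]
  by (simp add: ev_Gm sgrad_ev_coord inner_diff_left)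

lemma Gm_coord_coord: "Gm (coord v) (coord w) = cst (v \<bullet> w) - coord v * coord w"
proof (rule sfun_eqI)
  fix z :: 'a assume z: "z \<in> sphere 0 1"
  show "ev (Gm (coord v) (coord w)) z = ev (cst (v \<bullet> w) - coord v * coord w) z"
    using z unfolding Gm_coord_eq[OF z] sgrad_ev_coord[OF z]
    by (simp add: ev_ring ev_cst ev_coord inner_diff_right inner_commute)
qed

lemma Lp_coord: "Lp (coord v) = - cst (real DIM('a) - 1) * coord (v :: 'a::euclidean_space)"
proof (rule sfun_eqI)
  fix z :: 'a assume z: "z \<in> sphere 0 1"
  show "ev (Lp (coord v)) z = ev (- cst (real DIM('a) - 1) * coord v) z"
    using slap_cong[of "ev (coord v)" "\<lambda>z. z \<bullet> v", OF ev_coord z]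
    unfolding ev_Lp[OF z] ev_ring[OF z] ev_cst[OF z] ev_coord[OF z] slap_coord[OF z] by simp
qed

text \<open>The left side is twice the Hessian of the coordinate evaluated on grad f. Stated through
  \<open>Gm\<close> alone, it makes Hessian computations for conformal factors possible inside the
  ring.\<close>

lemma Gm_coord_hessian: "cst 2 * Gm f (Gm (coord v) f) - Gm (coord v) (Gm f f) = - cst 2 * coord v * Gm f f"
proof (rule sfun_eqI)
  fix z :: 'a assume z: "z \<in> sphere 0 1"
  have 1: "sgrad (ev (Gm (coord v) f)) z = sgrad (\<lambda>z. v \<bullet> sgrad (ev f) z) z"
    by (rule sgrad_cong[OF _ z]) (rule Gm_coord_eq)
  have 2: "sgrad (ev (Gm f f)) z = sgrad (\<lambda>z. sgrad (ev f) z \<bullet> sgrad (ev f) z) z"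
    by (rule sgrad_cong[OF _ z]) (rule ev_Gm)
  show "ev (cst 2 * Gm f (Gm (coord v) f) - Gm (coord v) (Gm f f)) z = ev (- cst 2 * coord v * Gm f f) z"
    unfolding ev_ring[OF z] ev_cst[OF z] ev_coord[OF z] Gm_coord_eq[OF z]
    unfolding ev_Gm[OF z] 1 2 using hessian_coord(1)[OF smooth_ev z, of f v] by simp
qed

section \<open>Linearity, integration by parts and positivity of the integral\<close>

lemma SI_add: "SI (f + g) = SI f + SI g"
proof -
  have "SI (f + g) = sint (\<lambda>z. ev f z + ev g z)"
    unfolding SI_def by (rule sint_cong) (simp add: ev_ring)
  also have "\<dots> = SI f + SI g"
    unfolding SI_def sint_eq_lborel[OF smooth_ev] sint_eq_lborel[OF smooth_sphere_add[OF smooth_ev smooth_ev]]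
    using integrable_hext[OF smooth_ev[of f]] integrable_hext[OF smooth_ev[of g]]
    by (simp add: hext_def distrib_left)
  finally show ?thesis .
qed

lemma SI_cst_mult: "SI (cst c * f) = c * SI f"
proof -
  have "SI (cst c * f) = sint (\<lambda>z. c * ev f z)"
    unfolding SI_def by (rule sint_cong) (simp add: ev_ring ev_cst)
  also have "\<dots> = c * SI f"
    unfolding SI_def sint_eq_lborel[OF smooth_ev] sint_eq_lborel[OF smooth_sphere_mult[OF smooth_sphere_const smooth_ev]]
    by (simp add: hext_def mult.left_commute)
  finally show ?thesis .
qed

lemma SI_linear:
  fixes f g :: "'a::euclidean_space sfun"
  shows "SI (- f) = - SI f" "SI (f - g) = SI f - SI g" "SI (0 :: 'a sfun) = 0"
proof -
  show 1: "SI (- f) = - SI f" for f :: "'a sfun"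
    unfolding uminus_eq_cst[of f] SI_cst_mult by simp
  show "SI (f - g) = SI f - SI g" for f g :: "'a sfun"
    unfolding diff_conv_add_uminus SI_add 1 ..
  show "SI (0 :: 'a sfun) = 0"
    using SI_cst_mult[of 0 "0 :: 'a sfun"] by simp
qed

lemma SI_sum: "SI (\<Sum>i\<in>A. f i) = (\<Sum>i\<in>A. SI (f i))"
  by (induction A rule: infinite_finite_induct) (auto simp: SI_add SI_linear)

lemma SI_cst: "SI (cst c :: 'a::euclidean_space sfun) = c * omega TYPE('a)"
proof -
  have "SI (1::'a sfun) = omega TYPE('a)"
    unfolding SI_def omega_def by (rule sint_cong) (simp add: ev_ring)
  then show ?thesis using SI_cst_mult[of c "1::'a sfun"] by simp
qed

lemma SI_by_parts: "SI (a * Lp f + Gm a f) = 0"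
proof -
  have "SI (a * Lp f + Gm a f) = sint (\<lambda>z. sgrad (ev a) z \<bullet> sgrad (ev f) z + ev a z * slap (ev f) z)"
    unfolding SI_def by (rule sint_cong) (simp add: ev_ring ev_Lp ev_Gm)
  then show ?thesis using sint_divergence[OF smooth_ev smooth_ev] by simp
qed

lemma SI_mono:
  assumes "\<And>z. z \<in> sphere 0 1 \<Longrightarrow> ev f z \<le> ev g z"
  shows "SI f \<le> SI g"
proof -
  have "(\<integral>x. indicator (ball 0 1) x * hext (ev f) x \<partial>lborel) \<le> (\<integral>x. indicator (ball 0 1) x * hext (ev g) x \<partial>lborel)"
  proof (rule integral_mono_AE[OF integrable_hext[OF smooth_ev] integrable_hext[OF smooth_ev]])
    show "AE x in lborel. indicator (ball 0 1) x * hext (ev f) x \<le> indicator (ball 0 1) x * hext (ev g) x"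
      using AE_lborel_singleton[of 0]
      by eventually_elim (use assms[OF sgn_in_sphere] in \<open>auto simp: hext_def indicator_def\<close>)
  qed
  then show ?thesis unfolding SI_def sint_eq_lborel[OF smooth_ev] by (intro mult_left_mono) auto
qed

text \<open>A positive value at z would persist on an open piece of the cone over a neighbourhood of
  z, which has positive Lebesgue measure.\<close>

lemma SI_eq_0_imp:
  assumes I: "SI f \<le> 0" and nn: "\<And>z. z \<in> sphere 0 1 \<Longrightarrow> ev f z \<ge> 0" and z: "z \<in> sphere 0 1"
  shows "ev f z = 0"
proof (rule ccontr)
  assume "ev f z \<noteq> 0"
  then have p: "hext (ev f) z > 0" using nn[OF z] z by (simp add: hext_sphere order_less_le)
  define F where "F x = indicator (ball 0 1) x * hext (ev f) x" for x
  have Fi: "integrable lborel F" unfolding F_def by (rule integrable_hext[OF smooth_ev])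
  have Fnn: "AE x in lborel. 0 \<le> F x"
    using AE_lborel_singleton[of 0]
    by eventually_elim (use nn[OF sgn_in_sphere] in \<open>auto simp: F_def hext_def indicator_def\<close>)
  have "0 \<le> (\<integral>x. F x \<partial>lborel)" using Fnn by (rule integral_nonneg_AE)
  moreover have "real DIM('a) * (\<integral>x. F x \<partial>lborel) \<le> 0"
    using I unfolding SI_def sint_eq_lborel[OF smooth_ev] F_def .
  ultimately have "(\<integral>x. F x \<partial>lborel) = 0" by (simp add: mult_le_0_iff)
  then have AE0: "AE x in lborel. F x = 0"
    using integral_nonneg_eq_0_iff_AE[OF Fi Fnn] by simp
  define U where "U = {x \<in> - {0}. hext (ev f) x > 0} \<inter> ball 0 1"
  have "open U" unfolding U_def
  proof (rule open_Int)
    have "open (- {0} \<inter> hext (ev f) -` {0<..})"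
      by (rule continuous_open_preimage[OF smooth_on_continuous[OF smooth_sphereD[OF smooth_ev]] open_punct open_greaterThan])
    moreover have "- {0} \<inter> hext (ev f) -` {0<..} = {x \<in> - {0}. hext (ev f) x > 0}" by auto
    ultimately show "open {x \<in> - {0}. hext (ev f) x > 0}" by simp
  qed simp
  \<comment> \<open>The point z lies on the boundary of the ball; homogeneity allows moving halfway
    towards the origin.\<close>
  moreover have "(1/2) *\<^sub>R z \<in> U" using p z hext_scale[of "1/2" "ev f" z] by (auto simp: U_def)
  moreover have "U \<in> null_sets lborel"
  proof -
    have "AE x in lborel. x \<notin> U" using AE0 by eventually_elim (auto simp: F_def U_def)
    then show ?thesis using \<open>open U\<close> by (subst AE_iff_null_sets) auto
  qed
  ultimately show False
    using negligible_iff_null_sets[of U] open_not_negligible[of U] null_sets_completionI by blast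
qed

section \<open>Conformal covariance of the energy\<close>

text \<open>The energy after integration by parts; only first derivatives and one Laplacian remain.\<close>

definition EE :: "'a::euclidean_space sfun \<Rightarrow> real" where
  "EE f = (let n = real DIM('a) - 1; m = (n - 4) / 4; g = Gm f f in
     SI (cst (- (1/2 + m)) * (g * g) - cst m * (g * (f * Lp f)) + cst ((n - 1) * m\<^sup>2) * (f * f * g)
       + cst (n * (n - 1) / 8 * m ^ 3) * (f * f * (f * f))))"

lemma sgrad_toS:
  assumes "smooth_sphere u" "z \<in> sphere 0 1"
  shows "sgrad (ev (toS u)) z = sgrad u z"
  using ev_toS[OF assms(1)] assms(2) by (rule sgrad_cong)

lemma slap_toS:
  assumes "smooth_sphere u" "z \<in> sphere 0 1"
  shows "slap (ev (toS u)) z = slap u z"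
  using ev_toS[OF assms(1)] assms(2) by (rule slap_cong)

lemma sdiv_scaled_sgrad_ev:
  assumes a: "\<And>z. z \<in> sphere 0 1 \<Longrightarrow> a z = ev A z" and u: "smooth_sphere u" and z: "z \<in> sphere 0 1"
  shows "sdiv (\<lambda>x. a x *\<^sub>R sgrad u x) z = ev (A * Lp (toS u) + Gm A (toS u)) z"
proof -
  have "sdiv (\<lambda>x. a x *\<^sub>R sgrad u x) z = sdiv (\<lambda>x. ev A x *\<^sub>R sgrad u x) z"
    by (rule sdiv_cong[OF _ z]) (simp only: a)
  also have "\<dots> = sgrad (ev A) z \<bullet> sgrad u z + ev A z * lapl (hext u) z"
    by (rule sdiv_scaled_sgrad[OF smooth_ev u z])
  finally show ?thesis
    by (simp only: ev_ring[OF z] ev_Lp[OF z] ev_Gm[OF z] slap_toS[OF u z] sgrad_toS[OF u z] slap_eq_lapl[OF u z] add.commute)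
qed

lemma Lsig2_toS:
  fixes u :: "'a::euclidean_space \<Rightarrow> real"
  assumes u: "smooth_sphere u" and z: "z \<in> sphere 0 1"
  defines "n \<equiv> real DIM('a) - 1" and "f \<equiv> toS u"
  shows "Lsig2 u z = 1/2 * ev (Gm f f * Lp f + Gm (Gm f f) f) z
     - (n-4)/16 * (ev f z * ev (Lp (Gm f f)) z - ev (Lp (f * f) * Lp f + Gm (Lp (f * f)) f) z)
     - (n-1)/4 * ((n-4)/4)^2 * ev f z * ev (Lp (f * f)) z
     + n*(n-1)/8 * ((n-4)/4)^3 * (ev f z)^3"
proof -
  have g2: "(norm (sgrad u x))\<^sup>2 = ev (Gm f f) x" if "x \<in> sphere 0 1" for x
    unfolding ev_Gm[OF that] f_def sgrad_toS[OF u that] by (simp add: dot_square_norm)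
  have lu2: "slap (\<lambda>x. (u x)\<^sup>2) x = ev (Lp (f * f)) x" if "x \<in> sphere 0 1" for x
  proof -
    have "slap (\<lambda>x. (u x)\<^sup>2) x = slap (ev (f * f)) x"
      by (rule slap_cong[OF _ that]) (simp only: ev_ring f_def ev_toS[OF u] power2_eq_square)
    then show ?thesis by (simp only: ev_Lp[OF that])
  qed
  have sg: "slap (\<lambda>x. (norm (sgrad u x))\<^sup>2) z = ev (Lp (Gm f f)) z"
    unfolding ev_Lp[OF z] by (rule slap_cong[OF g2 z])
  have uz: "u z = ev f z" by (simp only: f_def ev_toS[OF u z])
  have s1: "sdiv (\<lambda>x. (norm (sgrad u x))\<^sup>2 *\<^sub>R sgrad u x) z = ev (Gm f f * Lp f + Gm (Gm f f) f) z"
    unfolding f_def by (rule sdiv_scaled_sgrad_ev[OF _ u z]) (simp only: g2 f_def)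
  have s2: "sdiv (\<lambda>x. slap (\<lambda>x. (u x)\<^sup>2) x *\<^sub>R sgrad u x) z = ev (Lp (f * f) * Lp f + Gm (Lp (f * f)) f) z"
    unfolding f_def by (rule sdiv_scaled_sgrad_ev[OF _ u z]) (simp only: lu2 f_def)
  show ?thesis
    unfolding Lsig2_def Let_def dimn_def n_def[symmetric] sg lu2[OF z] uz s1 s2 ..
qed

text \<open>The two integrands differ by divergences: one moves the derivative off |grad f|^2,
  Green's identity exchanges the Laplacian between f^2 and |grad f|^2, and two more treat the terms
  with the Laplacian of f^2.\<close>

lemma Esig2_eq_EE:
  fixes u :: "'a::euclidean_space \<Rightarrow> real"
  assumes u: "smooth_sphere u"
  shows "Esig2 u = EE (toS u)"
proof -
  define n m where "n = real DIM('a) - 1" and "m = (n - 4) / 4"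
  define f where "f = toS u"
  define g where "g = Gm f f"
  define l where "l = Lp (f * f)"
  define A where "A = cst (1/2) * (f * (g * Lp f + Gm g f)) - cst (m/4) * (f * (f * Lp g - (l * Lp f + Gm l f)))
     - cst ((n-1)/4 * m^2) * (f * f * l) + cst (n*(n-1)/8 * m^3) * (f * f * (f * f))"
  have "Esig2 u = SI A"
    unfolding Esig2_def SI_def
  proof (rule sint_cong)
    fix z :: 'a assume z: "z \<in> sphere 0 1"
    have uz: "u z = ev f z" by (simp only: f_def ev_toS[OF u z])
    show "u z * Lsig2 u z = ev A z"
      unfolding Lsig2_toS[OF u z] uz f_def[symmetric] A_def g_def l_def n_def[symmetric] ev_ring[OF z] ev_cst[OF z]
      by (simp add: m_def n_def algebra_simps power2_eq_square power3_eq_cube)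
  qed
  also have "\<dots> = SI (cst (- (1/2 + m)) * (g * g) - cst m * (g * (f * Lp f)) + cst ((n - 1) * m\<^sup>2) * (f * f * g)
       + cst (n * (n - 1) / 8 * m ^ 3) * (f * f * (f * f)))" (is "_ = SI ?B")
  proof -
    \<comment> \<open>\<open>D a h\<close> is the divergence of a grad h, which integrates to zero
      by \<open>SI_by_parts\<close>.\<close>
    define D where "D a h = a * Lp h + Gm a h" for a h :: "'a sfun"
    have "A - ?B = cst (1/2) * D (f * g) f - cst (m/4) * (D (f * f) g - D g (f * f) - D (f * l) f)
        - cst ((n-1)/4 * m^2) * D (f * f) (f * f)"
      unfolding A_def D_def l_def Lp_rules Gm_left Gm_right Gm_commute[of f g] g_def[symmetric]
      by (rule sfun_eqI, simp only: ev_ring ev_cst, simp add: field_simps power2_eq_square power3_eq_cube)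
    then have "SI A - SI ?B = SI (cst (1/2) * D (f * g) f - cst (m/4) * (D (f * f) g - D g (f * f) - D (f * l) f)
        - cst ((n-1)/4 * m^2) * D (f * f) (f * f))" by (simp only: SI_linear(2)[symmetric])
    also have "\<dots> = 0" unfolding SI_linear SI_cst_mult unfolding D_def SI_by_parts by simp
    finally show ?thesis by simp
  qed
  finally show ?thesis by (simp add: EE_def Let_def f_def g_def n_def m_def)
qed

text \<open>Up to a positive factor, \<^term>\<open>Rf m f\<close> is the scalar curvature of f^(2/m) g0, where m = (n-4)/4.\<close>

definition Rf :: "real \<Rightarrow> 'a::euclidean_space sfun \<Rightarrow> 'a sfun" where
  "Rf m f = cst (4 * m + 4) * f * f - cst (2 / m) * (f * Lp f + cst ((m + 1) / m) * Gm f f)"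

text \<open>The metric Om^(-2) g0 is again round; \<tau> = ln Om and j = Om^(-2).\<close>

locale conformal_factor =
  fixes \<xi> :: "'a::euclidean_space" and m :: real
  assumes \<xi>: "norm \<xi> < 1" and DIM_m: "real DIM('a) = 4 * m + 5"
begin

definition s :: real where "s = sqrt (1 - (norm \<xi>)\<^sup>2)"
definition Om :: "'a sfun" where "Om = cst (1 / s) * (1 + coord \<xi>)"
definition \<tau> :: "'a sfun" where "\<tau> = sln Om"
definition J :: "'a sfun" where "J = sexp (- \<tau>)"

lemma s_pos: "s > 0"
  using \<xi> by (simp add: s_def abs_square_less_1)

lemma s_square: "s\<^sup>2 = 1 - \<xi> \<bullet> \<xi>"
  using \<xi> by (simp add: s_def abs_square_less_1 less_imp_le dot_square_norm)

lemma ev_Om: "z \<in> sphere 0 1 \<Longrightarrow> ev Om z = (1 + z \<bullet> \<xi>) / s"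
  by (simp add: Om_def ev_ring ev_cst ev_coord)

lemma ev_Om_pos: "z \<in> sphere 0 1 \<Longrightarrow> ev Om z > 0"
proof -
  assume z: "z \<in> sphere 0 1"
  have "\<bar>z \<bullet> \<xi>\<bar> \<le> norm z * norm \<xi>" by (rule Cauchy_Schwarz_ineq2)
  then show ?thesis using z \<xi> s_pos by (simp add: ev_Om)
qed

lemma sexp_\<tau>: "sexp \<tau> = Om"
  unfolding \<tau>_def by (rule sexp_sln) (simp add: pos_on_def ev_Om_pos)

lemma Om_J: "Om * J = 1"
  unfolding sexp_\<tau>[symmetric] J_def sexp_add[symmetric] by (simp add: sexp_0)

lemma ev_J: "z \<in> sphere 0 1 \<Longrightarrow> ev J z = 1 / ev Om z"
  using arg_cong[OF Om_J, of "\<lambda>f. ev f z"] ev_Om_pos[of z] by (simp add: ev_ring field_simps)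

lemma coord_\<xi>: "coord \<xi> = cst s * Om - 1"
  by (rule sfun_eqI) (use s_pos in \<open>simp add: ev_ring ev_cst ev_coord ev_Om\<close>)

lemma Gm_\<xi>: "Gm (coord \<xi>) f = cst s * Om * Gm \<tau> f"
  unfolding coord_\<xi> sexp_\<tau>[symmetric] Gm_minus Gm_left by simp

lemma Gm_J: "Gm J f = - J * Gm \<tau> f"
  unfolding J_def Gm_left Gm_minus by simp

text \<open>The scalar in Hess \<tau> = k g0 - d\<tau> d\<tau>. It comes from the Hessian of the
  linear function s exp \<tau> - 1, which is minus that function times g0.\<close>

definition k :: "'a sfun" where "k = cst (1 / s) * J - 1"

lemma ev_k: "z \<in> sphere 0 1 \<Longrightarrow> ev k z = 1 / (s * ev Om z) - 1"
  by (simp add: k_def ev_ring ev_cst ev_J)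

lemma Gm_k: "Gm k f = - (k + 1) * Gm \<tau> f"
  unfolding k_def Gm_left Gm_minus Gm_J by (simp add: algebra_simps)

text \<open>Together with the Hessian of \<tau> this says that Om^(-2) g0 has curvature one: its
  Schouten tensor (1/2 + k - |d\<tau>|^2 / 2) g0 equals half of J^2 g0. The source is the squared
  gradient of a linear function and s^2 = 1 - |\<xi>|^2.\<close>

lemma Gm_\<tau>_\<tau>: "Gm \<tau> \<tau> = cst 2 * k + 1 - J * J"
proof (rule sfun_eqI)
  fix z :: 'a assume z: "z \<in> sphere 0 1"
  define w q where "w = ev Om z" and "q = ev (Gm \<tau> \<tau>) z"
  have w: "w > 0" using ev_Om_pos[OF z] by (simp add: w_def)
  have "Gm (coord \<xi>) (coord \<xi>) = cst s * Om * (cst s * Om * Gm \<tau> \<tau>)"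
    unfolding Gm_\<xi> Gm_commute[of \<tau> "coord \<xi>"] ..
  then have "cst s * Om * (cst s * Om * Gm \<tau> \<tau>) = cst (\<xi> \<bullet> \<xi>) - (cst s * Om - 1) * (cst s * Om - 1)"
    by (simp only: Gm_coord_coord coord_\<xi>[symmetric])
  from arg_cong[OF this, of "\<lambda>f. ev f z"]
  have "s * w * (s * w * q) = (1 - s\<^sup>2) - (s * w - 1) * (s * w - 1)"
    by (simp only: ev_ring[OF z] ev_cst[OF z] w_def q_def s_square)
  then have "q = ((1 - s\<^sup>2) - (s * w - 1) * (s * w - 1)) / (s * w * (s * w))"
    using w s_pos by (simp add: eq_divide_eq mult_ac)
  also have "\<dots> = 2 * (1 / (s * w) - 1) + 1 - 1 / w * (1 / w)"
    using w s_pos by (simp add: divide_simps) (simp add: algebra_simps power2_eq_square)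
  finally have "q = 2 * (1 / (s * w) - 1) + 1 - 1 / w * (1 / w)" .
  then show "ev (Gm \<tau> \<tau>) z = ev (cst 2 * k + 1 - J * J) z"
    by (simp only: ev_ring[OF z] ev_cst[OF z] ev_k[OF z] ev_J[OF z] w_def q_def)
qed

lemma Lp_\<tau>: "Lp \<tau> = cst (real DIM('a) - 1) * k - Gm \<tau> \<tau>"
proof (rule sfun_eqI)
  fix z :: 'a assume z: "z \<in> sphere 0 1"
  define w l q where "w = ev Om z" and "l = ev (Lp \<tau>) z" and "q = ev (Gm \<tau> \<tau>) z"
  have w: "w > 0" using ev_Om_pos[OF z] by (simp add: w_def)
  have "Lp (coord \<xi>) = cst s * (Om * (Lp \<tau> + Gm \<tau> \<tau>))"
    unfolding coord_\<xi> Lp_minus Lp_rules Gm_left sexp_\<tau>[symmetric] by simp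
  then have "cst s * (Om * (Lp \<tau> + Gm \<tau> \<tau>)) = - cst (real DIM('a) - 1) * (cst s * Om - 1)"
    by (simp only: Lp_coord coord_\<xi>[symmetric])
  from arg_cong[OF this, of "\<lambda>f. ev f z"]
  have "s * (w * (l + q)) = - (real DIM('a) - 1) * (s * w - 1)"
    by (simp only: ev_ring[OF z] ev_cst[OF z] w_def l_def q_def)
  then have "l = (real DIM('a) - 1) * (1 / (s * w) - 1) - q"
    using w s_pos by (simp add: field_simps)
  then show "ev (Lp \<tau>) z = ev (cst (real DIM('a) - 1) * k - Gm \<tau> \<tau>) z"
    by (simp only: ev_ring[OF z] ev_cst[OF z] ev_k[OF z] w_def l_def q_def)
qed

lemma Lp_\<tau>_m: "Lp \<tau> = cst (4 * m + 4) * k - Gm \<tau> \<tau>"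
proof -
  have "real DIM('a) - 1 = 4 * m + 4" using DIM_m by simp
  then show ?thesis using Lp_\<tau> by (simp only:)
qed

text \<open>The left side is Hess \<tau> (grad w, grad w) + Hess w (grad \<tau>, grad w). The second
  summand is half of \<open>Gm \<tau> (Gm w w)\<close>; the first is given by Hess \<tau> = k g0 -
  d\<tau> d\<tau>.\<close>

lemma hessian_\<tau>:
  "Gm (Gm \<tau> w) w = cst (1/2) * Gm \<tau> (Gm w w) + k * Gm w w - Gm \<tau> w * Gm \<tau> w"
proof (rule sfun_eqI)
  fix z :: 'a assume z: "z \<in> sphere 0 1"
  define W b h t g where "W = ev Om z" and "b = ev (Gm \<tau> w) z" and "h = ev (Gm \<tau> (Gm w w)) z"
    and "t = ev (Gm (Gm \<tau> w) w) z" and "g = ev (Gm w w) z"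
  have W: "W > 0" using ev_Om_pos[OF z] by (simp add: W_def)
  have GO: "Gm w Om = Om * Gm \<tau> w"
    unfolding sexp_\<tau>[symmetric] Gm_right Gm_commute[of w \<tau>] ..
  have "Gm w (Gm (coord \<xi>) w) = cst s * (Om * Gm (Gm \<tau> w) w + Om * Gm \<tau> w * Gm \<tau> w)"
    unfolding Gm_\<xi> Gm_right GO Gm_commute[of w "Gm \<tau> w"] by (simp add: algebra_simps)
  note A = this
  have "cst 2 * (cst s * (Om * Gm (Gm \<tau> w) w + Om * Gm \<tau> w * Gm \<tau> w)) - cst s * Om * Gm \<tau> (Gm w w)
      = - cst 2 * (cst s * Om - 1) * Gm w w"
    unfolding Gm_\<xi>[symmetric] coord_\<xi>[symmetric] A[symmetric] by (rule Gm_coord_hessian)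
  from arg_cong[OF this, of "\<lambda>f. ev f z"]
  have "2 * (s * (W * t + W * b * b)) - s * W * h = - 2 * (s * W - 1) * g"
    by (simp only: ev_ring[OF z] ev_cst[OF z] W_def b_def h_def t_def g_def)
  then have "t = (1/2) * h + (1 / (s * W) - 1) * g - b * b"
    using W s_pos by (simp add: field_simps)
  then show "ev (Gm (Gm \<tau> w) w) z = ev (cst (1/2) * Gm \<tau> (Gm w w) + k * Gm w w - Gm \<tau> w * Gm \<tau> w) z"
    by (simp only: ev_ring[OF z] ev_cst[OF z] ev_k[OF z] W_def b_def h_def t_def g_def)
qed

text \<open>The conformal weight Om^(-m): for u = P w the metrics u^(2/m) g0 and w^(2/m) Om^(-2) g0
  coincide. The volume density of Om^(-2) g0 is \<open>P4 * (j * j)\<close>.\<close>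

definition P :: "'a sfun" where "P = sexp (cst (- m) * \<tau>)"
definition j :: "'a sfun" where "j = J * J"
definition P4 :: "'a sfun" where "P4 = P * P * (P * P)"

lemma Gm_P: "Gm P f = - cst m * P * Gm \<tau> f" "Gm f P = - cst m * P * Gm \<tau> f"
proof -
  show "Gm P f = - cst m * P * Gm \<tau> f"
    unfolding P_def Gm_left by (simp add: cst_hom)
  then show "Gm f P = - cst m * P * Gm \<tau> f"
    by (simp only: Gm_commute[of f P])
qed

lemma Lp_P: "Lp P = P * (cst (m * m) * Gm \<tau> \<tau> - cst m * Lp \<tau>)"
  unfolding P_def Lp_rules Gm_left Gm_right by (simp add: cst_hom algebra_simps)

lemma Gm_P4: "Gm P4 f = - cst (4 * m) * P4 * Gm \<tau> f"
proof (rule sfun_eqI)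
  fix z :: 'a assume z: "z \<in> sphere 0 1"
  show "ev (Gm P4 f) z = ev (- cst (4 * m) * P4 * Gm \<tau> f) z"
    unfolding P4_def Gm_left Gm_P ev_ring[OF z] ev_cst[OF z] by (simp add: algebra_simps)
qed

lemma Gm_j: "Gm j f = - cst 2 * j * Gm \<tau> f"
proof (rule sfun_eqI)
  fix z :: 'a assume z: "z \<in> sphere 0 1"
  show "ev (Gm j f) z = ev (- cst 2 * j * Gm \<tau> f) z"
    unfolding j_def Gm_left Gm_J ev_ring[OF z] ev_cst[OF z] by (simp add: algebra_simps)
qed

text \<open>\<^term>\<open>Aop w\<close> is the Laplacian of the round metric \<open>Om\<^sup>-\<^sup>2 g\<^sub>0\<close> divided by \<open>Om\<^sup>2\<close>.\<close>

definition Aop :: "'a sfun \<Rightarrow> 'a sfun" where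
  "Aop w = Lp w - cst (4 * m + 2) * Gm \<tau> w"

text \<open>The energy \<open>EE\<close> of w with respect to Om^(-2) g0, written in terms of g0.
  The density P4 j^2 loses one factor j for each squared gradient and each Laplacian, since both
  scale by Om^2.\<close>

definition E' :: "'a sfun \<Rightarrow> real" where
  "E' w = SI (P4 * (cst (- (1/2 + m)) * (Gm w w * Gm w w) - cst m * (Gm w w * (w * Aop w))
     + cst ((4 * m + 3) * m\<^sup>2) * (w * w * Gm w w * j) + cst ((4 * m + 4) * (4 * m + 3) / 8 * m ^ 3) * (w * w * (w * w) * (j * j))))"

text \<open>Both integrands differ by the divergence of P4 V with
  V = 2 m^2 w^2 b W - m^2 w^2 G T - m^3 w^3 q W - (m^3/4) w^4 (q + (n-1)(1+j)) T, where W and T are the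
  gradients of w and \<tau>.\<close>

lemma EE_covariant: "EE (P * w) = E' w"
proof -
  define D where "D a h = a * Lp h + Gm a h" for a h :: "'a sfun"
  define G b q where "G = Gm w w" and "b = Gm \<tau> w" and "q = Gm \<tau> \<tau>"
  define f where "f = P * w"
  define X where "X = cst (- (1/2 + m)) * (Gm f f * Gm f f) - cst m * (Gm f f * (f * Lp f)) + cst ((4 * m + 3) * m\<^sup>2) * (f * f * Gm f f)
       + cst ((4 * m + 4) * (4 * m + 3) / 8 * m ^ 3) * (f * f * (f * f))"
  define Y where "Y = P4 * (cst (- (1/2 + m)) * (G * G) - cst m * (G * (w * Aop w))
     + cst ((4 * m + 3) * m\<^sup>2) * (w * w * G * j) + cst ((4 * m + 4) * (4 * m + 3) / 8 * m ^ 3) * (w * w * (w * w) * (j * j)))"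
  have jq: "j = cst 2 * k + 1 - q" using Gm_\<tau>_\<tau> by (simp add: q_def j_def algebra_simps)
  have Lt: "Lp \<tau> = cst (4 * m + 4) * k - q" unfolding q_def by (rule Lp_\<tau>_m)
  have c1: "Gm w \<tau> = b" by (simp add: b_def Gm_commute)
  \<comment> \<open>Differentiating q = 2k + 1 - j closes the system: derivatives of q, k and j are
    all multiples of derivatives of \<tau>.\<close>
  have Gq: "Gm q f' = cst 2 * (k - q) * Gm \<tau> f'" for f'
  proof (rule sfun_eqI)
    fix z :: 'a assume z: "z \<in> sphere 0 1"
    have "Gm q f' = cst 2 * (- (k + 1) * Gm \<tau> f') + cst 2 * j * Gm \<tau> f'"
      unfolding q_def Gm_\<tau>_\<tau> j_def[symmetric] Gm_left Gm_minus Gm_k Gm_j by simp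
    from this[unfolded jq] show "ev (Gm q f') z = ev (cst 2 * (k - q) * Gm \<tau> f') z"
      by (simp only: ev_ring[OF z] ev_cst[OF z]) (simp add: algebra_simps)
  qed
  have Hb: "Gm b w = cst (1/2) * Gm \<tau> G + k * G - b * b"
    unfolding b_def G_def by (rule hessian_\<tau>)
  have "X - Y = cst (2 * m^2) * D (P4 * (w * w * b)) w - cst (m^2) * D (P4 * (w * w * G)) \<tau>
      - cst (m^3) * D (P4 * (w * w * w * q)) w - cst (m^3/4) * D (P4 * (w * w * w * w * (q + cst (4 * m + 3) * (1 + j)))) \<tau>"
    unfolding X_def Y_def D_def f_def Aop_def
    unfolding Lp_rules Gm_left Gm_right Gm_minus Gm_P Lp_P Gm_P4 Gm_j Gq Gm_commute[of G \<tau>] c1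
      G_def[symmetric] b_def[symmetric] q_def[symmetric] Hb Lt
    \<comment> \<open>Roundness of the new metric enters here, through j = 2k + 1 - q; what is left
      is a polynomial identity between values at a point.\<close>
    unfolding jq P4_def
    by (rule sfun_eqI, simp only: ev_ring ev_cst, simp add: field_simps power2_eq_square power3_eq_cube)
  then have "SI X - SI Y = SI (cst (2 * m^2) * D (P4 * (w * w * b)) w - cst (m^2) * D (P4 * (w * w * G)) \<tau>
     - cst (m^3) * D (P4 * (w * w * w * q)) w - cst (m^3/4) * D (P4 * (w * w * w * w * (q + cst (4 * m + 3) * (1 + j)))) \<tau>)"
    by (simp only: SI_linear(2)[symmetric])
  also have "\<dots> = 0" unfolding SI_linear SI_cst_mult unfolding D_def SI_by_parts by simp
  finally have "SI X = SI Y" by simp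
  moreover have "real DIM('a) - 1 - 1 = 4 * m + 3" "real DIM('a) - 1 = 4 * m + 4" "(4 * m + 4 - 4) / 4 = m"
    by (simp_all add: DIM_m)
  ultimately show ?thesis
    unfolding EE_def E'_def Let_def f_def[symmetric] G_def[symmetric]
    by (simp only: X_def Y_def)
qed

text \<open>The bracket is j times the expression \<open>Rf m w\<close> formed in the metric Om^(-2)
  g0. In contrast to the energy, the relation is pointwise and involves no divergence.\<close>

lemma Rf_covariant:
  assumes "m \<noteq> 0"
  shows "Rf m (P * w) = P * P * (cst (4 * m + 4) * j * w * w - cst (2 / m) * (w * Aop w + cst ((m + 1) / m) * Gm w w))"
proof (rule sfun_eqI)
  fix z :: 'a assume z: "z \<in> sphere 0 1"
  define q where "q = Gm \<tau> \<tau>"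
  have jq: "j = cst 2 * k + 1 - q" using Gm_\<tau>_\<tau> by (simp add: q_def j_def algebra_simps)
  have Lt: "Lp \<tau> = cst (4 * m + 4) * k - q" unfolding q_def by (rule Lp_\<tau>_m)
  have c1: "Gm w \<tau> = Gm \<tau> w" by (simp add: Gm_commute)
  show "ev (Rf m (P * w)) z = ev (P * P * (cst (4 * m + 4) * j * w * w - cst (2 / m) * (w * Aop w + cst ((m + 1) / m) * Gm w w))) z"
    unfolding Rf_def Aop_def
    unfolding Lp_rules Gm_left Gm_right Gm_P Lp_P c1 q_def[symmetric] Lt
    unfolding jq ev_ring[OF z] ev_cst[OF z]
    using assms by (simp add: field_simps)
qed

section \<open>The second variation in the directions of the conformal coordinates\<close>

text \<open>\<^term>\<open>y\<close> lists the coordinate functions of the round metric Om^(-2) g0, that is, the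
  components of a Moebius transformation of the sphere.\<close>

definition \<gamma> :: real where "\<gamma> = 1 / (1 + s)"
definition y :: "'a \<Rightarrow> 'a sfun" where
  "y b = J * (coord b + cst (\<gamma> * (\<xi> \<bullet> b)) * (1 + Om))"

lemma \<gamma>: "\<gamma> * (1 + s) = 1"
  using s_pos by (simp add: \<gamma>_def)

text \<open>The origin of \<gamma>: since |\<xi>|^2 = (1 - s)(1 + s), the choice 1 / (1 + s) gives
  \<gamma> |\<xi>|^2 = 1 - s, which makes z + \<gamma> (1 + Om) \<xi> a vector of length Om.\<close>

lemma \<gamma>_square: "\<gamma> * \<gamma> * (\<xi> \<bullet> \<xi>) = \<gamma> * (1 - s)"
proof -
  have "\<gamma> * \<gamma> * (\<xi> \<bullet> \<xi>) = \<gamma> * (1 - s) * (\<gamma> * (1 + s))"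
  proof -
    have "\<xi> \<bullet> \<xi> = (1 - s) * (1 + s)" using s_square by (simp add: algebra_simps power2_eq_square)
    then show ?thesis by (simp only: mult_ac)
  qed
  then show ?thesis by (simp add: \<gamma>)
qed

lemma sum_y_y: "(\<Sum>b\<in>Basis. y b * y b) = 1"
proof (rule sfun_eqI)
  fix z :: 'a assume z: "z \<in> sphere 0 1"
  define W where "W = ev Om z"
  have W: "W > 0" using ev_Om_pos[OF z] by (simp add: W_def)
  have zx: "z \<bullet> \<xi> = s * W - 1" using z s_pos by (simp add: W_def ev_Om)
  \<comment> \<open>The components of v divided by Om are the values of \<open>y\<close>, so the
    claim is that v has length Om.\<close>
  define v where "v = z + (\<gamma> * (1 + W)) *\<^sub>R \<xi>"
  have "ev (y b * y b) z = (v \<bullet> b) * (v \<bullet> b) / W\<^sup>2" for b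
    unfolding y_def v_def ev_ring[OF z] ev_coord[OF z] ev_cst[OF z] ev_J[OF z] W_def[symmetric]
    using W by (simp add: inner_add_left field_simps power2_eq_square)
  then have "ev (\<Sum>b\<in>Basis. y b * y b) z = (v \<bullet> v) / W\<^sup>2"
    unfolding ev_sum[OF z] euclidean_inner[of v v] by (simp add: sum_divide_distrib)
  also have "v \<bullet> v = 1 + 2 * \<gamma> * (1 + W) * (s * W - 1) + (\<gamma> * \<gamma> * (\<xi> \<bullet> \<xi>)) * (1 + W)\<^sup>2"
    using z by (simp add: v_def inner_add_left inner_add_right zx inner_commute[of \<xi> z] dot_square_norm[of z]
        power2_eq_square algebra_simps)
  also have "\<dots> = 1 + (1 + W) * (\<gamma> * (1 + s)) * (W - 1)"
    unfolding \<gamma>_square by (simp add: algebra_simps power2_eq_square)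
  also have "\<dots> = W\<^sup>2" unfolding \<gamma> by (simp add: algebra_simps power2_eq_square)
  finally show "ev (\<Sum>b\<in>Basis. y b * y b) z = ev 1 z" using W by (simp add: ev_ring[OF z])
qed

text \<open>This is the sum of dy dy = Om^(-2) g0, evaluated on the gradient of w: the map with
  components \<open>y\<close> pulls the round metric back to the new one.\<close>

lemma sum_Gm_y_square: "(\<Sum>b\<in>Basis. Gm (y b) w * Gm (y b) w) = j * Gm w w"
proof (rule sfun_eqI)
  fix z :: 'a assume z: "z \<in> sphere 0 1"
  define W t F where "W = ev Om z" and "t = ev (Gm \<tau> w) z" and "F = sgrad (ev w) z"
  have W: "W > 0" using ev_Om_pos[OF z] by (simp add: W_def)
  have zx: "z \<bullet> \<xi> = s * W - 1" using z s_pos by (simp add: W_def ev_Om)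
  have zF: "z \<bullet> F = 0" unfolding F_def by (rule sgrad_tangent[OF smooth_ev z])
  have xF: "\<xi> \<bullet> F = s * W * t"
    using arg_cong[OF Gm_\<xi>, of "\<lambda>f. ev f z" w]
    by (simp only: Gm_coord_eq[OF z] ev_ring[OF z] ev_cst[OF z] F_def W_def t_def)
  \<comment> \<open>The components of v divided by Om are the values of \<open>Gm (y b) w\<close>; v
    has the length of F because \<gamma> (1 + s) = 1.\<close>
  define v where "v = F - t *\<^sub>R (z + \<gamma> *\<^sub>R \<xi>)"
  have "Gm (y b) w = J * (Gm (coord b) w - Gm \<tau> w * (coord b + cst (\<gamma> * (\<xi> \<bullet> b))))" for b
    unfolding y_def sexp_\<tau>[symmetric] Gm_left Gm_J Gm_minus by (simp add: algebra_simps)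
  then have "ev (Gm (y b) w * Gm (y b) w) z = (v \<bullet> b) * (v \<bullet> b) / W\<^sup>2" for b
    using W
    by (simp add: v_def ev_ring[OF z] ev_coord[OF z] ev_cst[OF z] ev_J[OF z] W_def[symmetric] Gm_coord_eq[OF z]
        F_def[symmetric] t_def[symmetric] inner_diff_left inner_add_left inner_commute[of b F] power2_eq_square
        times_divide_times_eq)
  then have "ev (\<Sum>b\<in>Basis. Gm (y b) w * Gm (y b) w) z = (v \<bullet> v) / W\<^sup>2"
    unfolding ev_sum[OF z] euclidean_inner[of v v] by (simp add: sum_divide_distrib)
  also have "v \<bullet> v = F \<bullet> F - 2 * t * \<gamma> * (s * W * t)
      + t * t * (1 + 2 * \<gamma> * (s * W - 1) + \<gamma> * \<gamma> * (\<xi> \<bullet> \<xi>))"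
    using z by (simp add: v_def inner_add_left inner_add_right inner_diff_left inner_diff_right
        zx zF xF inner_commute[of \<xi> z] inner_commute[of F z] inner_commute[of F \<xi>] dot_square_norm[of z] algebra_simps)
  also have "\<dots> = F \<bullet> F + t * t * (1 - \<gamma> * (1 + s))"
    unfolding \<gamma>_square by (simp add: algebra_simps)
  also have "\<dots> = F \<bullet> F" by (simp add: \<gamma>)
  finally show "ev (\<Sum>b\<in>Basis. Gm (y b) w * Gm (y b) w) z = ev (j * Gm w w) z"
    by (simp add: j_def ev_ring[OF z] ev_J[OF z] ev_Gm[OF z] F_def[symmetric] W_def[symmetric] power2_eq_square)
qed

text \<open>The \<open>y\<close> are coordinates of a round sphere, hence eigenfunctions of its
  Laplacian with eigenvalue -n, where n = 4m + 4. The factor j appears because \<open>Aop\<close> is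
  that Laplacian divided by Om^2.\<close>

lemma Aop_y: "Aop (y b) = - cst (4 * m + 4) * j * y b"
proof (rule sfun_eqI)
  fix z :: 'a assume z: "z \<in> sphere 0 1"
  define W t X e where "W = ev Om z" and "t = ev (Gm \<tau> (coord b)) z" and "X = z \<bullet> b" and "e = \<gamma> * (\<xi> \<bullet> b)"
  have W: "W > 0" using ev_Om_pos[OF z] by (simp add: W_def)
  note Lt = Lp_\<tau>_m
  have LJ: "Lp J = J * (Gm \<tau> \<tau> - Lp \<tau>)"
    unfolding J_def Lp_rules Lp_minus Gm_minus by simp
  have Lx: "Lp (coord b) = - cst (4 * m + 4) * coord b"
  proof -
    have "real DIM('a) - 1 = 4 * m + 4" using DIM_m by simp
    then show ?thesis by (simp only: Lp_coord)
  qed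
  have tx: "s * W * t = \<xi> \<bullet> b - (s * W - 1) * X"
    using arg_cong[OF Gm_\<xi>, of "\<lambda>f. ev f z" "coord b"] s_pos
    by (simp add: Gm_coord_coord ev_ring[OF z] ev_cst[OF z] ev_coord[OF z] W_def t_def X_def ev_Om[OF z])
  have xb: "\<xi> \<bullet> b = e * (1 + s)"
    using \<gamma> by (simp add: e_def mult.commute mult.left_commute)
  have te: "t = (e * (1 + s) - (s * W - 1) * X) / (s * W)"
    using tx W s_pos by (simp add: xb field_simps)
  show "ev (Aop (y b)) z = ev (- cst (4 * m + 4) * j * y b) z"
    unfolding Aop_def y_def e_def[symmetric] sexp_\<tau>[symmetric]
    unfolding Lp_rules Lp_minus Gm_left Gm_right Gm_minus Gm_commute[of \<tau> J] Gm_J LJ Lx Lt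
    unfolding Gm_\<tau>_\<tau> j_def sexp_\<tau> ev_ring[OF z] ev_cst[OF z] ev_coord[OF z] ev_J[OF z] ev_k[OF z]
      W_def[symmetric] t_def[symmetric] X_def[symmetric]
    unfolding te using W s_pos by (simp add: field_simps)
qed

section \<open>Sums over the conformal coordinates and the summed second variation\<close>

lemma Gm_sum_left: "Gm (\<Sum>i\<in>A. f i) g = (\<Sum>i\<in>A. Gm (f i) g)"
  by (induction A rule: infinite_finite_induct) (auto simp: Gm_left Gm_minus)

lemma Lp_sum: "Lp (\<Sum>i\<in>A. f i) = (\<Sum>i\<in>A. Lp (f i))"
  by (induction A rule: infinite_finite_induct) (auto simp: Lp_rules Lp_minus)

lemma cst_2_cancel:
  assumes "cst 2 * f = (0 :: 'a sfun)"
  shows "f = 0"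
proof (rule sfun_eqI)
  fix z :: 'a assume z: "z \<in> sphere 0 1"
  show "ev f z = ev 0 z"
    using arg_cong[OF assms, of "\<lambda>f. ev f z"] by (simp add: ev_ring[OF z] ev_cst[OF z])
qed

text \<open>First derivative of the relation that the squares of the \<open>y\<close> sum to
  one.\<close>

lemma sum_y_Gm_y: "(\<Sum>b\<in>Basis. y b * Gm (y b) w) = 0"
proof (rule cst_2_cancel)
  have "0 = Gm (\<Sum>b\<in>Basis. y b * y b) w" by (simp only: sum_y_y Gm_minus)
  also have "\<dots> = (\<Sum>b\<in>Basis. cst 2 * (y b * Gm (y b) w))"
    unfolding Gm_sum_left
  proof (rule sum.cong[OF refl], rule sfun_eqI)
    fix b z :: 'a assume z: "z \<in> sphere 0 1"
    show "ev (Gm (y b * y b) w) z = ev (cst 2 * (y b * Gm (y b) w)) z"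
      unfolding Gm_left by (simp only: ev_ring[OF z] ev_cst[OF z])
  qed
  finally show "cst 2 * (\<Sum>b\<in>Basis. y b * Gm (y b) w) = 0" by (simp add: sum_distrib_left)
qed

text \<open>The Laplacian of the same relation. The eigenvalue equation gives the right side, and
  the drift part of \<open>Aop\<close> drops out by \<open>sum_y_Gm_y\<close>.\<close>

lemma sum_Gm_y_y: "(\<Sum>b\<in>Basis. Gm (y b) (y b)) = cst (4 * m + 4) * j"
proof -
  have "0 = Lp (\<Sum>b\<in>Basis. y b * y b)" by (simp only: sum_y_y Lp_minus)
  also have "\<dots> = (\<Sum>b\<in>Basis. cst 2 * (Gm (y b) (y b) - cst (4 * m + 4) * j * (y b * y b)
      + cst (4 * m + 2) * (y b * Gm (y b) \<tau>)))"
    unfolding Lp_sum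
  proof (rule sum.cong[OF refl], rule sfun_eqI)
    fix b z :: 'a assume z: "z \<in> sphere 0 1"
    have "Lp (y b) = - cst (4 * m + 4) * j * y b + cst (4 * m + 2) * Gm (y b) \<tau>"
      using Aop_y[of b] by (simp add: Aop_def Gm_commute[of \<tau>] algebra_simps)
    then show "ev (Lp (y b * y b)) z = ev (cst 2 * (Gm (y b) (y b) - cst (4 * m + 4) * j * (y b * y b)
      + cst (4 * m + 2) * (y b * Gm (y b) \<tau>))) z"
      unfolding Lp_rules by (simp only: ev_ring[OF z] ev_cst[OF z]) (simp add: algebra_simps)
  qed
  also have "\<dots> = cst 2 * ((\<Sum>b\<in>Basis. Gm (y b) (y b)) - cst (4 * m + 4) * j * (\<Sum>b\<in>Basis. y b * y b)
      + cst (4 * m + 2) * (\<Sum>b\<in>Basis. y b * Gm (y b) \<tau>))"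
    by (simp only: sum.distrib sum_subtractf sum_distrib_left[symmetric])
  finally have "cst 2 * ((\<Sum>b\<in>Basis. Gm (y b) (y b)) - cst (4 * m + 4) * j) = 0"
    unfolding sum_y_y sum_y_Gm_y by simp
  from cst_2_cancel[OF this] show ?thesis by simp
qed

text \<open>Second-order coefficient of the quartic polynomial t \<mapsto> E' (w + t v).\<close>

definition E2 :: "'a sfun \<Rightarrow> 'a sfun \<Rightarrow> real" where
  "E2 w v = SI (P4 * (cst (- (1/2 + m)) * (cst 2 * Gm w w * Gm v v + cst 4 * Gm w v * Gm w v)
     - cst m * (Gm w w * (v * Aop v) + cst 2 * Gm w v * (w * Aop v + v * Aop w) + Gm v v * (w * Aop w))
     + cst ((4 * m + 3) * m\<^sup>2) * j * (w * w * Gm v v + cst 4 * w * v * Gm w v + v * v * Gm w w)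
     + cst ((4 * m + 4) * (4 * m + 3) / 8 * m ^ 3) * cst 6 * (w * w * (v * v) * (j * j))))"

text \<open>The energy is a quartic form, so the expansion along a line is exact and no remainder
  has to be estimated.\<close>

lemma E'_expand:
  "\<exists>a1 a3 a4. \<forall>t. E' (w + cst t * v) = E' w + a1 * t + E2 w v * t\<^sup>2 + a3 * t ^ 3 + a4 * t ^ 4"
proof -
  define c1 c2 c3 where "c1 = - (1/2 + m)" and "c2 = (4 * m + 3) * m\<^sup>2" and "c3 = (4 * m + 4) * (4 * m + 3) / 8 * m ^ 3"
  define F1 where "F1 = P4 * (cst c1 * (cst 4 * Gm w w * Gm w v) - cst m * (Gm w w * (w * Aop v + v * Aop w) + cst 2 * Gm w v * (w * Aop w))
     + cst c2 * j * (w * w * (cst 2 * Gm w v) + cst 2 * w * v * Gm w w) + cst c3 * cst 4 * (w * w * w * v * (j * j)))"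
  define F3 where "F3 = P4 * (cst c1 * (cst 4 * Gm v v * Gm w v) - cst m * (Gm v v * (w * Aop v + v * Aop w) + cst 2 * Gm w v * (v * Aop v))
     + cst c2 * j * (v * v * (cst 2 * Gm w v) + cst 2 * w * v * Gm v v) + cst c3 * cst 4 * (v * v * v * w * (j * j)))"
  have A: "Aop (w + cst t * v) = Aop w + cst t * Aop v" for t
    unfolding Aop_def Lp_rules Gm_right Gm_left by (simp add: algebra_simps)
  have G: "Gm (w + cst t * v) (w + cst t * v) = Gm w w + cst t * (cst 2 * Gm w v) + cst t * cst t * Gm v v" for t
  proof (rule sfun_eqI)
    fix z :: 'a assume z: "z \<in> sphere 0 1"
    show "ev (Gm (w + cst t * v) (w + cst t * v)) z = ev (Gm w w + cst t * (cst 2 * Gm w v) + cst t * cst t * Gm v v) z"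
      unfolding Gm_right Gm_left Gm_commute[of v w] by (simp only: ev_ring[OF z] ev_cst[OF z]) (simp add: algebra_simps)
  qed
  have "E' (w + cst t * v) = E' w + SI F1 * t + E2 w v * t\<^sup>2 + SI F3 * t ^ 3 + E' v * t ^ 4" for t
  proof -
    have "E' w + SI F1 * t + E2 w v * t\<^sup>2 + SI F3 * t ^ 3 + E' v * t ^ 4
       = E' w + t * SI F1 + t\<^sup>2 * E2 w v + t ^ 3 * SI F3 + t ^ 4 * E' v" by simp
    also have "\<dots> = E' (w + cst t * v)"
      unfolding E'_def E2_def SI_cst_mult[symmetric] SI_add[symmetric] c1_def[symmetric] c2_def[symmetric] c3_def[symmetric]
      unfolding G A F1_def F3_def
      by (rule arg_cong[of _ _ SI], rule sfun_eqI, simp only: ev_ring ev_cst, simp add: algebra_simps power2_eq_square power3_eq_cube power4_eq_xxxx)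
    finally show ?thesis by simp
  qed
  then show ?thesis by blast
qed

text \<open>Once the eigenvalue equation has removed the Laplacian of y, the variation depends on y
  only through y^2, y Gm y w, (Gm y w)^2 and Gm y y. Their sums are 1, 0, j Gm w w and (4m+4) j. The
  coefficient of y^2 contains 6 times the energy density, 6 being the binomial coefficient of a
  quartic form.\<close>

lemma sum_E2:
  "(\<Sum>b\<in>Basis. E2 w (y b * w)) = 6 * E' w + SI (P4 * (cst (- ((1/2 + m) * (8 * m + 12))) * (w * w * Gm w w * j)
      - cst m * (cst (- 12 * m - 8) * (w * w * Gm w w * j) + cst (4 * m + 4) * (w * w * w * Aop w * j))
      + cst ((4 * m + 3) * m\<^sup>2 * (4 * m + 4)) * (w * w * (w * w) * (j * j))))"
proof -
  define c1 c2 c3 where "c1 = - (1/2 + m)" and "c2 = (4 * m + 3) * m\<^sup>2" and "c3 = (4 * m + 4) * (4 * m + 3) / 8 * m ^ 3"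
  define G A where "G = Gm w w" and "A = Aop w"
  define N where "N = cst (4 * m + 4) * j"
  \<comment> \<open>C1, C2, C3 and C4 are the coefficients of y^2, y Gm y w, (Gm y w)^2 and Gm y y
    in the integrand.\<close>
  define C1 where "C1 = P4 * (cst c1 * cst 6 * G * G - cst m * (cst 6 * G * w * A - cst 3 * N * w * w * G)
     + cst c2 * cst 6 * j * w * w * G + cst c3 * cst 6 * (w * w * (w * w) * (j * j)))"
  define C2 where "C2 = P4 * (cst c1 * cst 12 * G * w - cst m * (cst 6 * w * G + cst 6 * w * w * A - cst 2 * N * w * w * w)
     + cst c2 * cst 6 * j * w * w * w)"
  define C3 where "C3 = P4 * (cst c1 * cst 4 * w * w - cst m * cst 4 * w * w)"
  define C4 where "C4 = P4 * (cst c1 * cst 2 * G * w * w - cst m * w * w * w * A + cst c2 * j * w * w * w * w)"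
  have "E2 w (y b * w) = SI (C1 * (y b * y b) + C2 * (y b * Gm (y b) w) + C3 * (Gm (y b) w * Gm (y b) w) + C4 * Gm (y b) (y b))" for b
  proof -
    have Ay: "Lp (y b) = cst (4 * m + 2) * Gm \<tau> (y b) - N * y b"
      using Aop_y[of b] by (simp add: Aop_def N_def algebra_simps)
    have Aw: "Lp w = A + cst (4 * m + 2) * Gm \<tau> w" by (simp add: A_def Aop_def)
    have A1: "Aop (y b * w) = y b * A - N * w * y b + cst 2 * Gm (y b) w"
      unfolding Aop_def[of "y b * w"] Lp_rules Gm_right Ay Aw
      by (rule sfun_eqI, simp only: ev_ring ev_cst, simp add: algebra_simps)
    have G1: "Gm w (y b * w) = y b * G + w * Gm (y b) w"
      unfolding Gm_right G_def Gm_commute[of w "y b"] by (simp add: algebra_simps)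
    have G2: "Gm (y b * w) (y b * w) = y b * y b * G + cst 2 * y b * w * Gm (y b) w + w * w * Gm (y b) (y b)"
      unfolding Gm_right Gm_left G_def Gm_commute[of w "y b"]
      by (rule sfun_eqI, simp only: ev_ring ev_cst, simp add: algebra_simps)
    show ?thesis
      unfolding E2_def A1 G1 G2 G_def[symmetric] A_def[symmetric] c1_def[symmetric] c2_def[symmetric] c3_def[symmetric]
    proof (rule arg_cong[of _ _ SI], rule sfun_eqI)
      fix z :: 'a assume z: "z \<in> sphere 0 1"
      define Y a D where "Y = ev (y b) z" and "a = ev (Gm (y b) w) z" and "D = ev (Gm (y b) (y b)) z"
      show "ev (P4 * (cst c1 * (cst 2 * G * (y b * y b * G + cst 2 * y b * w * Gm (y b) w + w * w * Gm (y b) (y b))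
            + cst 4 * (y b * G + w * Gm (y b) w) * (y b * G + w * Gm (y b) w))
          - cst m * (G * (y b * w * (y b * A - N * w * y b + cst 2 * Gm (y b) w))
            + cst 2 * (y b * G + w * Gm (y b) w) * (w * (y b * A - N * w * y b + cst 2 * Gm (y b) w) + y b * w * A)
            + (y b * y b * G + cst 2 * y b * w * Gm (y b) w + w * w * Gm (y b) (y b)) * (w * A))
          + cst c2 * j * (w * w * (y b * y b * G + cst 2 * y b * w * Gm (y b) w + w * w * Gm (y b) (y b))
            + cst 4 * w * (y b * w) * (y b * G + w * Gm (y b) w) + y b * w * (y b * w) * G)
          + cst c3 * cst 6 * (w * w * (y b * w * (y b * w)) * (j * j)))) z
        = ev (C1 * (y b * y b) + C2 * (y b * Gm (y b) w) + C3 * (Gm (y b) w * Gm (y b) w) + C4 * Gm (y b) (y b)) z"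
        unfolding C1_def C2_def C3_def C4_def ev_ring[OF z] ev_cst[OF z] Y_def[symmetric] a_def[symmetric] D_def[symmetric]
        by (simp add: algebra_simps)
    qed
  qed
  then have "(\<Sum>b\<in>Basis. E2 w (y b * w)) = SI (C1 * (\<Sum>b\<in>Basis. y b * y b) + C2 * (\<Sum>b\<in>Basis. y b * Gm (y b) w)
      + C3 * (\<Sum>b\<in>Basis. Gm (y b) w * Gm (y b) w) + C4 * (\<Sum>b\<in>Basis. Gm (y b) (y b)))"
    by (simp only: SI_sum[symmetric] sum.distrib sum_distrib_left)
  also have "\<dots> = SI (C1 + C3 * (j * G) + C4 * N)"
    unfolding sum_y_y sum_y_Gm_y sum_Gm_y_square sum_Gm_y_y N_def[symmetric] G_def[symmetric] by simp
  also have "\<dots> = 6 * E' w + SI (P4 * (cst (- ((1/2 + m) * (8 * m + 12))) * (w * w * Gm w w * j)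
      - cst m * (cst (- 12 * m - 8) * (w * w * Gm w w * j) + cst (4 * m + 4) * (w * w * w * Aop w * j))
      + cst ((4 * m + 3) * m\<^sup>2 * (4 * m + 4)) * (w * w * (w * w) * (j * j))))"
    unfolding E'_def SI_cst_mult[symmetric] SI_add[symmetric] G_def[symmetric] A_def[symmetric]
    unfolding C1_def C3_def C4_def N_def c1_def c2_def c3_def
    by (rule arg_cong[of _ _ SI], rule sfun_eqI, simp only: ev_ring ev_cst, simp add: field_simps power2_eq_square power3_eq_cube)
  finally show ?thesis .
qed

text \<open>With the factor 6 + 8/m imposed by the constraint, the terms with w^4 cancel. The only
  other term without a gradient factor, w^3 \<open>Aop w\<close>, acquires one by integration by
  parts: its weight P4 j = Om^(2-n) is the one for which \<open>Aop\<close> has divergence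
  form.\<close>

lemma second_variation_identity:
  assumes m: "m > 0"
  shows "(\<Sum>b\<in>Basis. E2 w (y b * w)) - (6 + 8 / m) * E' w
     = SI (P4 * Gm w w * (cst 8 * (w * Aop w) + cst (4 / m + 8) * Gm w w - cst (16 * m\<^sup>2 + 20 * m + 6) * j * w * w))"
    (is "_ = SI ?R")
proof -
  define G A where "G = Gm w w" and "A = Aop w"
  define Z where "Z = P4 * (cst (- ((1/2 + m) * (8 * m + 12))) * (w * w * G * j)
      - cst m * (cst (- 12 * m - 8) * (w * w * G * j) + cst (4 * m + 4) * (w * w * w * A * j))
      + cst ((4 * m + 3) * m\<^sup>2 * (4 * m + 4)) * (w * w * (w * w) * (j * j)))
     - cst (8 / m) * (P4 * (cst (- (1/2 + m)) * (G * G) - cst m * (G * (w * A))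
     + cst ((4 * m + 3) * m\<^sup>2) * (w * w * G * j) + cst ((4 * m + 4) * (4 * m + 3) / 8 * m ^ 3) * (w * w * (w * w) * (j * j))))"
  \<comment> \<open>The divergence of P4 j w^3 grad w, equal to P4 j (w^3 \<open>Aop w\<close> + 3
    w^2 \<open>Gm w w\<close>).\<close>
  define D where "D = P4 * (w * w * w * j) * Lp w + Gm (P4 * (w * w * w * j)) w"
  have "(\<Sum>b\<in>Basis. E2 w (y b * w)) - (6 + 8 / m) * E' w = SI Z"
    unfolding sum_E2 Z_def SI_linear SI_cst_mult unfolding E'_def G_def A_def by (simp add: algebra_simps)
  also have "Z = ?R - cst (m * (4 * m + 4)) * D"
  proof (rule sfun_eqI)
    fix z :: 'a assume z: "z \<in> sphere 0 1"
    have Aw: "Lp w = A + cst (4 * m + 2) * Gm \<tau> w" by (simp add: A_def Aop_def)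
    show "ev Z z = ev (?R - cst (m * (4 * m + 4)) * D) z"
      unfolding Z_def D_def Gm_left Gm_P4 Gm_j Aw G_def[symmetric] A_def[symmetric] ev_ring[OF z] ev_cst[OF z]
      using m by (simp add: field_simps power2_eq_square power3_eq_cube)
  qed
  also have "SI (?R - cst (m * (4 * m + 4)) * D) = SI ?R"
    unfolding SI_linear SI_cst_mult D_def SI_by_parts by simp
  finally show ?thesis .
qed

text \<open>Positive scalar curvature bounds w \<open>Aop w\<close> from above, strongly enough to
  make the bracket of the second variation identity at most -(4m+6) j w^2. The integral is
  nonnegative by hypothesis, so the weight \<open>Gm w w\<close> must vanish.\<close>

lemma gradient_vanishes:
  assumes m: "m > 0" and R: "\<And>z. z \<in> sphere 0 1 \<Longrightarrow> ev (Rf m (P * w)) z > 0"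
    and sv: "(\<Sum>b\<in>Basis. E2 w (y b * w)) \<ge> (6 + 8 / m) * E' w" and w: "pos_on w"
    and z: "z \<in> sphere 0 1"
  shows "ev (Gm w w) z = 0"
proof -
  define Q where "Q = P4 * Gm w w * (j * w * w)"
  have bound: "ev (P4 * Gm w w * (cst 8 * (w * Aop w) + cst (4 / m + 8) * Gm w w - cst (16 * m\<^sup>2 + 20 * m + 6) * j * w * w)) z
      \<le> ev (- cst (4 * m + 6) * Q) z" if z: "z \<in> sphere 0 1" for z
  proof -
    define p where "p = ev P z"
    have p: "p > 0" by (simp add: p_def P_def ev_sexp[OF z])
    define g a \<omega> where "g = ev (Gm w w) z" and "a = ev (w * Aop w) z" and "\<omega> = ev (j * w * w) z"
    have g: "g \<ge> 0" by (simp add: g_def ev_Gm[OF z])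
    have "p * p * ((4 * m + 4) * \<omega> - (2 / m) * (a + ((m + 1) / m) * g)) > 0"
      using R[OF z] m unfolding Rf_covariant[OF less_imp_neq[OF m, symmetric]]
      by (simp only: ev_ring[OF z] ev_cst[OF z] p_def g_def a_def \<omega>_def mult.assoc)
    then have "(4 * m + 4) * \<omega> - (2 / m) * (a + ((m + 1) / m) * g) > 0"
      using p by (simp add: zero_less_mult_iff)
    \<comment> \<open>Eight times this bound contributes 16 m^2 + 16 m to the coefficient of
      \<omega>; against 16 m^2 + 20 m + 6 there remain -(4m+6) \<omega> and -(4/m) g.\<close>
    then have "a + ((m + 1) / m) * g < (m / 2) * ((4 * m + 4) * \<omega>)"
      using m by (simp add: field_simps)
    moreover define r where "r = g / m"
    moreover have "((m + 1) / m) * g = g + r" "(4 / m + 8) * g = 4 * r + 8 * g" "(4 / m) * g = 4 * r"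
      using m by (simp_all add: r_def field_simps)
    moreover have "(m / 2) * ((4 * m + 4) * \<omega>) = 2 * (m\<^sup>2 * \<omega>) + 2 * (m * \<omega>)"
      "(16 * m\<^sup>2 + 20 * m + 6) * \<omega> = 16 * (m\<^sup>2 * \<omega>) + 20 * (m * \<omega>) + 6 * \<omega>"
      "- (4 * m + 6) * \<omega> = - 4 * (m * \<omega>) - 6 * \<omega>"
      by (simp_all add: algebra_simps power2_eq_square)
    ultimately have "8 * a + (4 / m + 8) * g - (16 * m\<^sup>2 + 20 * m + 6) * \<omega> \<le> - (4 * m + 6) * \<omega> - (4 / m) * g"
      by linarith
    also have "\<dots> \<le> - (4 * m + 6) * \<omega>" using m g by simp
    finally have "p * p * (p * p) * g * (8 * a + (4 / m + 8) * g - (16 * m\<^sup>2 + 20 * m + 6) * \<omega>)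
        \<le> p * p * (p * p) * g * (- (4 * m + 6) * \<omega>)"
      using p g by (intro mult_left_mono) auto
    then show ?thesis
      by (simp only: Q_def P4_def ev_ring[OF z] ev_cst[OF z] p_def g_def a_def \<omega>_def mult_ac mult_minus_left mult_minus_right)
  qed
  have "0 \<le> SI (P4 * Gm w w * (cst 8 * (w * Aop w) + cst (4 / m + 8) * Gm w w - cst (16 * m\<^sup>2 + 20 * m + 6) * j * w * w))"
    using sv second_variation_identity[OF m, of w] by simp
  also have "\<dots> \<le> SI (- cst (4 * m + 6) * Q)" by (rule SI_mono[OF bound])
  finally have "(4 * m + 6) * SI Q \<le> 0" by (simp add: SI_linear SI_cst_mult)
  then have SQ: "SI Q \<le> 0" using m by (simp add: mult_le_0_iff)
  have pz: "ev P z > 0" "ev J z > 0" if "z \<in> sphere 0 1" for z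
    using that by (simp_all add: P_def J_def ev_sexp)
  have "ev Q z = 0"
  proof (rule SI_eq_0_imp[OF SQ _ z])
    fix z :: 'a assume z: "z \<in> sphere 0 1"
    have "ev (Gm w w) z \<ge> 0" by (simp add: ev_Gm[OF z])
    then show "ev Q z \<ge> 0" using pz[OF z] by (simp add: Q_def P4_def j_def ev_ring[OF z] mult.assoc)
  qed
  then show ?thesis
    using pz[OF z] bspec[OF w[unfolded pos_on_def] z] by (auto simp: Q_def P4_def j_def ev_ring[OF z])
qed

end

section \<open>Balancing and the conformal volume\<close>

lemma SI_1: "SI (1 :: 'a::euclidean_space sfun) = omega TYPE('a)"
  using SI_cst[where 'a='a, of 1] by (simp add: cst_hom)

lemma SI_nonneg: "(\<And>z. z \<in> sphere 0 1 \<Longrightarrow> ev f z \<ge> 0) \<Longrightarrow> SI f \<ge> 0"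
  using SI_mono[of 0 f] by (simp add: ev_ring SI_linear)

lemma sphere_nonempty: obtains z :: "'a::euclidean_space" where "z \<in> sphere 0 1"
proof -
  obtain b :: 'a where "b \<in> Basis" using nonempty_Basis by blast
  then show thesis by (intro that[of b]) simp
qed

lemma SI_pos: "pos_on f \<Longrightarrow> SI f > 0"
proof (rule ccontr)
  assume f: "pos_on f" and "\<not> SI f > 0"
  obtain z :: 'a where z: "z \<in> sphere 0 1" by (rule sphere_nonempty)
  have "ev f z = 0"
    by (rule SI_eq_0_imp[OF _ _ z]) (use f \<open>\<not> SI f > 0\<close> in \<open>auto simp: pos_on_def less_imp_le\<close>)
  then show False using f z unfolding pos_on_def by force
qed

lemma omega_pos: "omega TYPE('a::euclidean_space) > 0"
  using SI_pos[of "1 :: 'a sfun"] by (simp add: SI_1 pos_on_def ev_ring)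

lemma ev_bounded: obtains M where "M > 0" "\<And>z. z \<in> sphere 0 1 \<Longrightarrow> \<bar>ev f z\<bar> \<le> M"
  using smooth_sphere_bounded[OF smooth_ev] by blast

context conformal_factor
begin

text \<open>The Laplacian of \<tau> has integral zero and equals (4m+2) J/s - (4m+3) + J^2; dropping
  J^2 gives the claim. As J/s = 1/(1 + \<xi> z), this bounds the integral of that function uniformly
  for \<xi> in the ball.\<close>

lemma SI_J_bound: "(4 * m + 2) * SI J / s \<le> (4 * m + 3) * omega TYPE('a)"
proof -
  have "SI (1 * Lp \<tau> + Gm 1 \<tau>) = 0" by (rule SI_by_parts)
  then have "SI (Lp \<tau>) = 0" by (simp add: Gm_minus)
  moreover have "SI (cst ((4 * m + 2) / s) * J - cst (4 * m + 3)) \<le> SI (Lp \<tau>)"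
  proof (rule SI_mono)
    fix z :: 'a assume z: "z \<in> sphere 0 1"
    have "0 \<le> ev J z * ev J z" by simp
    then show "ev (cst ((4 * m + 2) / s) * J - cst (4 * m + 3)) z \<le> ev (Lp \<tau>) z"
      unfolding Lp_\<tau>_m Gm_\<tau>_\<tau> k_def ev_ring[OF z] ev_cst[OF z] using s_pos by (simp add: field_simps)
  qed
  ultimately show ?thesis by (simp add: SI_linear SI_cst_mult SI_cst)
qed

text \<open>The left side is the integral of a times the derivative of \<tau> with respect to \<xi>
  in direction v. It vanishes because a = Om^(-n) turns a combination of a J z v and a J into the
  divergence of a grad (z v).\<close>

lemma SI_conformal_volume_critical:
  assumes m4: "4 * m + 4 > 0"
  defines "a \<equiv> P4 * (j * j)"
  shows "SI (a * J * coord v) / s + (\<xi> \<bullet> v) / s\<^sup>2 * SI a = 0"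
proof -
  have Ga: "Gm a f = - cst (4 * m + 4) * a * Gm \<tau> f" for f
  proof (rule sfun_eqI)
    fix z :: 'a assume z: "z \<in> sphere 0 1"
    show "ev (Gm a f) z = ev (- cst (4 * m + 4) * a * Gm \<tau> f) z"
      unfolding a_def Gm_left Gm_P4 Gm_j ev_ring[OF z] ev_cst[OF z] by (simp add: algebra_simps)
  qed
  have Lx: "Lp (coord v) = - cst (4 * m + 4) * coord v" for v :: 'a
  proof -
    have "real DIM('a) - 1 = 4 * m + 4" using DIM_m by simp
    then show ?thesis by (simp only: Lp_coord)
  qed
  have *: "SI (a * J * coord v) + (\<xi> \<bullet> v) * SI (a * J) = 0" for v
  proof -
    have "a * Lp (coord v) + Gm a (coord v) = cst (- (4 * m + 4) / s) * (a * J * coord v + cst (\<xi> \<bullet> v) * (a * J))"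
    proof (rule sfun_eqI)
      fix z :: 'a assume z: "z \<in> sphere 0 1"
      define W t X where "W = ev Om z" and "t = ev (Gm \<tau> (coord v)) z" and "X = z \<bullet> v"
      have W: "W > 0" using ev_Om_pos[OF z] by (simp add: W_def)
      have "s * W * t = \<xi> \<bullet> v - (s * W - 1) * X"
        using arg_cong[OF Gm_\<xi>, of "\<lambda>f. ev f z" "coord v"] s_pos
        by (simp add: Gm_coord_coord ev_ring[OF z] ev_cst[OF z] ev_coord[OF z] W_def t_def X_def ev_Om[OF z])
      then have t: "t = (\<xi> \<bullet> v - (s * W - 1) * X) / (s * W)" using W s_pos by (simp add: field_simps)
      show "ev (a * Lp (coord v) + Gm a (coord v)) z = ev (cst (- (4 * m + 4) / s) * (a * J * coord v + cst (\<xi> \<bullet> v) * (a * J))) z"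
        unfolding Ga Lx ev_ring[OF z] ev_cst[OF z] ev_coord[OF z] ev_J[OF z] W_def[symmetric] t_def[symmetric] X_def[symmetric] t
        using W s_pos by (simp add: field_simps)
    qed
    then have "- (4 * m + 4) / s * (SI (a * J * coord v) + (\<xi> \<bullet> v) * SI (a * J)) = 0"
      using SI_by_parts[of a "coord v"] by (simp only: SI_cst_mult SI_add)
    then show ?thesis using m4 s_pos by simp
  qed
  \<comment> \<open>Since \<xi> z = s Om - 1, the case v = \<xi> determines the integral of a J in
    terms of that of a.\<close>
  have "a * J * coord \<xi> = cst s * a - a * J"
  proof (rule sfun_eqI)
    fix z :: 'a assume z: "z \<in> sphere 0 1"
    show "ev (a * J * coord \<xi>) z = ev (cst s * a - a * J) z"
      unfolding coord_\<xi> ev_ring[OF z] ev_cst[OF z] ev_J[OF z] using ev_Om_pos[OF z] by (simp add: field_simps)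
  qed
  with *[of \<xi>] have "SI (cst s * a - a * J) + (\<xi> \<bullet> \<xi>) * SI (a * J) = 0" by (simp only:)
  then have "s * SI a - (1 - \<xi> \<bullet> \<xi>) * SI (a * J) = 0"
    unfolding SI_linear SI_cst_mult by (simp add: algebra_simps)
  then have "SI (a * J) = SI a / s" using s_pos by (simp add: s_square[symmetric] power2_eq_square field_simps)
  then have "SI (a * J * coord v) = - (\<xi> \<bullet> v) * (SI a / s)" using *[of v] by simp
  then show ?thesis using s_pos by (simp add: power2_eq_square)
qed

text \<open>The hypothesis says that \<xi> is critical for the integral of \<rho> \<tau> as a
  function of \<xi>. Its case v = \<xi> yields SI (\<rho> J) = SI \<rho> / s, its case v = b the
  integral of \<rho> J z b; in the combination forming \<open>y b\<close> they cancel by the choice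
  of \<gamma>.\<close>

lemma SI_balanced:
  assumes "\<And>v. SI (\<rho> * J * coord v) / s + (\<xi> \<bullet> v) / s\<^sup>2 * SI \<rho> = 0"
  shows "SI (\<rho> * y b) = 0"
proof -
  have "\<rho> * J * coord \<xi> = cst s * \<rho> - \<rho> * J"
  proof (rule sfun_eqI)
    fix z :: 'a assume z: "z \<in> sphere 0 1"
    show "ev (\<rho> * J * coord \<xi>) z = ev (cst s * \<rho> - \<rho> * J) z"
      unfolding coord_\<xi> ev_ring[OF z] ev_cst[OF z] ev_J[OF z] using ev_Om_pos[OF z] by (simp add: field_simps)
  qed
  with assms[of \<xi>] have "(s * SI \<rho> - SI (\<rho> * J)) / s + (1 - s\<^sup>2) / s\<^sup>2 * SI \<rho> = 0"
    by (simp add: SI_linear SI_cst_mult s_square)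
  then have 1: "SI (\<rho> * J) = SI \<rho> / s" using s_pos by (simp add: field_simps power2_eq_square)
  have 2: "SI (\<rho> * J * coord b) = - (\<xi> \<bullet> b) * SI \<rho> / s"
    using assms[of b] s_pos by (simp add: field_simps power2_eq_square)
  have "\<rho> * y b = \<rho> * J * coord b + cst (\<gamma> * (\<xi> \<bullet> b)) * (\<rho> * J + \<rho> * (Om * J))"
    by (simp add: y_def algebra_simps)
  then have "SI (\<rho> * y b) = - (\<xi> \<bullet> b) * SI \<rho> / s + \<gamma> * (\<xi> \<bullet> b) * (SI \<rho> / s + SI \<rho>)"
    by (simp add: Om_J SI_add SI_cst_mult 1 2)
  also have "\<dots> = (\<xi> \<bullet> b) * SI \<rho> / s * (\<gamma> * (1 + s) - 1)"
    using s_pos by (simp add: field_simps)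
  finally show ?thesis by (simp add: \<gamma>)
qed

lemma ev_\<tau>: "z \<in> sphere 0 1 \<Longrightarrow> ev \<tau> z = ln (1 + z \<bullet> \<xi>) - ln (1 - \<xi> \<bullet> \<xi>) / 2"
proof -
  assume z: "z \<in> sphere 0 1"
  have p: "1 + z \<bullet> \<xi> > 0" using ev_Om_pos[OF z] s_pos by (simp add: ev_Om[OF z] zero_less_divide_iff)
  have "ev \<tau> z = ln (ev Om z)"
    unfolding \<tau>_def by (rule ev_sln[OF _ z]) (simp add: pos_on_def ev_Om_pos)
  also have "\<dots> = ln (1 + z \<bullet> \<xi>) - ln s"
    using p s_pos by (simp add: ev_Om[OF z] ln_div)
  also have "ln s = ln (1 - \<xi> \<bullet> \<xi>) / 2"
    unfolding s_square[symmetric] using s_pos by (simp add: ln_realpow)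
  finally show ?thesis .
qed

lemma ev_J_s: "z \<in> sphere 0 1 \<Longrightarrow> ev J z / s = 1 / (1 + z \<bullet> \<xi>)"
  using s_pos by (simp add: ev_J ev_Om)

lemma one_plus_pos: "z \<in> sphere 0 1 \<Longrightarrow> 1 + z \<bullet> \<xi> > 0"
  using ev_Om_pos[of z] s_pos by (simp add: ev_Om zero_less_divide_iff)

lemma one_plus_ge: "z \<in> sphere 0 1 \<Longrightarrow> 1 + z \<bullet> \<xi> \<ge> 1 - norm \<xi>"
  using Cauchy_Schwarz_ineq2[of z \<xi>] by simp

lemma norm_\<xi>_square: "\<xi> \<bullet> \<xi> < 1"
  using s_square s_pos by (smt (verit) zero_less_power)

lemma volume_density: "P4 * (j * j) = sexp (cst (- (4 * m + 4)) * \<tau>)"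
proof (rule sfun_eqI)
  fix z :: 'a assume z: "z \<in> sphere 0 1"
  show "ev (P4 * (j * j)) z = ev (sexp (cst (- (4 * m + 4)) * \<tau>)) z"
    unfolding P4_def P_def j_def J_def ev_ring[OF z] ev_sexp[OF z] ev_cst[OF z] exp_add[symmetric]
    by (simp add: algebra_simps)
qed

end

text \<open>The functional minimized over the open ball is proper: its integral part stays bounded below
  by the uniform bound on the integral of 1/(1 + \<xi> z), while the logarithmic term blows up.\<close>

lemma exists_balancing_point:
  fixes \<rho> :: "'a::euclidean_space sfun"
  assumes \<rho>: "pos_on \<rho>" and m: "m > 0" and dim: "real DIM('a) = 4 * m + 5"
  shows "\<exists>\<xi>::'a. norm \<xi> < 1 \<and> (\<forall>v. SI (\<rho> * conformal_factor.J \<xi> * coord v) / conformal_factor.s \<xi>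
     + (\<xi> \<bullet> v) / (conformal_factor.s \<xi>)\<^sup>2 * SI \<rho> = 0)"
proof -
  define I0 where "I0 = SI \<rho>"
  have I0: "I0 > 0" using SI_pos[OF \<rho>] by (simp add: I0_def)
  define lg where "lg \<xi> = sln (1 + coord \<xi>)" for \<xi> :: 'a
  define K where "K \<xi> = cst (1 / conformal_factor.s \<xi>) * conformal_factor.J \<xi>" for \<xi> :: 'a
  have cf: "conformal_factor \<xi> m" if "norm \<xi> < 1" for \<xi> :: 'a
    using that dim by unfold_locales
  have ev_lg: "ev (lg \<xi>) z = ln (1 + z \<bullet> \<xi>)" if "norm \<xi> < 1" "z \<in> sphere 0 1" for \<xi> z :: 'a
  proof -
    have "pos_on (1 + coord \<xi>)"
      using conformal_factor.one_plus_pos[OF cf[OF that(1)]] by (simp add: pos_on_def ev_ring ev_coord)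
    then show ?thesis using that by (simp add: lg_def ev_sln ev_ring ev_coord)
  qed
  have ev_K: "ev (K \<xi>) z = 1 / (1 + z \<bullet> \<xi>)" if "norm \<xi> < 1" "z \<in> sphere 0 1" for \<xi> z :: 'a
    using conformal_factor.ev_J_s[OF cf[OF that(1)] that(2)] that(2) by (simp add: K_def ev_ring ev_cst)
  have pz: "1 + z \<bullet> \<xi> > 0" if "norm \<xi> < 1" "z \<in> sphere 0 1" for \<xi> z :: 'a
    by (rule conformal_factor.one_plus_pos[OF cf[OF that(1)] that(2)])
  have \<rho>z: "ev \<rho> z > 0" if "z \<in> sphere 0 1" for z using \<rho> that by (auto simp: pos_on_def)
  define F0 where "F0 \<xi> = SI (\<rho> * lg \<xi>)" for \<xi>
  \<comment> \<open>This is the integral of \<rho> \<tau>, with ln s written as half of ln (1 -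
    \<xi> \<xi>); the claim asks for a critical point of F.\<close>
  define F where "F \<xi> = F0 \<xi> - I0 / 2 * ln (1 - \<xi> \<bullet> \<xi>)" for \<xi>
  \<comment> \<open>The tangent inequality for the concave function ln serves twice: it gives the
    Lipschitz estimate, and at a minimum it gives the first-order condition without differentiation
    under the integral.\<close>
  have up: "F0 \<eta> - F0 \<xi> \<le> SI (\<rho> * K \<xi> * coord (\<eta> - \<xi>))" if "norm \<xi> < 1" "norm \<eta> < 1" for \<xi> \<eta>
    unfolding F0_def SI_linear(2)[symmetric]
  proof (rule SI_mono)
    fix z :: 'a assume z: "z \<in> sphere 0 1"
    have "ln (1 + z \<bullet> \<eta>) - ln (1 + z \<bullet> \<xi>) = ln ((1 + z \<bullet> \<eta>) / (1 + z \<bullet> \<xi>))"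
      using pz[OF that(1) z] pz[OF that(2) z] by (simp add: ln_div)
    also have "\<dots> \<le> (1 + z \<bullet> \<eta>) / (1 + z \<bullet> \<xi>) - 1"
      using pz[OF that(1) z] pz[OF that(2) z] by (intro ln_le_minus_one) simp
    also have "\<dots> = 1 / (1 + z \<bullet> \<xi>) * (z \<bullet> (\<eta> - \<xi>))"
      using pz[OF that(1) z] by (simp add: field_simps inner_diff_right)
    finally have "ev \<rho> z * (ln (1 + z \<bullet> \<eta>) - ln (1 + z \<bullet> \<xi>)) \<le> ev \<rho> z * (1 / (1 + z \<bullet> \<xi>) * (z \<bullet> (\<eta> - \<xi>)))"
      using \<rho>z[OF z] by (intro mult_left_mono) auto
    then show "ev (\<rho> * lg \<eta> - \<rho> * lg \<xi>) z \<le> ev (\<rho> * K \<xi> * coord (\<eta> - \<xi>)) z"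
      unfolding ev_ring[OF z] ev_lg[OF that(1) z] ev_lg[OF that(2) z] ev_K[OF that(1) z] ev_coord[OF z]
      by (simp add: algebra_simps)
  qed
  have lip: "F0 \<eta> - F0 \<xi> \<le> I0 / (1 - r) * norm (\<eta> - \<xi>)" if "r < 1" "norm \<xi> \<le> r" "norm \<eta> \<le> r" for \<xi> \<eta> r
  proof -
    have n: "norm \<xi> < 1" "norm \<eta> < 1" using that by auto
    have "F0 \<eta> - F0 \<xi> \<le> SI (\<rho> * K \<xi> * coord (\<eta> - \<xi>))" by (rule up[OF n])
    also have "\<dots> \<le> SI (cst (norm (\<eta> - \<xi>) / (1 - r)) * \<rho>)"
    proof (rule SI_mono)
      fix z :: 'a assume z: "z \<in> sphere 0 1"
      have "1 - r \<le> 1 + z \<bullet> \<xi>"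
        using conformal_factor.one_plus_ge[OF cf[OF n(1)] z] that by simp
      moreover have "z \<bullet> (\<eta> - \<xi>) \<le> norm (\<eta> - \<xi>)" using Cauchy_Schwarz_ineq2[of z "\<eta> - \<xi>"] z by simp
      ultimately have "(z \<bullet> (\<eta> - \<xi>)) / (1 + z \<bullet> \<xi>) \<le> norm (\<eta> - \<xi>) / (1 - r)"
        using that by (intro frac_le) auto
      then have "ev \<rho> z * ((z \<bullet> (\<eta> - \<xi>)) / (1 + z \<bullet> \<xi>)) \<le> ev \<rho> z * (norm (\<eta> - \<xi>) / (1 - r))"
        using \<rho>z[OF z] by (intro mult_left_mono) auto
      then show "ev (\<rho> * K \<xi> * coord (\<eta> - \<xi>)) z \<le> ev (cst (norm (\<eta> - \<xi>) / (1 - r)) * \<rho>) z"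
        unfolding ev_ring[OF z] ev_K[OF n(1) z] ev_coord[OF z] ev_cst[OF z] by (simp add: mult_ac)
    qed
    finally show ?thesis unfolding SI_cst_mult I0_def[symmetric] by (simp add: mult.commute)
  qed
  have cont: "continuous_on (cball 0 r) F" if "0 \<le> r" "r < 1" for r
  proof -
    have "(I0 / (1 - r))-lipschitz_on (cball 0 r) F0"
    proof (rule lipschitz_onI)
      fix \<eta> \<xi> :: 'a assume "\<eta> \<in> cball 0 r" "\<xi> \<in> cball 0 r"
      then show "dist (F0 \<eta>) (F0 \<xi>) \<le> I0 / (1 - r) * dist \<eta> \<xi>"
        using lip[OF that(2), of \<xi> \<eta>] lip[OF that(2), of \<eta> \<xi>]
        by (simp add: dist_norm abs_le_iff norm_minus_commute)
    qed (use that I0 in auto)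
    moreover have "1 - \<xi> \<bullet> \<xi> > 0" if "\<xi> \<in> cball 0 r" for \<xi> :: 'a
      by (rule conformal_factor.norm_\<xi>_square[OF cf, THEN diff_gt_0_iff_gt[THEN iffD2]]) (use that \<open>r < 1\<close> in auto)
    ultimately show ?thesis unfolding F_def
      by (intro continuous_intros lipschitz_on_continuous_on) (auto simp: less_imp_neq[symmetric])
  qed
  obtain M where M: "M > 0" "\<And>z. z \<in> sphere 0 1 \<Longrightarrow> \<bar>ev \<rho> z\<bar> \<le> M" using ev_bounded[of \<rho>] by blast
  define C where "C = M * ((4 * m + 3) / (4 * m + 2) * omega TYPE('a))"
  have coercive: "F0 \<xi> \<ge> - C" if n: "norm \<xi> < 1" for \<xi>
  proof -
    have "SI (cst (- M) * K \<xi>) \<le> F0 \<xi>" unfolding F0_def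
    proof (rule SI_mono)
      fix z :: 'a assume z: "z \<in> sphere 0 1"
      define t where "t = 1 + z \<bullet> \<xi>"
      have t: "t > 0" using pz[OF n z] by (simp add: t_def)
      have "- (1 / t) \<le> ln t" using ln_le_minus_one[of "1 / t"] t by (simp add: ln_div)
      then have "ev \<rho> z * (- (1 / t)) \<le> ev \<rho> z * ln t" using \<rho>z[OF z] by (intro mult_left_mono) auto
      moreover have "ev \<rho> z * (1 / t) \<le> M * (1 / t)" using M(2)[OF z] t by (intro mult_right_mono) auto
      ultimately show "ev (cst (- M) * K \<xi>) z \<le> ev (\<rho> * lg \<xi>) z"
        unfolding ev_ring[OF z] ev_lg[OF n z] ev_K[OF n z] ev_cst[OF z] t_def[symmetric] by simp
    qed
    moreover have "SI (K \<xi>) \<le> (4 * m + 3) / (4 * m + 2) * omega TYPE('a)"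
    proof -
      have "SI (K \<xi>) = SI (conformal_factor.J \<xi>) / conformal_factor.s \<xi>" by (simp add: K_def SI_cst_mult)
      then have "(4 * m + 2) * SI (K \<xi>) \<le> (4 * m + 3) * omega TYPE('a)"
        using conformal_factor.SI_J_bound[OF cf[OF n]] by simp
      then show ?thesis using m by (simp add: pos_le_divide_eq mult.commute)
    qed
    then have "M * SI (K \<xi>) \<le> C" unfolding C_def using M(1) by (intro mult_left_mono) auto
    ultimately show ?thesis unfolding SI_cst_mult by linarith
  qed
  \<comment> \<open>Chosen so that on the sphere of radius r the logarithmic term is at least C + 1.
    Then F \<ge> 1 there, while F 0 = 0, and the minimum over the closed ball is interior. The bound
    1/2 keeps the argument of the root nonnegative.\<close>
  define e where "e = exp (- 2 * (C + 1) / I0)"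
  define r where "r = sqrt (1 - min e (1/2))"
  have e: "e > 0" by (simp add: e_def)
  have r: "0 \<le> r" "r < 1" "r\<^sup>2 = 1 - min e (1/2)"
    using e by (auto simp: r_def real_sqrt_pow2)
  have big: "F \<xi> \<ge> 1" if "norm \<xi> = r" for \<xi>
  proof -
    have "ln (1 - \<xi> \<bullet> \<xi>) \<le> ln e"
      using e r that by (simp add: dot_square_norm)
    also have "\<dots> = - 2 * (C + 1) / I0" by (simp add: e_def)
    finally have "I0 / 2 * ln (1 - \<xi> \<bullet> \<xi>) \<le> I0 / 2 * (- 2 * (C + 1) / I0)"
      using I0 by (intro mult_left_mono) auto
    also have "\<dots> = - (C + 1)" using I0 by (simp add: field_simps)
    finally show ?thesis using coercive[of \<xi>] that r by (simp add: F_def)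
  qed
  have F00: "F 0 = 0"
  proof -
    have "\<rho> * lg 0 = 0"
      by (rule sfun_eqI) (use ev_lg[of 0] in \<open>simp add: ev_ring\<close>)
    then show ?thesis by (simp add: F_def F0_def SI_linear)
  qed
  obtain \<xi> where min: "\<xi> \<in> cball 0 r" "\<And>\<eta>. \<eta> \<in> cball 0 r \<Longrightarrow> F \<xi> \<le> F \<eta>"
    using continuous_attains_inf[OF compact_cball _ cont[OF r(1,2)]] r(1) by (metis cball_eq_empty not_less)
  have "F \<xi> \<le> 0" using min(2)[of 0] F00 r by simp
  then have n\<xi>: "norm \<xi> < r" using big[of \<xi>] min(1) by (cases "norm \<xi> = r") auto
  then have n1: "norm \<xi> < 1" using r by simp
  interpret conformal_factor \<xi> m by (rule cf[OF n1])
  have "SI (\<rho> * J * coord v) / s + (\<xi> \<bullet> v) / s\<^sup>2 * SI \<rho> = 0" for v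
  proof -
    define B where "B = SI (\<rho> * K \<xi> * coord v)"
    \<comment> \<open>L t lies above F (\<xi> + t v) - F \<xi> and agrees with it at t = 0, so it
      inherits the local minimum; unlike F it is explicitly differentiable.\<close>
    define L where "L t = t * B - I0 / 2 * (ln (1 - (\<xi> + t *\<^sub>R v) \<bullet> (\<xi> + t *\<^sub>R v)) - ln (1 - \<xi> \<bullet> \<xi>))" for t
    have near: "\<forall>\<^sub>F t in nhds (0::real). \<xi> + t *\<^sub>R v \<in> ball 0 r"
      by (rule eventually_line_in_open) (use n\<xi> in auto)
    then obtain d where d: "d > 0" "\<And>t. \<bar>t\<bar> < d \<Longrightarrow> \<xi> + t *\<^sub>R v \<in> ball 0 r"
      unfolding eventually_nhds_metric by (auto simp: dist_real_def)
    have Lpos: "L t \<ge> 0" if "\<bar>t\<bar> < d" for t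
    proof -
      have n2: "norm (\<xi> + t *\<^sub>R v) < r" using d(2)[OF that] by simp
      have 1: "F \<xi> \<le> F (\<xi> + t *\<^sub>R v)" using min(2) n2 by simp
      have "F0 (\<xi> + t *\<^sub>R v) - F0 \<xi> \<le> SI (\<rho> * K \<xi> * coord (\<xi> + t *\<^sub>R v - \<xi>))"
        by (rule up) (use n1 n2 r in auto)
      also have "\<rho> * K \<xi> * coord (\<xi> + t *\<^sub>R v - \<xi>) = cst t * (\<rho> * K \<xi> * coord v)"
        by (rule sfun_eqI) (simp add: ev_ring ev_cst ev_coord)
      also have "SI \<dots> = t * B" unfolding SI_cst_mult B_def ..
      finally show ?thesis using 1 unfolding L_def F_def right_diff_distrib by linarith
    qed
    have L0: "L 0 = 0" by (simp add: L_def)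
    have "(L has_real_derivative (B - I0 / 2 * (- (2 * (\<xi> \<bullet> v)) / (1 - \<xi> \<bullet> \<xi>)))) (at 0)"
    proof -
      have "(\<xi> + t *\<^sub>R v) \<bullet> (\<xi> + t *\<^sub>R v) = \<xi> \<bullet> \<xi> + 2 * t * (\<xi> \<bullet> v) + t * t * (v \<bullet> v)" for t
        by (simp add: algebra_simps inner_commute)
      then show ?thesis unfolding L_def[abs_def] using norm_\<xi>_square
        by (auto intro!: derivative_eq_intros simp: field_simps)
    qed
    from DERIV_local_min[OF this d(1)] have "B - I0 / 2 * (- (2 * (\<xi> \<bullet> v)) / (1 - \<xi> \<bullet> \<xi>)) = 0"
      using Lpos L0 by simp
    moreover have "B = SI (\<rho> * J * coord v) / s"
    proof -
      have "\<rho> * K \<xi> * coord v = cst (1 / s) * (\<rho> * J * coord v)" by (simp add: K_def algebra_simps)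
      then show ?thesis by (simp add: B_def SI_cst_mult)
    qed
    ultimately show ?thesis unfolding s_square by (simp add: I0_def field_simps)
  qed
  then show ?thesis using n1 by blast
qed

text \<open>Tangent inequalities deliver a one-sided bound. Exchanging r and t makes it two-sided,
  and a function with quadratically small increments has derivative zero.\<close>

lemma quadratic_bound_imp_constant:
  fixes g :: "real \<Rightarrow> real"
  assumes "\<And>r t. r \<in> {0..1} \<Longrightarrow> t \<in> {0..1} \<Longrightarrow> g t - C * (r - t)\<^sup>2 \<le> g r"
  shows "g 0 = g 1"
proof -
  have bd: "\<bar>g r - g t\<bar> \<le> \<bar>C\<bar> * (r - t)\<^sup>2" if "r \<in> {0..1}" "t \<in> {0..1}" for r t
  proof -
    have "C * (r - t)\<^sup>2 \<le> \<bar>C\<bar> * (r - t)\<^sup>2" by (intro mult_right_mono) auto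
    then show ?thesis using assms[OF that] assms[OF that(2,1)] by (simp add: power2_commute[of t r])
  qed
  have "(g has_field_derivative 0) (at t within {0..1})" if t: "t \<in> {0..1}" for t
  proof -
    have "((\<lambda>r. (g r - g t) / (r - t)) \<longlongrightarrow> 0) (at t within {0..1})"
    proof (rule Lim_null_comparison)
      show "\<forall>\<^sub>F r in at t within {0..1}. norm ((g r - g t) / (r - t)) \<le> \<bar>C\<bar> * \<bar>r - t\<bar>"
        unfolding eventually_at_filter
      proof (rule always_eventually, intro allI impI)
        fix r assume "r \<noteq> t" "r \<in> {0..1}"
        then show "norm ((g r - g t) / (r - t)) \<le> \<bar>C\<bar> * \<bar>r - t\<bar>"
          using bd[of r t] t by (simp add: abs_divide divide_le_eq power2_eq_square abs_mult[symmetric] mult.assoc)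
      qed
    qed (auto intro!: tendsto_eq_intros)
    then show ?thesis by (simp add: has_field_derivative_iff)
  qed
  then obtain c where "\<And>t. t \<in> {0..1} \<Longrightarrow> g t = c"
    using has_field_derivative_zero_constant[of "{0..1}" g] by auto
  then show ?thesis by simp
qed

text \<open>Conformal invariance of the volume: along the path t \<xi> the volume changes at most
  quadratically in the step because its first variation is the integral of a divergence.\<close>

lemma (in conformal_factor) SI_volume:
  assumes m: "m > 0"
  shows "SI (P4 * (j * j)) = omega TYPE('a)"
proof -
  define N where "N = 4 * m + 4"
  define q where "q = \<xi> \<bullet> \<xi>"
  have q: "0 \<le> q" "q < 1" using norm_\<xi>_square by (simp_all add: q_def)
  have cf: "conformal_factor (t *\<^sub>R \<xi>) m" if "t \<in> {0..1}" for t
  proof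
    have "norm (t *\<^sub>R \<xi>) \<le> 1 * norm \<xi>" unfolding norm_scaleR using that by (intro mult_right_mono) auto
    then show "norm (t *\<^sub>R \<xi>) < 1" using \<xi> by simp
  qed (rule DIM_m)
  define T where "T t = conformal_factor.\<tau> (t *\<^sub>R \<xi>)" for t
  define a where "a t = sexp (cst (- N) * T t)" for t
  define g where "g t = SI (a t)" for t
  have qt: "1 - t\<^sup>2 * q \<ge> 1 - q" if "t \<in> {0..1}" for t
    using that q mult_right_mono[of "t\<^sup>2" 1 q] power_le_one[of t 2] by simp
  have evT: "ev (T t) z = ln (1 + t * (z \<bullet> \<xi>)) - ln (1 - t\<^sup>2 * q) / 2" if "t \<in> {0..1}" "z \<in> sphere 0 1" for t z
    unfolding T_def conformal_factor.ev_\<tau>[OF cf[OF that(1)] that(2)] by (simp add: q_def power2_eq_square mult.assoc)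
  have pz: "1 + t * (z \<bullet> \<xi>) > 0" if "t \<in> {0..1}" "z \<in> sphere 0 1" for t z
    using conformal_factor.one_plus_pos[OF cf[OF that(1)] that(2)] by simp
  have pz': "1 + t * (z \<bullet> \<xi>) \<ge> 1 - norm \<xi>" if "t \<in> {0..1}" "z \<in> sphere 0 1" for t z
  proof -
    have "t * norm \<xi> \<le> 1 * norm \<xi>" using that by (intro mult_right_mono) auto
    then show ?thesis using conformal_factor.one_plus_ge[OF cf[OF that(1)] that(2)] that by simp
  qed
  \<comment> \<open>Crude bound for the volume along the path: Om at the parameter t \<xi> is at
    least 1 - |\<xi>|, and the density is Om^(-N).\<close>
  define B where "B = exp (- N * ln (1 - norm \<xi>)) * omega TYPE('a)"
  have gB: "0 \<le> g t" "g t \<le> B" if t: "t \<in> {0..1}" for t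
  proof -
    have "SI (a t) \<le> SI (cst (exp (- N * ln (1 - norm \<xi>))) :: 'a sfun)"
    proof (rule SI_mono)
      fix z :: 'a assume z: "z \<in> sphere 0 1"
      have "ln (1 - norm \<xi>) \<le> ln (1 + t * (z \<bullet> \<xi>))" using pz'[OF t z] \<xi> by simp
      moreover have "ln (1 - t\<^sup>2 * q) \<le> 0" using qt[OF t] q by (intro ln_le_zero_iff[THEN iffD2]) auto
      ultimately have "N * ln (1 - norm \<xi>) \<le> N * ev (T t) z"
        unfolding evT[OF t z] using m by (intro mult_left_mono) (auto simp: N_def)
      then show "ev (a t) z \<le> ev (cst (exp (- N * ln (1 - norm \<xi>)))) z"
        by (simp add: a_def ev_sexp[OF z] ev_ring[OF z] ev_cst[OF z])
    qed
    then show "g t \<le> B" by (simp add: g_def SI_cst B_def)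
    show "0 \<le> g t" unfolding g_def a_def by (rule SI_nonneg) (simp add: ev_sexp)
  qed
  define C where "C = N * B * (2 / (1 - q)\<^sup>2)"
  have step: "g t - C * (r - t)\<^sup>2 \<le> g r" if r: "r \<in> {0..1}" and t: "t \<in> {0..1}" for r t
  proof -
    interpret t: conformal_factor "t *\<^sub>R \<xi>" m by (rule cf[OF t])
    define X where "X = a t * t.J * coord \<xi>"
    \<comment> \<open>Half of the tangent bound for the logarithm of (1 - t^2 q) / (1 - r^2 q). The
      denominator is taken at r, which changes it only to second order in r - t.\<close>
    define D where "D = (r\<^sup>2 - t\<^sup>2) * q / (2 * (1 - r\<^sup>2 * q))"
    have "SI (a t - cst N * (cst ((r - t) / t.s) * X + cst D * a t)) \<le> g r"
      unfolding g_def
    proof (rule SI_mono)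
      fix z :: 'a assume z: "z \<in> sphere 0 1"
      define x where "x = z \<bullet> \<xi>"
      have p: "1 + t * x > 0" "1 + r * x > 0" using pz[OF t z] pz[OF r z] by (simp_all add: x_def)
      have p2: "1 - t\<^sup>2 * q > 0" "1 - r\<^sup>2 * q > 0" using qt[OF t] qt[OF r] q by simp_all
      have "ln (1 + r * x) - ln (1 + t * x) \<le> (1 + r * x) / (1 + t * x) - 1"
        using ln_le_minus_one[of "(1 + r * x) / (1 + t * x)"] p by (simp add: ln_div)
      also have "\<dots> = (r - t) * x / (1 + t * x)" using p by (simp add: field_simps)
      finally have 1: "ln (1 + r * x) - ln (1 + t * x) \<le> (r - t) * x / (1 + t * x)" .
      have "ln (1 - t\<^sup>2 * q) - ln (1 - r\<^sup>2 * q) \<le> (1 - t\<^sup>2 * q) / (1 - r\<^sup>2 * q) - 1"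
        using ln_le_minus_one[of "(1 - t\<^sup>2 * q) / (1 - r\<^sup>2 * q)"] p2 by (simp add: ln_div)
      also have "\<dots> = 2 * D" using p2 by (simp add: D_def field_simps)
      finally have 2: "ev (T r) z - ev (T t) z \<le> (r - t) * x / (1 + t * x) + D"
        using 1 unfolding evT[OF t z] evT[OF r z] x_def[symmetric] by simp
      define A where "A = exp (- N * ev (T t) z)"
      have "A * (1 - N * ((r - t) * x / (1 + t * x) + D)) \<le> A * (1 + (- N * (ev (T r) z - ev (T t) z)))"
      proof (rule mult_left_mono)
        have "N * (ev (T r) z - ev (T t) z) \<le> N * ((r - t) * x / (1 + t * x) + D)"
          using 2 m by (intro mult_left_mono) (auto simp: N_def)
        then show "1 - N * ((r - t) * x / (1 + t * x) + D) \<le> 1 + (- N * (ev (T r) z - ev (T t) z))" by simp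
      qed (simp add: A_def)
      also have "\<dots> \<le> A * exp (- N * (ev (T r) z - ev (T t) z))"
        by (intro mult_left_mono exp_ge_add_one_self) (simp add: A_def)
      also have "\<dots> = exp (- N * ev (T r) z)"
        unfolding A_def exp_add[symmetric] by (simp add: algebra_simps)
      finally have 3: "A * (1 - N * ((r - t) * x / (1 + t * x) + D)) \<le> exp (- N * ev (T r) z)" .
      have J: "ev t.J z / t.s = 1 / (1 + t * x)" using t.ev_J_s[OF z] by (simp add: x_def)
      have ea: "ev (a t) z = A" by (simp add: a_def A_def ev_sexp[OF z] ev_ring[OF z] ev_cst[OF z])
      have "(r - t) / t.s * ev X z = A * ((r - t) * x) * (ev t.J z / t.s)"
        by (simp add: X_def ev_ring[OF z] ea ev_coord[OF z] x_def)
      then have "(r - t) / t.s * ev X z = A * ((r - t) * x / (1 + t * x))" unfolding J by simp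
      then have "ev (a t - cst N * (cst ((r - t) / t.s) * X + cst D * a t)) z = A * (1 - N * ((r - t) * x / (1 + t * x) + D))"
        unfolding ev_ring[OF z] ev_cst[OF z] ea by (simp add: algebra_simps)
      then show "ev (a t - cst N * (cst ((r - t) / t.s) * X + cst D * a t)) z \<le> ev (a r) z"
        using 3 by (simp add: a_def ev_sexp[OF z] ev_ring[OF z] ev_cst[OF z])
    qed
    \<comment> \<open>The volume density at t \<xi> satisfies the critical equation; direction \<xi>
      expresses SI X through g t.\<close>
    moreover have "SI X / t.s = - (t * q / (1 - t\<^sup>2 * q)) * g t"
    proof -
      have at: "t.P4 * (t.j * t.j) = a t" unfolding t.volume_density a_def N_def T_def ..
      have "t.s\<^sup>2 = 1 - t\<^sup>2 * q" using t.s_square by (simp add: q_def power2_eq_square)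
      moreover have "(t *\<^sub>R \<xi>) \<bullet> \<xi> = t * q" by (simp add: q_def)
      moreover have "SI X / t.s + ((t *\<^sub>R \<xi>) \<bullet> \<xi>) / t.s\<^sup>2 * SI (a t) = 0"
        using t.SI_conformal_volume_critical[of \<xi>] m unfolding at X_def by simp
      ultimately have "SI X / t.s + (t * q) / (1 - t\<^sup>2 * q) * SI (a t) = 0" by (simp only:)
      then show ?thesis by (simp add: g_def)
    qed
    ultimately have "g t - N * ((r - t) * (- (t * q / (1 - t\<^sup>2 * q)) * g t) + D * g t) \<le> g r"
      unfolding SI_linear SI_cst_mult SI_add times_divide_eq_left times_divide_eq_right[symmetric] by (simp only: g_def)
    \<comment> \<open>The first-order parts cancel, which leaves the factor (r - t)^2. Its
      coefficient is then at most 4 B / (2 (1 - q)^2), whence the constant C.\<close>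
    moreover have "(r - t) * (- (t * q / (1 - t\<^sup>2 * q)) * g t) + D * g t
        = g t * q * (1 + t * q * (2 * r + t)) / (2 * (1 - r\<^sup>2 * q) * (1 - t\<^sup>2 * q)) * (r - t)\<^sup>2"
    proof -
      have "1 - t\<^sup>2 * q \<noteq> 0" "1 - r\<^sup>2 * q \<noteq> 0" using qt[OF t] qt[OF r] q by auto
      then show ?thesis unfolding D_def by (simp add: divide_simps) (simp add: algebra_simps power2_eq_square)
    qed
    moreover have "g t * q * (1 + t * q * (2 * r + t)) / (2 * (1 - r\<^sup>2 * q) * (1 - t\<^sup>2 * q)) \<le> B * (2 / (1 - q)\<^sup>2)"
    proof -
      have "t * q * (2 * r + t) \<le> 1 * 3"
        using r t q by (intro mult_mono mult_le_one) auto
      then have "(g t * q) * (1 + t * q * (2 * r + t)) \<le> (B * 1) * 4"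
        using gB[OF t] r t q by (intro mult_mono add_nonneg_nonneg mult_nonneg_nonneg) auto
      moreover have "2 * (1 - q)\<^sup>2 \<le> 2 * (1 - r\<^sup>2 * q) * (1 - t\<^sup>2 * q)"
      proof -
        have "(1 - q) * (1 - q) \<le> (1 - r\<^sup>2 * q) * (1 - t\<^sup>2 * q)"
          using qt[OF r] qt[OF t] q by (intro mult_mono) auto
        then show ?thesis by (simp only: power2_eq_square[of "1 - q"] mult.assoc)
      qed
      ultimately have "g t * q * (1 + t * q * (2 * r + t)) / (2 * (1 - r\<^sup>2 * q) * (1 - t\<^sup>2 * q)) \<le> B * 4 / (2 * (1 - q)\<^sup>2)"
        using gB[OF t] q by (intro frac_le) auto
      then show ?thesis by (simp add: mult.commute[of B])
    qed
    then have "N * (g t * q * (1 + t * q * (2 * r + t)) / (2 * (1 - r\<^sup>2 * q) * (1 - t\<^sup>2 * q)) * (r - t)\<^sup>2)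
        \<le> N * (B * (2 / (1 - q)\<^sup>2) * (r - t)\<^sup>2)"
      using m by (intro mult_left_mono mult_right_mono) (auto simp: N_def)
    ultimately show ?thesis by (simp add: C_def)
  qed
  have "g 0 = g 1" by (rule quadratic_bound_imp_constant[OF step])
  moreover have "a 0 = 1"
  proof (rule sfun_eqI)
    fix z :: 'a assume z: "z \<in> sphere 0 1"
    show "ev (a 0) z = ev 1 z" using evT[OF _ z, of 0] by (simp add: a_def ev_sexp[OF z] ev_ring[OF z])
  qed
  moreover have "a 1 = P4 * (j * j)"
    unfolding volume_density a_def N_def T_def by simp
  ultimately show ?thesis by (simp add: g_def SI_1)
qed

section \<open>Local minimizers\<close>

lemma pos_on_lower_bound:
  assumes "pos_on f"
  obtains \<delta> where "\<delta> > 0" "\<And>z. z \<in> sphere 0 1 \<Longrightarrow> ev f z \<ge> \<delta>"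
proof -
  have "sphere 0 1 \<noteq> ({} :: 'a set)" using sphere_nonempty by blast
  then obtain z0 where "z0 \<in> sphere 0 1" "\<And>z. z \<in> sphere 0 1 \<Longrightarrow> ev f z0 \<le> ev f z"
    using continuous_attains_inf[OF compact_sphere _ smooth_sphere_continuous[OF smooth_ev[of f]]] by metis
  then show thesis using assms by (intro that[of "ev f z0"]) (auto simp: pos_on_def)
qed

section \<open>Scaling and expansion rules, and membership in the constraint set\<close>

lemma Rf_add:
  assumes "m \<noteq> 0"
  shows "Rf m (f + cst t * g) = Rf m f + cst t * (cst (2 * (4 * m + 4)) * f * g
    - cst (2 / m) * (f * Lp g + g * Lp f + cst (2 * ((m + 1) / m)) * Gm f g)) + cst (t\<^sup>2) * Rf m g"
  unfolding Rf_def Lp_rules Gm_left Gm_right Gm_commute[of g f]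
  by (rule sfun_eqI, simp only: ev_ring ev_cst, simp add: assms field_simps power2_eq_square)

lemma Rf_scale: "Rf m (cst c * f) = cst (c\<^sup>2) * Rf m f"
  unfolding Rf_def Lp_rules Gm_left Gm_right
  by (rule sfun_eqI, simp only: ev_ring ev_cst, simp add: algebra_simps power2_eq_square)

lemma EE_scale: "EE (cst c * f) = c ^ 4 * EE f"
proof -
  have "Gm (cst c * f) (cst c * f) = cst (c * c) * Gm f f" "Lp (cst c * f) = cst c * Lp f"
    unfolding Lp_rules Gm_left Gm_right by (simp_all add: cst_hom algebra_simps)
  then show ?thesis
    unfolding EE_def Let_def SI_cst_mult[symmetric]
    by (intro arg_cong[of _ _ SI] sfun_eqI) (simp add: ev_ring ev_cst algebra_simps power4_eq_xxxx)
qed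

lemma powr_eq_ev: "pos_on W \<Longrightarrow> z \<in> sphere 0 1 \<Longrightarrow> ev W z powr a = ev (sexp (cst a * sln W)) z"
proof -
  assume W: "pos_on W" and z: "z \<in> sphere 0 1"
  have "ev W z > 0" using W z unfolding pos_on_def by blast
  then show ?thesis by (simp add: powr_def ev_sexp[OF z] ev_ring[OF z] ev_cst[OF z] ev_sln[OF W z])
qed

text \<open>In terms of lw = ln W both sides are positive multiples of 4m + 4 - (2/m)(Lp lw + a Gm
  lw lw), where a = (2m+1)/m is the exponent 2(n-2)/(n-4).\<close>

lemma scal_conf_pos_iff:
  fixes W :: "'a::euclidean_space sfun"
  assumes W: "pos_on W" and m: "m > 0" and dim: "real DIM('a) = 4 * m + 5" and z: "z \<in> sphere 0 1"
  shows "scal_conf (ev W) z > 0 \<longleftrightarrow> ev (Rf m W) z > 0"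
proof -
  define lw where "lw = sln W"
  define a where "a = (2 * m + 1) / m"
  define l g w where "l = ev (Lp lw) z" and "g = ev (Gm lw lw) z" and "w = ev W z"
  have w: "w > 0" using W z by (auto simp: w_def pos_on_def)
  have We: "W = sexp lw" unfolding lw_def by (rule sexp_sln[OF W, symmetric])
  have n: "dimn TYPE('a) = 4 * m + 4" using dim by (simp add: dimn_def)
  have a: "2 * (4 * m + 4 - 2) / (4 * m + 4 - 4) = a" using m by (simp add: a_def field_simps)
  have V: "slap (\<lambda>x. ev W x powr a) z = w powr a * (a * l + a\<^sup>2 * g)"
  proof -
    have "slap (\<lambda>x. ev W x powr a) z = slap (ev (sexp (cst a * lw))) z"
      unfolding lw_def by (rule slap_cong[OF powr_eq_ev[OF W] z])
    also have "\<dots> = ev (Lp (sexp (cst a * lw))) z" by (simp only: ev_Lp[OF z])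
    also have "\<dots> = w powr a * (a * l + a\<^sup>2 * g)"
      unfolding Lp_rules Gm_left Gm_right ev_ring[OF z] ev_cst[OF z] w_def powr_eq_ev[OF W z] lw_def[symmetric]
      by (simp add: l_def g_def algebra_simps power2_eq_square)
    finally show ?thesis .
  qed
  have "scal_conf (ev W) z = (w powr a) powr (- (4 * m + 6) / (4 * m + 2)) *
      ((4 * m + 4) * (4 * m + 3) * w powr a - 4 * (4 * m + 3) / (4 * m + 2) * (w powr a * (a * l + a\<^sup>2 * g)))"
    unfolding scal_conf_def Let_def n a V w_def[symmetric] by (simp add: algebra_simps)
  also have "\<dots> = (w powr a) powr (- (4 * m + 6) / (4 * m + 2)) * w powr a * (4 * m + 3) *
      ((4 * m + 4) - 2 / m * (l + a * g))"
  proof -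
    have "4 / (4 * m + 2) * a = 2 / m"
    proof -
      have "4 / (2 * b) * (b / m) = 2 / m" if "b > 0" for b using that by simp
      from this[of "2 * m + 1"] have "4 / (2 * (2 * m + 1)) * ((2 * m + 1) / m) = 2 / m" using m by simp
      moreover have "2 * (2 * m + 1) = 4 * m + 2" by simp
      ultimately show ?thesis by (simp only: a_def)
    qed
    then have "4 * (4 * m + 3) / (4 * m + 2) * (w powr a * (a * l + a\<^sup>2 * g)) = (4 * m + 3) * w powr a * (2 / m * (l + a * g))"
    proof -
      have "4 * (4 * m + 3) / (4 * m + 2) * (w powr a * (a * l + a\<^sup>2 * g))
          = (4 * m + 3) * w powr a * ((4 / (4 * m + 2) * a) * (l + a * g))"
      proof -
        have "4 * (4 * m + 3) * i * (v * (a * l + a\<^sup>2 * g)) = (4 * m + 3) * v * ((4 * i * a) * (l + a * g))" for i v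
          by (simp add: algebra_simps power2_eq_square)
        from this[of "inverse (4 * m + 2)" "w powr a"] show ?thesis by (simp only: divide_inverse)
      qed
      then show ?thesis unfolding \<open>4 / (4 * m + 2) * a = 2 / m\<close> .
    qed
    then show ?thesis by (simp add: algebra_simps)
  qed
  finally have sc: "scal_conf (ev W) z = (w powr a) powr (- (4 * m + 6) / (4 * m + 2)) * w powr a * (4 * m + 3) *
      ((4 * m + 4) - 2 / m * (l + a * g))" .
  have gen: "0 < x * d \<longleftrightarrow> 0 < d" if "x > 0" for x d :: real
    using that by (simp add: zero_less_mult_iff)
  have "(w powr a) powr (- (4 * m + 6) / (4 * m + 2)) * w powr a * (4 * m + 3) > 0"
    using m w by (intro mult_pos_pos) auto
  then have "scal_conf (ev W) z > 0 \<longleftrightarrow> (4 * m + 4) - 2 / m * (l + a * g) > 0"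
    unfolding sc by (rule gen)
  moreover have "ev (Rf m W) z = w * w * ((4 * m + 4) - 2 / m * (l + a * g))"
  proof -
    have "ev (sexp lw) z = w" by (simp add: We w_def)
    then show ?thesis
      unfolding We Rf_def Lp_rules Gm_left Gm_right ev_ring[OF z] ev_cst[OF z] l_def[symmetric] g_def[symmetric]
      using m by (simp add: a_def field_simps)
  qed
  ultimately show ?thesis using w by (simp add: zero_less_mult_iff)
qed

lemma scal_conf_cong:
  assumes "\<And>z. z \<in> sphere 0 1 \<Longrightarrow> u z = v z" "z \<in> sphere 0 1"
  shows "scal_conf u z = scal_conf v z"
proof -
  have "slap (\<lambda>x. u x powr a) z = slap (\<lambda>x. v x powr a) z" for a
    by (rule slap_cong[OF _ assms(2)]) (simp add: assms(1))
  moreover have "u z = v z" using assms by blast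
  ultimately show ?thesis by (simp add: scal_conf_def Let_def)
qed

lemma V14_ev_iff:
  fixes W :: "'a::euclidean_space sfun"
  assumes W: "pos_on W" and m: "m > 0" and dim: "real DIM('a) = 4 * m + 5"
  shows "ev W \<in> V14 \<longleftrightarrow> SI (sexp (cst ((4 * m + 4) / m) * sln W)) = omega TYPE('a) \<and> pos_on (Rf m W)"
proof -
  have p: "4 * dimn TYPE('a) / (dimn TYPE('a) - 4) = (4 * m + 4) / m"
    using dim m by (simp add: dimn_def field_simps)
  have "sint (\<lambda>z. ev W z powr ((4 * m + 4) / m)) = SI (sexp (cst ((4 * m + 4) / m) * sln W))"
    unfolding SI_def by (rule sint_cong[OF powr_eq_ev[OF W]])
  moreover have "(\<forall>z\<in>sphere 0 1. scal_conf (ev W) z > 0) \<longleftrightarrow> pos_on (Rf m W)"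
    using scal_conf_pos_iff[OF W m dim] by (simp add: pos_on_def)
  ultimately show ?thesis using W unfolding V14_def p by (auto simp: smooth_ev pos_on_def)
qed

lemma V14_toS:
  assumes "u \<in> V14"
  shows "ev (toS u) \<in> V14" "pos_on (toS u)" "smooth_sphere u"
proof -
  show s: "smooth_sphere u" using assms by (simp add: V14_def)
  have eq: "ev (toS u) z = u z" if "z \<in> sphere 0 1" for z using ev_toS[OF s that] .
  show "pos_on (toS u)" using assms eq by (auto simp: V14_def pos_on_def)
  show "ev (toS u) \<in> V14"
    using assms scal_conf_cong[of "ev (toS u)" u, OF eq]
      sint_cong[of "\<lambda>z. ev (toS u) z powr (4 * dimn TYPE('a) / (dimn TYPE('a) - 4))" "\<lambda>z. u z powr (4 * dimn TYPE('a) / (dimn TYPE('a) - 4))"]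
    by (auto simp: V14_def smooth_ev eq)
qed

section \<open>Higher derivatives of extensions and closeness in C^k\<close>

lemma smooth_on_pdl: "smooth_on S f \<Longrightarrow> set bs \<subseteq> Basis \<Longrightarrow> smooth_on S (pdl bs f)"
  by (induction bs) (auto intro: smooth_on_pd1)

lemma pdl_cong:
  assumes "open S" "\<And>y. y \<in> S \<Longrightarrow> f y = g y"
  shows "x \<in> S \<Longrightarrow> pdl bs f x = pdl bs g x"
proof (induction bs arbitrary: x)
  case (Cons b bs)
  show ?case unfolding pdl.simps by (rule pd1_cong[OF assms(1) Cons.prems Cons.IH])
qed (use assms in simp)

lemma pdl_lincomb:
  assumes S: "open S" and f: "smooth_on S f" and g: "smooth_on S g" and bs: "set bs \<subseteq> Basis"
  shows "x \<in> S \<Longrightarrow> pdl bs (\<lambda>x. a * f x + c * g x) x = a * pdl bs f x + c * pdl bs g x"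
  using bs
proof (induction bs arbitrary: x)
  case (Cons b bs)
  then have b: "b \<in> Basis" "set bs \<subseteq> Basis" by auto
  note sm = smooth_on_pdl[OF f b(2)] smooth_on_pdl[OF g b(2)]
  have "pdl (b # bs) (\<lambda>x. a * f x + c * g x) x = pd1 b (\<lambda>x. a * pdl bs f x + c * pdl bs g x) x"
    unfolding pdl.simps by (rule pd1_cong[OF S Cons.prems(1) Cons.IH[OF _ b(2)]])
  also have "\<dots> = a * pd1 b (pdl bs f) x + c * pd1 b (pdl bs g) x"
    using pd1_add[OF smooth_on_mult[OF S smooth_on_const[OF S] sm(1)] smooth_on_mult[OF S smooth_on_const[OF S] sm(2)] Cons.prems(1) b(1)]
      pd1_mult[OF smooth_on_const[OF S] sm(1) Cons.prems(1) b(1)] pd1_mult[OF smooth_on_const[OF S] sm(2) Cons.prems(1) b(1)]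
    by simp
  finally show ?case by simp
qed simp

text \<open>Only finitely many derivative words have length at most k, and each derivative is
  continuous on the compact sphere. Hence small multiples of a fixed function are small in
  C^k.\<close>

lemma pdl_hext_bounded:
  assumes "smooth_sphere f"
  shows "\<exists>M>0. \<forall>bs. set bs \<subseteq> Basis \<and> length bs \<le> k \<longrightarrow> (\<forall>z\<in>sphere 0 1. \<bar>pdl bs (hext f) z\<bar> \<le> M)"
proof -
  define B where "B = {bs :: 'a list. set bs \<subseteq> Basis \<and> length bs \<le> k}"
  have fin: "finite B" unfolding B_def by (rule finite_lists_length_le[OF finite_Basis])
  have "\<exists>M>0. \<forall>z\<in>sphere 0 1. \<bar>pdl bs (hext f) z\<bar> \<le> M" if "bs \<in> B" for bs
  proof -
    have "continuous_on (sphere 0 1) (pdl bs (hext f))"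
      using smooth_on_continuous[OF smooth_on_pdl[OF smooth_sphereD[OF assms]], of bs] that
      by (rule_tac continuous_on_subset[of "- {0}"]) (auto simp: B_def)
    then have "bounded (pdl bs (hext f) ` sphere 0 1)"
      by (intro compact_imp_bounded compact_continuous_image compact_sphere)
    then show ?thesis unfolding bounded_pos by auto
  qed
  then obtain M where M: "\<And>bs. bs \<in> B \<Longrightarrow> M bs > 0 \<and> (\<forall>z\<in>sphere 0 1. \<bar>pdl bs (hext f) z\<bar> \<le> M bs)"
    by metis
  have nn: "M bs \<ge> 0" if "bs \<in> B" for bs using M[OF that] by simp
  define R where "R = sum M B + 1"
  have R: "R > 0" unfolding R_def using sum_nonneg[of B M, OF nn] by simp
  have "\<bar>pdl bs (hext f) z\<bar> \<le> R" if "bs \<in> B" "z \<in> sphere 0 1" for bs z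
  proof -
    have "\<bar>pdl bs (hext f) z\<bar> \<le> M bs" using M[OF that(1)] that(2) by blast
    also have "M bs \<le> sum M B" by (rule member_le_sum[OF that(1) _ fin]) (use nn in auto)
    finally show ?thesis by (simp add: R_def)
  qed
  then show ?thesis using R unfolding B_def by blast
qed

text \<open>The first-order expansion of the power p - 1, integrated by the mean value inequality on
  the segment from 0 to s. The bound 1/2 on \<delta> keeps 1 + s positive.\<close>

lemma powr_second_order:
  fixes p :: real
  assumes e: "e > 0"
  shows "\<exists>\<delta>>0. \<delta> \<le> 1/2 \<and> (\<forall>s. \<bar>s\<bar> < \<delta> \<longrightarrow> \<bar>(1 + s) powr p - 1 - p * s - p * (p - 1) / 2 * s\<^sup>2\<bar> \<le> e * s\<^sup>2)"
proof -
  define e' where "e' = e / (\<bar>p\<bar> + 1)"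
  have e': "e' > 0" using e by (simp add: e'_def add_nonneg_pos)
  have "((\<lambda>s. (1 + s) powr (p - 1)) has_real_derivative (p - 1)) (at 0)"
    by (auto intro!: derivative_eq_intros)
  then have "((\<lambda>s. (1 + s) powr (p - 1)) has_derivative (\<lambda>h. (p - 1) * h)) (at 0)"
    by (simp add: has_field_derivative_def)
  then obtain d where d: "d > 0" "\<And>s. \<bar>s\<bar> < d \<Longrightarrow> \<bar>(1 + s) powr (p - 1) - 1 - (p - 1) * s\<bar> \<le> e' * \<bar>s\<bar>"
    unfolding has_derivative_at_alt using e' by (auto simp: dist_norm)
  define \<delta> where "\<delta> = min d (1/2)"
  have "\<bar>(1 + s) powr p - 1 - p * s - p * (p - 1) / 2 * s\<^sup>2\<bar> \<le> e * s\<^sup>2" if s: "\<bar>s\<bar> < \<delta>" for s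
  proof -
    define f where "f x = (1 + x) powr p - 1 - p * x - p * (p - 1) / 2 * x\<^sup>2" for x
    have seg: "\<bar>x\<bar> \<le> \<bar>s\<bar>" if "x \<in> closed_segment 0 s" for x
      using that by (auto simp: closed_segment_eq_real_ivl split: if_splits)
    have "norm (f s - f 0) \<le> (\<bar>p\<bar> * e' * \<bar>s\<bar>) * norm (s - 0)"
    proof (rule field_differentiable_bound[where S = "closed_segment 0 s"])
      show "(f has_field_derivative p * ((1 + x) powr (p - 1) - 1 - (p - 1) * x)) (at x within closed_segment 0 s)"
        if "x \<in> closed_segment 0 s" for x
        unfolding f_def[abs_def] using seg[OF that] s
        by (auto intro!: derivative_eq_intros simp: \<delta>_def field_simps)
      show "norm (p * ((1 + x) powr (p - 1) - 1 - (p - 1) * x)) \<le> \<bar>p\<bar> * e' * \<bar>s\<bar>"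
        if "x \<in> closed_segment 0 s" for x
      proof -
        have "\<bar>(1 + x) powr (p - 1) - 1 - (p - 1) * x\<bar> \<le> e' * \<bar>x\<bar>"
          using d(2) seg[OF that] s by (simp add: \<delta>_def)
        also have "\<dots> \<le> e' * \<bar>s\<bar>" using seg[OF that] e' by (intro mult_left_mono) auto
        finally show ?thesis unfolding real_norm_def abs_mult mult.assoc by (rule mult_left_mono) simp
      qed
    qed auto
    then have "\<bar>f s\<bar> \<le> \<bar>p\<bar> * e' * s\<^sup>2" by (simp add: f_def power2_eq_square mult.assoc abs_mult[symmetric])
    also have "\<dots> \<le> e * s\<^sup>2"
    proof (rule mult_right_mono)
      have "\<bar>p\<bar> * e \<le> (\<bar>p\<bar> + 1) * e" using e by simp
      then show "\<bar>p\<bar> * e' \<le> e" by (simp add: e'_def divide_le_eq add_nonneg_pos mult.commute)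
    qed simp
    finally show ?thesis by (simp add: f_def)
  qed
  then show ?thesis using d(1) by (intro exI[of _ \<delta>]) (auto simp: \<delta>_def)
qed

lemma filterlim_uminus_at_0: "filterlim (\<lambda>t. - t) (at 0) (at (0::real))"
  unfolding filterlim_at by (auto intro!: tendsto_eq_intros simp: eventually_at_filter)

text \<open>The line U + t U y is rescaled by \<kappa> t to satisfy the constraint. Balancing
  removes the linear term of the constraint integral N, whose quadratic coefficient is p (p-1) / 2
  times SI (\<rho> y^2). The energy has degree four, so \<kappa>^(-4) = (N / \<omega>)^(4/p) turns
  this into the factor 2 (p-1) = 6 + 8/m.\<close>

lemma constrained_second_variation:
  fixes u :: "'a::euclidean_space \<Rightarrow> real"
  assumes min: "local_min_V14 u" and m: "m > 0" and dim: "real DIM('a) = 4 * m + 5"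
  defines "U \<equiv> toS u"
  defines "\<rho> \<equiv> sexp (cst ((4 * m + 4) / m) * sln U)"
  assumes bal: "SI (\<rho> * y) = 0"
    and expand: "\<And>t. EE (U + cst t * (U * y)) = e0 + a1 * t + a2 * t\<^sup>2 + a3 * t ^ 3 + a4 * t ^ 4"
  shows "a2 \<ge> (6 + 8 / m) * e0 * SI (\<rho> * (y * y)) / omega TYPE('a)"
proof -
  define p where "p = (4 * m + 4) / m"
  have p: "p > 0" using m by (simp add: p_def)
  define \<omega> where "\<omega> = omega TYPE('a)"
  have \<omega>: "\<omega> > 0" unfolding \<omega>_def by (rule omega_pos)
  have uV: "u \<in> V14" using min by (simp add: local_min_V14_def)
  have U: "pos_on U" and UV: "ev U \<in> V14" and us: "smooth_sphere u"
    using V14_toS[OF uV] by (simp_all add: U_def)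
  have U\<omega>: "SI \<rho> = \<omega>" and RU: "pos_on (Rf m U)"
    using V14_ev_iff[OF U m dim] UV by (simp_all add: \<rho>_def \<omega>_def)
  have \<rho>: "pos_on \<rho>" unfolding \<rho>_def by (rule pos_sexp)
  have \<rho>z: "ev \<rho> z > 0" if "z \<in> sphere 0 1" for z using \<rho> that unfolding pos_on_def by blast
  have Uz: "ev U z > 0" if "z \<in> sphere 0 1" for z using U that unfolding pos_on_def by blast
  obtain M where M: "M > 0" "\<And>z. z \<in> sphere 0 1 \<Longrightarrow> \<bar>ev y z\<bar> \<le> M" using ev_bounded[of y] by blast
  define f where "f t = 1 + cst t * y" for t
  have evf: "ev (f t) z = 1 + t * ev y z" if "z \<in> sphere 0 1" for t z
    by (simp add: f_def ev_ring[OF that] ev_cst[OF that])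
  have ty: "\<bar>t * ev y z\<bar> < \<delta>" if "\<bar>t\<bar> < \<delta> / M" "z \<in> sphere 0 1" for t z \<delta>
  proof -
    have "\<bar>t * ev y z\<bar> \<le> \<bar>t\<bar> * M" unfolding abs_mult using M(2)[OF that(2)] by (intro mult_left_mono) auto
    also have "\<dots> < \<delta>" using that(1) M(1) by (simp add: pos_less_divide_eq)
    finally show ?thesis .
  qed
  have f_pos: "pos_on (f t)" if "\<bar>t\<bar> < (1/2) / M" for t
    unfolding pos_on_def
  proof
    fix z :: 'a assume z: "z \<in> sphere 0 1"
    show "ev (f t) z > 0" using ty[OF that z] unfolding evf[OF z] by linarith
  qed
  define N where "N t = SI (\<rho> * sexp (cst p * sln (f t)))" for t
  define S where "S = SI (\<rho> * (y * y))"
  have S: "S \<ge> 0" unfolding S_def by (rule SI_nonneg) (use \<rho>z in \<open>simp add: ev_ring less_imp_le\<close>)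
  define A where "A = p * (p - 1) / 2 * S"
  have N_expand: "((\<lambda>t. (N t - \<omega>) / t\<^sup>2) \<longlongrightarrow> A) (at 0)"
  proof (rule tendstoI)
    fix e :: real assume e: "e > 0"
    \<comment> \<open>S + 1 instead of S, because only S \<ge> 0 is known.\<close>
    define e' where "e' = e / (2 * (S + 1))"
    have e': "e' > 0" "e' * S < e"
    proof -
      show "e' > 0" using e S by (simp add: e'_def)
      have "e * S < e * (2 * (S + 1))" using e S by (intro mult_strict_left_mono) auto
      then show "e' * S < e" using S by (simp add: e'_def pos_divide_less_eq)
    qed
    obtain \<delta> where \<delta>: "\<delta> > 0" "\<delta> \<le> 1/2"
      "\<And>s. \<bar>s\<bar> < \<delta> \<Longrightarrow> \<bar>(1 + s) powr p - 1 - p * s - p * (p - 1) / 2 * s\<^sup>2\<bar> \<le> e' * s\<^sup>2"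
      using powr_second_order[OF e'(1), of p] by blast
    have main: "\<bar>N t - \<omega> - A * t\<^sup>2\<bar> \<le> e' * S * t\<^sup>2" if t: "\<bar>t\<bar> < \<delta> / M" for t
    proof -
      have t2: "\<bar>t\<bar> < (1/2) / M" using t \<delta>(2) M(1) by (meson divide_right_mono less_imp_le less_le_trans)
      define Q where "Q = \<rho> + cst (p * t) * (\<rho> * y) + cst (p * (p - 1) / 2 * t\<^sup>2) * (\<rho> * (y * y))"
      have pt: "\<bar>ev (\<rho> * sexp (cst p * sln (f t))) z - ev Q z\<bar> \<le> e' * t\<^sup>2 * ev (\<rho> * (y * y)) z"
        if z: "z \<in> sphere 0 1" for z
      proof -
        define s where "s = t * ev y z"
        have "ev (sexp (cst p * sln (f t))) z = (1 + s) powr p"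
          unfolding powr_eq_ev[OF f_pos[OF t2] z, symmetric] evf[OF z] s_def ..
        then have "ev (\<rho> * sexp (cst p * sln (f t))) z - ev Q z
            = ev \<rho> z * ((1 + s) powr p - 1 - p * s - p * (p - 1) / 2 * s\<^sup>2)"
          unfolding Q_def ev_ring[OF z] ev_cst[OF z] by (simp add: s_def algebra_simps power2_eq_square)
        also have "\<bar>\<dots>\<bar> \<le> ev \<rho> z * (e' * s\<^sup>2)"
          unfolding abs_mult using \<rho>z[OF z] \<delta>(3)[of s] ty[OF t z] by (auto simp: s_def intro!: mult_left_mono)
        finally show ?thesis by (simp add: ev_ring[OF z] s_def power2_eq_square mult_ac)
      qed
      have SQ: "SI Q = \<omega> + A * t\<^sup>2"
        unfolding Q_def SI_add SI_cst_mult U\<omega> bal A_def S_def by simp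
      have "N t - SI Q \<le> e' * t\<^sup>2 * S"
        unfolding N_def S_def SI_linear(2)[symmetric] SI_cst_mult[symmetric]
        by (rule SI_mono) (use pt in \<open>force simp: ev_ring(4) ev_ring(2)[of _ "cst (e' * t\<^sup>2)"] ev_cst\<close>)
      moreover have "SI Q - N t \<le> e' * t\<^sup>2 * S"
        unfolding N_def S_def SI_linear(2)[symmetric] SI_cst_mult[symmetric]
        by (rule SI_mono) (use pt in \<open>force simp: ev_ring(4) ev_ring(2)[of _ "cst (e' * t\<^sup>2)"] ev_cst\<close>)
      ultimately show ?thesis unfolding SQ by (simp add: abs_le_iff mult_ac)
    qed
    have "\<bar>(N t - \<omega>) / t\<^sup>2 - A\<bar> < e" if t: "t \<noteq> 0" "\<bar>t\<bar> < \<delta> / M" for t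
    proof -
      have "(N t - \<omega>) / t\<^sup>2 - A = (N t - \<omega> - A * t\<^sup>2) / t\<^sup>2" using t by (simp add: field_simps)
      then have "\<bar>(N t - \<omega>) / t\<^sup>2 - A\<bar> = \<bar>N t - \<omega> - A * t\<^sup>2\<bar> / t\<^sup>2" by simp
      also have "\<dots> \<le> e' * S" using main[OF t(2)] t by (simp add: pos_divide_le_eq)
      finally show ?thesis using e' by simp
    qed
    then show "\<forall>\<^sub>F t in at 0. dist ((N t - \<omega>) / t\<^sup>2) A < e"
      unfolding eventually_at using \<delta>(1) M(1) by (intro exI[of _ "\<delta> / M"]) (auto simp: dist_real_def)
  qed
  have N_lim: "(N \<longlongrightarrow> \<omega>) (at 0)"
  proof -
    have "((\<lambda>t. \<omega> + t\<^sup>2 * ((N t - \<omega>) / t\<^sup>2)) \<longlongrightarrow> \<omega> + 0\<^sup>2 * A) (at 0)"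
      by (intro tendsto_intros N_expand)
    moreover have "\<forall>\<^sub>F t in at 0. \<omega> + t\<^sup>2 * ((N t - \<omega>) / t\<^sup>2) = N t"
      by (auto simp: eventually_at_filter)
    ultimately show ?thesis using Lim_transform_eventually by fastforce
  qed
  \<comment> \<open>Rescaling by \<kappa> multiplies the constraint integral by \<kappa>^p, so this
    value restores \<omega>.\<close>
  define \<kappa> where "\<kappa> t = (\<omega> / N t) powr (1 / p)" for t
  have \<kappa>_lim: "(\<kappa> \<longlongrightarrow> 1) (at 0)"
  proof -
    have "(\<kappa> \<longlongrightarrow> (\<omega> / \<omega>) powr (1 / p)) (at 0)"
      unfolding \<kappa>_def using \<omega> by (intro tendsto_intros N_lim) auto
    then show ?thesis using \<omega> by simp
  qed
  define W where "W t = cst (\<kappa> t) * (U + cst t * (U * y))" for t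
  have Wf: "W t = cst (\<kappa> t) * (U * f t)" for t by (simp add: W_def f_def algebra_simps)
  have small: "\<forall>\<^sub>F t in at (0::real). \<bar>t\<bar> < (1/2) / M"
    unfolding eventually_at using M(1) by (intro exI[of _ "(1/2) / M"]) (auto simp: dist_real_def)
  have N_pos: "\<forall>\<^sub>F t in at 0. N t > 0"
    using order_tendstoD(1)[OF N_lim \<omega>] .
  \<comment> \<open>Positive scalar curvature persists: \<open>Rf\<close> is a quadratic form, so
    along the line it is a quadratic polynomial in t with bounded coefficients whose constant term
    has a positive minimum.\<close>
  have W_R: "\<forall>\<^sub>F t in at 0. pos_on (Rf m (W t))"
  proof -
    define X where "X = cst (2 * (4 * m + 4)) * U * (U * y)
      - cst (2 / m) * (U * Lp (U * y) + (U * y) * Lp U + cst (2 * ((m + 1) / m)) * Gm U (U * y))"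
    define Y where "Y = Rf m (U * y)"
    have RW: "Rf m (W t) = cst ((\<kappa> t)\<^sup>2) * (Rf m U + cst t * X + cst (t\<^sup>2) * Y)" for t
      unfolding W_def Rf_scale Rf_add[OF less_imp_neq[OF m, symmetric]] X_def Y_def ..
    obtain d where d: "d > 0" "\<And>z. z \<in> sphere 0 1 \<Longrightarrow> ev (Rf m U) z \<ge> d"
      using pos_on_lower_bound[OF RU] by blast
    obtain MX where MX: "MX > 0" "\<And>z. z \<in> sphere 0 1 \<Longrightarrow> \<bar>ev X z\<bar> \<le> MX" using ev_bounded[of X] by blast
    obtain MY where MY: "MY > 0" "\<And>z. z \<in> sphere 0 1 \<Longrightarrow> \<bar>ev Y z\<bar> \<le> MY" using ev_bounded[of Y] by blast
    have "((\<lambda>t. d - \<bar>t\<bar> * MX - t\<^sup>2 * MY) \<longlongrightarrow> d - \<bar>0\<bar> * MX - 0\<^sup>2 * MY) (at 0)"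
      by (intro tendsto_intros)
    then have "\<forall>\<^sub>F t in at 0. d - \<bar>t\<bar> * MX - t\<^sup>2 * MY > 0"
      using d(1) by (intro order_tendstoD(1)) auto
    moreover have "\<forall>\<^sub>F t in at 0. \<kappa> t > 0" using order_tendstoD(1)[OF \<kappa>_lim] by simp
    ultimately show ?thesis
    proof eventually_elim
      case (elim t)
      show ?case unfolding pos_on_def
      proof
        fix z :: 'a assume z: "z \<in> sphere 0 1"
        have "\<bar>t * ev X z\<bar> \<le> \<bar>t\<bar> * MX" unfolding abs_mult using MX(2)[OF z] by (intro mult_left_mono) auto
        moreover have "\<bar>t\<^sup>2 * ev Y z\<bar> \<le> t\<^sup>2 * MY" unfolding abs_mult using MY(2)[OF z] by (intro mult_mono) auto
        ultimately have "ev (Rf m U) z + t * ev X z + t\<^sup>2 * ev Y z > 0" using d(2)[OF z] elim(1) by linarith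
        then show "ev (Rf m (W t)) z > 0"
          unfolding RW ev_ring[OF z] ev_cst[OF z] using elim(2) by simp
      qed
    qed
  qed
  have W_V14: "\<forall>\<^sub>F t in at 0. ev (W t) \<in> V14"
    using small N_pos W_R
  proof eventually_elim
    case (elim t)
    have \<kappa>: "\<kappa> t > 0" using elim \<omega> by (simp add: \<kappa>_def)
    have fz: "ev (f t) z > 0" if "z \<in> sphere 0 1" for z using f_pos[OF elim(1)] that unfolding pos_on_def by blast
    have W: "pos_on (W t)"
      unfolding pos_on_def Wf using \<kappa> fz Uz by (auto simp: ev_ring ev_cst)
    have "sexp (cst p * sln (W t)) = cst (\<omega> / N t) * (\<rho> * sexp (cst p * sln (f t)))"
    proof (rule sfun_eqI)
      fix z :: 'a assume z: "z \<in> sphere 0 1"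
      have "ev (sexp (cst p * sln (W t))) z = (\<kappa> t * (ev U z * ev (f t) z)) powr p"
        unfolding powr_eq_ev[OF W z, symmetric] unfolding Wf ev_ring[OF z] ev_cst[OF z] ..
      also have "\<dots> = \<kappa> t powr p * (ev U z powr p * ev (f t) z powr p)"
        using \<kappa> fz[OF z] Uz[OF z] by (simp add: powr_mult less_imp_le)
      also have "\<kappa> t powr p = \<omega> / N t"
        unfolding \<kappa>_def powr_powr using p elim(2) \<omega> by simp
      finally show "ev (sexp (cst p * sln (W t))) z = ev (cst (\<omega> / N t) * (\<rho> * sexp (cst p * sln (f t)))) z"
        unfolding ev_ring[OF z] ev_cst[OF z] \<rho>_def p_def[symmetric] powr_eq_ev[OF U z] powr_eq_ev[OF f_pos[OF elim(1)] z] .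
    qed
    then have "SI (sexp (cst p * sln (W t))) = \<omega>"
      using elim(2) by (simp add: SI_cst_mult N_def)
    then show ?case using V14_ev_iff[OF W m dim] elim(3) by (simp add: p_def \<omega>_def)
  qed
  obtain k \<epsilon> where \<epsilon>: "\<epsilon> > 0" "\<And>v. v \<in> V14 \<Longrightarrow> (\<And>bs z. set bs \<subseteq> Basis \<Longrightarrow> length bs \<le> k \<Longrightarrow> z \<in> sphere 0 1 \<Longrightarrow>
      \<bar>pdl bs (hext v) z - pdl bs (hext u) z\<bar> < \<epsilon>) \<Longrightarrow> Esig2 v \<ge> Esig2 u"
    using min unfolding local_min_V14_def by metis
  have W_close: "\<forall>\<^sub>F t in at 0. \<forall>bs z. set bs \<subseteq> Basis \<longrightarrow> length bs \<le> k \<longrightarrow> z \<in> sphere 0 1 \<longrightarrow>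
      \<bar>pdl bs (hext (ev (W t))) z - pdl bs (hext u) z\<bar> < \<epsilon>"
  proof -
    obtain M1 where M1: "M1 > 0" "\<And>bs z. set bs \<subseteq> Basis \<Longrightarrow> length bs \<le> k \<Longrightarrow> z \<in> sphere 0 1 \<Longrightarrow> \<bar>pdl bs (hext u) z\<bar> \<le> M1"
      using pdl_hext_bounded[OF us, of k] by blast
    obtain M2 where M2: "M2 > 0" "\<And>bs z. set bs \<subseteq> Basis \<Longrightarrow> length bs \<le> k \<Longrightarrow> z \<in> sphere 0 1 \<Longrightarrow> \<bar>pdl bs (hext (ev (U * y))) z\<bar> \<le> M2"
      using pdl_hext_bounded[OF smooth_ev, of k "U * y"] by blast
    have "((\<lambda>t. \<bar>\<kappa> t - 1\<bar> * M1 + \<bar>\<kappa> t * t\<bar> * M2) \<longlongrightarrow> \<bar>1 - 1\<bar> * M1 + \<bar>1 * 0\<bar> * M2) (at 0)"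
      by (intro tendsto_intros \<kappa>_lim)
    then have "\<forall>\<^sub>F t in at 0. \<bar>\<kappa> t - 1\<bar> * M1 + \<bar>\<kappa> t * t\<bar> * M2 < \<epsilon>"
      using \<epsilon>(1) by (intro order_tendstoD(2)) auto
    then show ?thesis
    proof eventually_elim
      case (elim t)
      show ?case
      proof (intro allI impI)
        fix bs :: "'a list" and z :: 'a assume bs: "set bs \<subseteq> Basis" "length bs \<le> k" and z: "z \<in> sphere 0 1"
        have z0: "z \<in> - {0}" using z by auto
        have "pdl bs (hext (ev (W t))) z = pdl bs (\<lambda>x. \<kappa> t * hext u x + (\<kappa> t * t) * hext (ev (U * y)) x) z"
        proof (rule pdl_cong[OF open_punct _ z0])
          fix x :: 'a assume "x \<in> - {0}"
          then have x: "x /\<^sub>R norm x \<in> sphere 0 1" by simp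
          show "hext (ev (W t)) x = \<kappa> t * hext u x + (\<kappa> t * t) * hext (ev (U * y)) x"
            unfolding hext_def W_def ev_ring[OF x] ev_cst[OF x] U_def ev_toS[OF us x] by (simp add: algebra_simps)
        qed
        also have "\<dots> = \<kappa> t * pdl bs (hext u) z + (\<kappa> t * t) * pdl bs (hext (ev (U * y))) z"
          by (rule pdl_lincomb[OF open_punct smooth_sphereD[OF us] smooth_sphereD[OF smooth_ev] bs(1) z0])
        finally have "pdl bs (hext (ev (W t))) z - pdl bs (hext u) z
            = (\<kappa> t - 1) * pdl bs (hext u) z + (\<kappa> t * t) * pdl bs (hext (ev (U * y))) z" by (simp add: algebra_simps)
        also have "\<bar>\<dots>\<bar> \<le> \<bar>\<kappa> t - 1\<bar> * M1 + \<bar>\<kappa> t * t\<bar> * M2"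
          by (rule order_trans[OF abs_triangle_ineq], unfold abs_mult[of "\<kappa> t - 1"] abs_mult[of "\<kappa> t * t"])
             (intro add_mono mult_left_mono M1(2) M2(2) bs z abs_ge_zero)
        finally show "\<bar>pdl bs (hext (ev (W t))) z - pdl bs (hext u) z\<bar> < \<epsilon>" using elim by simp
      qed
    qed
  qed
  \<comment> \<open>The reciprocal of \<kappa>^4 near 0: it turns minimality of the rescaled energy
    into a lower bound for the energy on the line, which is a polynomial in t.\<close>
  define h where "h t = (N t / \<omega>) powr (4 / p)" for t
  have EU: "EE U = e0"
    using expand[of 0] by (simp add: cst_hom)
  have E_ge: "\<forall>\<^sub>F t in at 0. EE (U + cst t * (U * y)) \<ge> e0 * h t"
    using W_V14 W_close N_pos
  proof eventually_elim
    case (elim t)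
    have "Esig2 u \<le> Esig2 (ev (W t))" using \<epsilon>(2)[OF elim(1)] elim(2) by blast
    moreover have "toS (ev (W t)) = W t"
      by (rule sfun_eqI) (simp only: ev_toS[OF smooth_ev])
    ultimately have le: "e0 \<le> (\<kappa> t) ^ 4 * EE (U + cst t * (U * y))"
      using EU unfolding Esig2_eq_EE[OF us] Esig2_eq_EE[OF smooth_ev] U_def[symmetric]
      by (simp add: W_def EE_scale)
    have one: "\<kappa> t ^ 4 * h t = 1"
    proof -
      have q: "\<omega> / N t > 0" "N t / \<omega> > 0" using elim(3) \<omega> by simp_all
      have "\<kappa> t ^ 4 = \<kappa> t powr 4" using q by (simp add: \<kappa>_def)
      also have "\<dots> = (\<omega> / N t) powr (4 / p)" unfolding \<kappa>_def powr_powr by simp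
      finally have "\<kappa> t ^ 4 * h t = (\<omega> / N t) powr (4 / p) * (N t / \<omega>) powr (4 / p)"
        by (simp only: h_def)
      also have "\<dots> = ((\<omega> / N t) * (N t / \<omega>)) powr (4 / p)"
        by (rule powr_mult[symmetric])
      finally have "\<kappa> t ^ 4 * h t = ((\<omega> / N t) * (N t / \<omega>)) powr (4 / p)" .
      then show ?thesis using elim(3) \<omega> by simp
    qed
    have "e0 * h t \<le> \<kappa> t ^ 4 * EE (U + cst t * (U * y)) * h t"
      by (rule mult_right_mono[OF le]) (simp add: h_def)
    also have "\<dots> = (\<kappa> t ^ 4 * h t) * EE (U + cst t * (U * y))" by (simp only: mult_ac)
    finally show ?case unfolding one by simp
  qed
  have h_lim: "((\<lambda>t. (h t - 1) / t\<^sup>2) \<longlongrightarrow> 4 / p * (A / \<omega>)) (at 0)"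
  proof -
    have "((\<lambda>x. x powr (4 / p)) has_real_derivative 4 / p) (at 1)"
      by (auto intro!: derivative_eq_intros)
    \<comment> \<open>Caratheodory's slope function stays meaningful when N t = \<omega>, where a
      difference quotient of the power would divide by zero.\<close>
    then obtain g where g: "\<And>x. x powr (4 / p) - 1 powr (4 / p) = g x * (x - 1)" "isCont g 1" "g 1 = 4 / p"
      unfolding CARAT_DERIV by blast
    have "((\<lambda>t. N t / \<omega>) \<longlongrightarrow> \<omega> / \<omega>) (at 0)" using \<omega> by (intro tendsto_intros N_lim) auto
    then have "((\<lambda>t. g (N t / \<omega>)) \<longlongrightarrow> g 1) (at 0)"
      using isCont_tendsto_compose[OF g(2)] \<omega> by simp
    then have "((\<lambda>t. g (N t / \<omega>) * ((N t - \<omega>) / t\<^sup>2 / \<omega>)) \<longlongrightarrow> 4 / p * (A / \<omega>)) (at 0)"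
      unfolding g(3) using \<omega> by (intro tendsto_intros N_expand) auto
    moreover have "g (N t / \<omega>) * ((N t - \<omega>) / t\<^sup>2 / \<omega>) = (h t - 1) / t\<^sup>2" for t
    proof -
      have "h t - 1 = g (N t / \<omega>) * (N t / \<omega> - 1)" using g(1)[of "N t / \<omega>"] by (simp add: h_def)
      also have "N t / \<omega> - 1 = (N t - \<omega>) / \<omega>" using \<omega> by (simp add: diff_divide_distrib)
      finally show ?thesis by (simp add: mult.commute)
    qed
    ultimately show ?thesis by simp
  qed
  \<comment> \<open>Adding the inequalities for t and -t cancels the odd terms, so a1 = 0 need not be known.\<close>
  have sym: "\<forall>\<^sub>F t in at 0. 2 * a2 + 2 * a4 * t\<^sup>2 \<ge> e0 * ((h t - 1) / t\<^sup>2 + (h (- t) - 1) / t\<^sup>2)"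
  proof -
    have nz: "\<forall>\<^sub>F t in at (0::real). t \<noteq> 0" by (simp add: eventually_at_filter)
    show ?thesis
      using E_ge eventually_compose_filterlim[OF E_ge filterlim_uminus_at_0] nz
    proof eventually_elim
      case (elim t)
      have "e0 * (h t - 1) + e0 * (h (- t) - 1) \<le> 2 * a2 * t\<^sup>2 + 2 * a4 * t ^ 4"
        using elim(1,2) unfolding expand by (simp add: algebra_simps)
      then have "(e0 * (h t - 1) + e0 * (h (- t) - 1)) / t\<^sup>2 \<le> (2 * a2 * t\<^sup>2 + 2 * a4 * t ^ 4) / t\<^sup>2"
        by (rule divide_right_mono) simp
      also have "\<dots> = 2 * a2 + 2 * a4 * t\<^sup>2"
        using elim(3) by (simp add: field_simps power2_eq_square power4_eq_xxxx)
      finally show ?case by (simp add: distrib_left add_divide_distrib)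
    qed
  qed
  have h_lim': "((\<lambda>t. (h (- t) - 1) / t\<^sup>2) \<longlongrightarrow> 4 / p * (A / \<omega>)) (at 0)"
    using filterlim_compose[OF h_lim filterlim_uminus_at_0] by simp
  define X where "X = 4 / p * (A / \<omega>)"
  have "e0 * (X + X) \<le> 2 * a2 + 2 * a4 * 0\<^sup>2"
    by (rule tendsto_le[OF _ _ _ sym]) (simp, intro tendsto_intros h_lim[folded X_def] h_lim'[folded X_def],
        intro tendsto_intros h_lim[folded X_def] h_lim'[folded X_def])
  then have "(2 * (p - 1)) * e0 * S / \<omega> \<le> a2"
  proof -
    have "e0 * X = (2 * (p - 1)) * e0 * S / \<omega>" using p \<omega> by (simp add: X_def A_def field_simps)
    then show ?thesis using \<open>e0 * (X + X) \<le> _\<close> by (simp add: distrib_left)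
  qed
  moreover have "2 * (p - 1) = 6 + 8 / m" using m by (simp add: p_def field_simps)
  ultimately show ?thesis by (simp add: S_def \<omega>_def)
qed

text \<open>The extension has zero derivative on the punctured space, which is connected in
  dimension at least two.\<close>

lemma constant_of_gradient_zero:
  fixes f :: "'a::euclidean_space sfun"
  assumes dim: "DIM('a) \<ge> 2" and grad: "\<And>z. z \<in> sphere 0 1 \<Longrightarrow> ev (Gm f f) z = 0"
  obtains c where "\<And>z. z \<in> sphere 0 1 \<Longrightarrow> ev f z = c"
proof -
  have D: "pd1 b (hext (ev f)) x = 0" if x: "x \<noteq> 0" and b: "b \<in> Basis" for x b
  proof -
    have z: "x /\<^sub>R norm x \<in> sphere 0 1" using x by simp
    have "sgrad (ev f) (x /\<^sub>R norm x) = 0" using grad[OF z] by (simp add: ev_Gm[OF z])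
    then have "pd1 b (hext (ev f)) (x /\<^sub>R norm x) = 0" using sgrad_inner[OF b, of "ev f" "x /\<^sub>R norm x"] by simp
    then show ?thesis using pd1_hext_sgn[OF smooth_ev x b, of f] x by simp
  qed
  have "connected (- {0::'a})"
    using connected_punctured_universe[OF dim, of 0] .
  moreover have "(hext (ev f) has_derivative (\<lambda>h. 0)) (at x)" if "x \<in> - {0}" for x
  proof -
    have "(\<lambda>h. \<Sum>b\<in>Basis. (h \<bullet> b) * pd1 b (hext (ev f)) x) = (\<lambda>h. 0)" using D that by simp
    then show ?thesis
      using smooth_on_has_derivative[OF open_punct that smooth_sphereD[OF smooth_ev[of f]]] by simp
  qed
  ultimately have "hext (ev f) x = hext (ev f) x'" if "x \<in> - {0}" "x' \<in> - {0}" for x x'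
    using has_derivative_zero_unique_connected[of "- {0}" "hext (ev f)" x x'] that by auto
  then have *: "ev f z = ev f z'" if "z \<in> sphere 0 1" "z' \<in> sphere 0 1" for z z'
    using that sphere_nonzero by (metis ComplI hext_sphere singletonD)
  obtain z0 :: 'a where "z0 \<in> sphere 0 1" by (rule sphere_nonempty)
  then show thesis using * by (intro that[of "ev f z0"])
qed

theorem theorem1p2:
  fixes u :: "'a::euclidean_space \<Rightarrow> real"
  assumes "DIM('a) \<ge> 6"
    and "local_min_V14 u"
  shows "\<exists>\<xi>\<in>ball (0::'a) 1. \<forall>\<zeta>\<in>sphere 0 1.
           u \<zeta> = ((1 + \<xi> \<bullet> \<zeta>) / sqrt (1 - (norm \<xi>)\<^sup>2)) powr (- (real DIM('a) - 1 - 4) / 4)"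
proof -
  define m where "m = (real DIM('a) - 5) / 4"
  have m: "m > 0" using assms(1) by (simp add: m_def)
  have dim: "real DIM('a) = 4 * m + 5" by (simp add: m_def field_simps)
  define U where "U = toS u"
  have uV: "u \<in> V14" using assms(2) by (simp add: local_min_V14_def)
  have U: "pos_on U" and UV: "ev U \<in> V14" and us: "smooth_sphere u"
    using V14_toS[OF uV] by (simp_all add: U_def)
  define p where "p = (4 * m + 4) / m"
  define \<rho> where "\<rho> = sexp (cst p * sln U)"
  have S\<rho>: "SI \<rho> = omega TYPE('a)" and RU: "pos_on (Rf m U)"
    using V14_ev_iff[OF U m dim] UV by (simp_all add: \<rho>_def p_def)
  have "pos_on \<rho>" unfolding \<rho>_def by (rule pos_sexp)
  from exists_balancing_point[OF this m dim] obtain \<xi> :: 'a where \<xi>: "norm \<xi> < 1"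
    and crit: "\<And>v. SI (\<rho> * conformal_factor.J \<xi> * coord v) / conformal_factor.s \<xi>
     + (\<xi> \<bullet> v) / (conformal_factor.s \<xi>)\<^sup>2 * SI \<rho> = 0" by blast
  interpret conformal_factor \<xi> m using \<xi> dim by unfold_locales
  have bal: "SI (\<rho> * y b) = 0" for b by (rule SI_balanced[OF crit])
  \<comment> \<open>U divided by P: the conformal factor of the same metric relative to Om^(-2) g0.
    The admissible direction U y becomes w y in this gauge.\<close>
  define w where "w = sexp (cst m * \<tau>) * U"
  have PU: "P * w = U"
    unfolding w_def P_def mult.assoc[symmetric] sexp_add[symmetric] by (simp add: cst_hom sexp_0)
  have w: "pos_on w"
    using U by (simp add: w_def pos_on_def ev_ring ev_sexp)
  have sv: "E2 w (y b * w) \<ge> (6 + 8 / m) * E' w * SI (\<rho> * (y b * y b)) / omega TYPE('a)" for b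
  proof -
    obtain a1 a3 a4 where ex: "\<And>t. E' (w + cst t * (y b * w)) = E' w + a1 * t + E2 w (y b * w) * t\<^sup>2 + a3 * t ^ 3 + a4 * t ^ 4"
      using E'_expand by blast
    have "U + cst t * (U * y b) = P * (w + cst t * (y b * w))" for t
      unfolding PU[symmetric] by (simp add: algebra_simps)
    then have "EE (U + cst t * (U * y b)) = E' w + a1 * t + E2 w (y b * w) * t\<^sup>2 + a3 * t ^ 3 + a4 * t ^ 4" for t
      by (simp only: EE_covariant ex)
    then show ?thesis
      unfolding U_def \<rho>_def p_def
      by (intro constrained_second_variation[OF assms(2) m dim bal[unfolded \<rho>_def p_def U_def]])
  qed
  \<comment> \<open>As the squares of the \<open>y\<close> sum to one and \<rho> has total mass
    \<omega>, the individual lower bounds add up to exactly (6 + 8/m) times the energy.\<close>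
  have "(6 + 8 / m) * E' w = (\<Sum>b\<in>Basis. (6 + 8 / m) * E' w * SI (\<rho> * (y b * y b)) / omega TYPE('a))"
  proof -
    have "(\<Sum>b\<in>Basis. SI (\<rho> * (y b * y b))) = omega TYPE('a)"
      unfolding SI_sum[symmetric] sum_distrib_left[symmetric] sum_y_y using S\<rho> by simp
    then have "(\<Sum>b\<in>Basis. (6 + 8 / m) * E' w * SI (\<rho> * (y b * y b)) / omega TYPE('a))
        = (6 + 8 / m) * E' w * omega TYPE('a) / omega TYPE('a)"
      by (simp only: sum_divide_distrib[symmetric] sum_distrib_left[symmetric])
    then show ?thesis using omega_pos[where 'a = 'a] by simp
  qed
  also have "\<dots> \<le> (\<Sum>b\<in>Basis. E2 w (y b * w))" by (rule sum_mono) (rule sv)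
  finally have sv_sum: "(\<Sum>b\<in>Basis. E2 w (y b * w)) \<ge> (6 + 8 / m) * E' w" .
  have grad: "ev (Gm w w) z = 0" if "z \<in> sphere 0 1" for z
  proof (rule gradient_vanishes[OF m _ sv_sum w that])
    show "ev (Rf m (P * w)) z > 0" if "z \<in> sphere 0 1" for z
      using RU that unfolding PU pos_on_def by blast
  qed
  obtain c where c: "\<And>z. z \<in> sphere 0 1 \<Longrightarrow> ev w z = c"
    using constant_of_gradient_zero[OF _ grad] assms(1) by auto
  obtain z0 :: 'a where z0: "z0 \<in> sphere 0 1" by (rule sphere_nonempty)
  have c0: "c > 0" using w z0 c unfolding pos_on_def by metis
  have Uz: "ev U z = c * ev Om z powr (- m)" if z: "z \<in> sphere 0 1" for z
  proof -
    have "ev P z = ev Om z powr (- m)"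
      using ev_Om_pos[OF z] by (simp add: P_def ev_sexp[OF z] ev_ring[OF z] ev_cst[OF z] \<tau>_def ev_sln[OF _ z] pos_on_def ev_Om_pos powr_def)
    then show ?thesis unfolding PU[symmetric] ev_ring[OF z] c[OF z] by simp
  qed
  \<comment> \<open>For constant w the constraint density is c^p times the volume density of Om^(-2)
    g0. Both densities have integral \<omega>, which forces c = 1.\<close>
  have "\<rho> = cst (c powr p) * (P4 * (j * j))"
  proof (rule sfun_eqI)
    fix z :: 'a assume z: "z \<in> sphere 0 1"
    have O: "ev Om z > 0" by (rule ev_Om_pos[OF z])
    have tz: "ev \<tau> z = ln (ev Om z)" unfolding \<tau>_def by (rule ev_sln[OF _ z]) (simp add: pos_on_def ev_Om_pos)
    have "ev \<rho> z = (c * ev Om z powr (- m)) powr p"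
      unfolding \<rho>_def powr_eq_ev[OF U z, symmetric] Uz[OF z] ..
    also have "\<dots> = c powr p * ev Om z powr (- (4 * m + 4))"
      using c0 O m by (simp add: powr_mult powr_powr p_def)
    also have "ev Om z powr (- (4 * m + 4)) = ev (P4 * (j * j)) z"
      unfolding volume_density ev_sexp[OF z] ev_ring[OF z] ev_cst[OF z] tz using O by (simp add: powr_def)
    finally show "ev \<rho> z = ev (cst (c powr p) * (P4 * (j * j))) z"
      by (simp add: ev_ring[OF z] ev_cst[OF z])
  qed
  then have "c powr p = 1"
    using S\<rho> SI_volume[OF m] omega_pos[where 'a = 'a] by (simp add: SI_cst_mult)
  then have "p * ln c = 0" using c0 by (metis ln_one ln_powr)
  moreover have "p \<noteq> 0" using m by (simp add: p_def)
  ultimately have c1: "c = 1" using c0 by simp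
  show ?thesis
  proof (intro bexI ballI)
    fix z :: 'a assume z: "z \<in> sphere 0 1"
    have "u z = ev U z" using ev_toS[OF us z] by (simp add: U_def)
    also have "\<dots> = ev Om z powr (- m)" using Uz[OF z] c1 by simp
    also have "ev Om z = (1 + \<xi> \<bullet> z) / sqrt (1 - (norm \<xi>)\<^sup>2)"
      using ev_Om[OF z] by (simp add: s_def inner_commute)
    also have "- m = - (real DIM('a) - 1 - 4) / 4" by (simp add: m_def field_simps)
    finally show "u z = ((1 + \<xi> \<bullet> z) / sqrt (1 - (norm \<xi>)\<^sup>2)) powr (- (real DIM('a) - 1 - 4) / 4)" .
  qed (use \<xi> in simp)
qed

end
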